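(* Let $a,b\in\mathbb Q$ with $a\neq 0$ and $d:=d(a,b)\neq 0$, and assume the curves $E_{a,b}$, $E^\ast_{a,b}$ below are nonsingular. Then: (1) For every rational point $P\in E_{a,b}(\mathbb Q)$ other than the point at infinity, the polynomial $\mathrm{Bru}(P;X)$ is reducible over $\mathbb Q$ if and only if $P\in\phi^\ast(E^\ast_{a,b}(\mathbb Q))$. (2) The quotient $E_{a,b}(\mathbb Q)/\phi^\ast(E^\ast_{a,b}(\mathbb Q))$ is finite, and the correspondence $P\mapsto \mathrm{Bru}(P;X)$ induces a bijection between the set of subgroups of order $5$ of $E_{a,b}(\mathbb Q)/\phi^\ast(E^\ast_{a,b}(\mathbb Q))$ and the set $\{\mathrm{Spl}_{\mathbb Q}(\mathrm{Bru}(P;X)) : P\in E_{a,b}(\mathbb Q)\setminus \phi^\ast(E^\ast_{a,b}(\mathbb Q))\}$ of splitting fields over $\mathbb Q$. (Concretely, a subgroup $\langle \bar P\rangle$ of order 5 is sent to $\mathrm{Spl}_{\mathbb Q}(\mathrm{Bru}(P;X))$, which depends only on the subgroup.)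
   Context: Brumer's quintic: $\mathrm{Bru}(a,b;X):=X^5+(a-3)X^4-(a-b-3)X^3+(a^2-a-2b-1)X^2+bX+a$. Put $d(a,b):=-4b^3+(a^2-30a+1)b^2+2a(3a+1)(4a-7)b-a(4a^4-4a^3-40a^2+91a-4)$, $d:=d(a,b)$, and $k:=\mathbb Q(\sqrt d)$. $\mathrm{Spl}_{\mathbb Q}(g)$ denotes the splitting field of $g$ over $\mathbb Q$. Curves over $\mathbb Q$: $E_{a,b}: y^2=x^3+d(a^2-30a+1)x^2-8d^2a(3a+1)(4a-7)x-16d^3a(4a^4-4a^3-40a^2+91a-4)$; $E^\ast_{a,b}: y^2=x^3+(a^2-30a+1)dx^2-8(26a^4-310a^3+327a^2+315a+26)d^2x+16(68a^6-1120a^5+3804a^4+1760a^3+6929a^2+1380a+68)d^3$; $E^\ast_a: y^2-(a-1)xy-ay=x^3-ax^2$ (on which $(0,0)$ is a rational point of order 5); $E_a: y^2-(a-1)xy-ay=x^3-ax^2-5a(a^2+2a-1)x-a(a^4+10a^3-5a^2+15a-1)$. $\lambda^\ast:E^\ast_a\to E_a$ is the degree-5 isogeny over $\mathbb Q$ with kernel $\langle(0,0)\rangle$; on $x$-coordinates it is $x\mapsto N(x)/D(x)$ with $N(x)=x^5-2ax^4+a(a^2+3a-1)x^3-3a^2(a-1)x^2+a^3(a-3)x+a^4$, $D(x)=x^2(x-a)^2$. Isomorphisms defined over $k$: $f:E_{a,b}\to E_a$, $(x,y)\mapsto\big(\tfrac{x}{4d}-2a,\ \tfrac{a-1}{8d}x+\tfrac{1}{8d\sqrt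 d}y-\tfrac{a(2a-3)}{2}\big)$, and $f^\ast:E^\ast_{a,b}\to E^\ast_a$, $(x,y)\mapsto\big(\tfrac{x}{100d}-\tfrac{2(a^2-5a+1)}{25},\ \tfrac{a-1}{200d}x+\tfrac{1}{1000d\sqrt d}y-\tfrac{2a^3-12a^2-13a-2}{50}\big)$. $\phi^\ast:E^\ast_{a,b}\to E_{a,b}$ is the degree-5 isogeny defined over $\mathbb Q$ satisfying $f\circ\phi^\ast=\lambda^\ast\circ f^\ast$ (it is the dual of a degree-5 $\mathbb Q$-isogeny $\phi:E_{a,b}\to E^\ast_{a,b}$). For $P=(x(P),y(P))\in E_{a,b}(\mathbb Q)$, $\mathrm{Bru}(P;X):=\mathrm{Bru}\big(a,\tfrac{x(P)}{-4d};X\big)$. *)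

theory Defs
  imports Complex_Main "HOL-Computational_Algebra.Polynomial" "HOL-Computational_Algebra.Factorial_Ring"
    "HOL-Algebra.Coset"
begin

datatype 'a ecpt = Inf | Pt 'a 'a

definition on_curve :: "'a::field \<Rightarrow> 'a \<Rightarrow> 'a \<Rightarrow> 'a ecpt \<Rightarrow> bool" where
  "on_curve A2 A4 A6 P = (case P of Inf \<Rightarrow> True
     | Pt x y \<Rightarrow> y^2 = x^3 + A2*x^2 + A4*x + A6)"

definition nonsingular :: "rat \<Rightarrow> rat \<Rightarrow> rat \<Rightarrow> bool" where
  "nonsingular A2 A4 A6 = (\<not> (\<exists>x y :: complex.
      y^2 = x^3 + of_rat A2*x^2 + of_rat A4*x + of_rat A6
    \<and> 3*x^2 + 2*of_rat A2*x + of_rat A4 = 0 \<and> 2*y = 0))"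

definition ec_add :: "'a::field \<Rightarrow> 'a \<Rightarrow> 'a ecpt \<Rightarrow> 'a ecpt \<Rightarrow> 'a ecpt" where
  "ec_add A2 A4 P Q = (case P of Inf \<Rightarrow> Q | Pt x1 y1 \<Rightarrow>
     (case Q of Inf \<Rightarrow> P | Pt x2 y2 \<Rightarrow>
       (if x1 = x2 \<and> y1 = - y2 then Inf else
        (let l = (if x1 \<noteq> x2 then (y2 - y1) / (x2 - x1)
                  else (3*x1^2 + 2*A2*x1 + A4) / (2*y1));
             x3 = l^2 - A2 - x1 - x2
         in Pt x3 (- (y1 + l*(x3 - x1)))))))"

definition ec_group :: "rat \<Rightarrow> rat \<Rightarrow> rat \<Rightarrow> rat ecpt monoid" where
  "ec_group A2 A4 A6 = \<lparr>carrier = {P. on_curve A2 A4 A6 P}, mult = ec_add A2 A4, one = Inf\<rparr>"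

definition dd :: "rat \<Rightarrow> rat \<Rightarrow> rat" where
  "dd a b = -4*b^3 + (a^2 - 30*a + 1)*b^2 + 2*a*(3*a+1)*(4*a-7)*b
            - a*(4*a^4 - 4*a^3 - 40*a^2 + 91*a - 4)"

definition EA2 :: "rat \<Rightarrow> rat \<Rightarrow> rat" where "EA2 a b = dd a b * (a^2 - 30*a + 1)"
definition EA4 :: "rat \<Rightarrow> rat \<Rightarrow> rat" where "EA4 a b = -8*(dd a b)^2*a*(3*a+1)*(4*a-7)"
definition EA6 :: "rat \<Rightarrow> rat \<Rightarrow> rat" where
  "EA6 a b = -16*(dd a b)^3*a*(4*a^4 - 4*a^3 - 40*a^2 + 91*a - 4)"

definition SA2 :: "rat \<Rightarrow> rat \<Rightarrow> rat" where "SA2 a b = (a^2 - 30*a + 1) * dd a b"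
definition SA4 :: "rat \<Rightarrow> rat \<Rightarrow> rat" where
  "SA4 a b = -8*(26*a^4 - 310*a^3 + 327*a^2 + 315*a + 26)*(dd a b)^2"
definition SA6 :: "rat \<Rightarrow> rat \<Rightarrow> rat" where
  "SA6 a b = 16*(68*a^6 - 1120*a^5 + 3804*a^4 + 1760*a^3 + 6929*a^2 + 1380*a + 68)*(dd a b)^3"

definition Eab :: "rat \<Rightarrow> rat \<Rightarrow> rat ecpt monoid" where
  "Eab a b = ec_group (EA2 a b) (EA4 a b) (EA6 a b)"
definition Estar :: "rat \<Rightarrow> rat \<Rightarrow> rat ecpt monoid" where
  "Estar a b = ec_group (SA2 a b) (SA4 a b) (SA6 a b)"

text \<open>x-coordinate map of lambda*: N(x)/D(x)\<close>
definition lamN :: "rat \<Rightarrow> rat \<Rightarrow> rat" where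
  "lamN a x = x^5 - 2*a*x^4 + a*(a^2 + 3*a - 1)*x^3 - 3*a^2*(a-1)*x^2 + a^3*(a-3)*x + a^4"
definition lamD :: "rat \<Rightarrow> rat \<Rightarrow> rat" where
  "lamD a x = x^2 * (x - a)^2"

text \<open>x-coordinates of f* (E*_{a,b} to E*_a) and inverse of f (E_a to E_{a,b});
  both are rational although f, f* are only defined over Q(sqrt d).\<close>
definition fstar_x :: "rat \<Rightarrow> rat \<Rightarrow> rat \<Rightarrow> rat" where
  "fstar_x a b x = x / (100 * dd a b) - 2*(a^2 - 5*a + 1)/25"
definition finv_x :: "rat \<Rightarrow> rat \<Rightarrow> rat \<Rightarrow> rat" where
  "finv_x a b u = 4 * dd a b * (u + 2*a)"

text \<open>The image phi*(E*_{a,b}(Q)) in E_{a,b}(Q).  Since f o phi* = lambda* o f*, phi* is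
  determined on x-coordinates by the above maps; phi* sends Q to the point at infinity iff
  Q = O or D(x(f* Q)) = 0, and otherwise phi*(Q) is one of the two points of E_{a,b}(Q) with
  the computed x-coordinate.  As the image is a subgroup (closed under negation), it is
  exactly the following set.\<close>
definition phi_img :: "rat \<Rightarrow> rat \<Rightarrow> rat ecpt set" where
  "phi_img a b = {Inf} \<union> {P \<in> carrier (Eab a b). \<exists>x y x' y'. P = Pt x y \<and>
      Pt x' y' \<in> carrier (Estar a b) \<and> lamD a (fstar_x a b x') \<noteq> 0 \<and>
      x = finv_x a b (lamN a (fstar_x a b x') / lamD a (fstar_x a b x'))}"

definition Bru :: "rat \<Rightarrow> rat \<Rightarrow> rat poly" where
  "Bru a b = [:a, b, a^2 - a - 2*b - 1, -(a - b - 3), a - 3, 1:]"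

definition BruP :: "rat \<Rightarrow> rat \<Rightarrow> rat ecpt \<Rightarrow> rat poly" where
  "BruP a b P = (case P of Inf \<Rightarrow> 0 | Pt x y \<Rightarrow> Bru a (x / (- 4 * dd a b)))"

definition is_subfield_complex :: "complex set \<Rightarrow> bool" where
  "is_subfield_complex K = (0 \<in> K \<and> 1 \<in> K \<and> (\<forall>x\<in>K. \<forall>y\<in>K. x + y \<in> K \<and> x * y \<in> K)
      \<and> (\<forall>x\<in>K. - x \<in> K) \<and> (\<forall>x\<in>K. x \<noteq> 0 \<longrightarrow> inverse x \<in> K))"

definition Spl :: "rat poly \<Rightarrow> complex set" where
  "Spl g = \<Inter> {K. is_subfield_complex K \<and> {z. poly (map_poly of_rat g) z = 0} \<subseteq> K}"

end

theory Submission
  imports Defs "HOL-Computational_Algebra.Fundamental_Theorem_Algebra"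
begin

text \<open>
The roots of Brumer's quintic are \<open>- u\<^sub>0, \<dots>, - u\<^sub>4\<close> for a 5-periodic Lyness cycle
\<open>u\<^sub>j\<^sub>-\<^sub>1 u\<^sub>j\<^sub>+\<^sub>1 = 1 + u\<^sub>j\<close>. Under \<open>X = a / x\<close> they are the fibre of the isogeny over \<open>P\<close>,
and the shift of the cycle is translation by the point \<open>(0, 0)\<close> of order 5. The fifth power of the
resolvent \<open>h = \<Sum> \<zeta>\<^sup>j u\<^sub>j\<close> is a function \<open>g(P)\<close> on \<open>E\<close> with divisor \<open>5T - 5O\<close>, so that
\<open>P \<mapsto> g(P)\<close> is a homomorphism to \<open>N\<^sup>* / N\<^sup>*\<^sup>5\<close> with \<open>N = \<rat>(\<zeta>, \<surd>d)\<close>; its kernel is the image of the isogeny,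
because a fifth root of \<open>g(P)\<close> in \<open>N\<close> would be fixed by the shift although the shift multiplies \<open>h\<close> by a
root of unity. Hence the fibres of \<open>g\<close> are the cosets, and comparing splitting fields becomes Kummer theory.
Finiteness is a descent in a quartic order: away from finitely many primes \<open>g(P)\<close> is the fifth power of an
ideal, and a lattice point argument replaces it, modulo fifth powers, by an integer all of whose conjugates are bounded.
\<close>

section \<open>Lyness cycles\<close>

text \<open>On E* the function \<open>x\<close> vanishes exactly at the points (0, 0) and -(0, 0),
  so each entry of the cycle has two simple poles, both in the kernel of the isogeny, and
  \<open>h\<close> has at most simple poles at the five kernel points. As the shift multiplies
  \<open>h\<close> by a root of unity, \<open>h^5\<close> descends to a function on E whose only
  pole is O, of order at most 5; this is the origin of \<open>g\<close>. That \<open>g\<close> is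
  multiplicative is Weil reciprocity for \<open>g\<close> and a line, here a resultant identity. The
  obstacle is that \<open>a\<close> and \<open>t\<close> do not see the orientation of the cycle:
  reversing it keeps both and negates the ordinate. Adjoining the square root of \<open>d\<close>
  fixes the orientation, and adjoining \<zeta> allows Kummer theory. Both are done by quadratic
  steps, which are harmless for quintics because 2 is prime to 5. For finiteness a smaller field
  suffices: the ordinate enters \<open>g\<close> only multiplied by
  \<open>s = \<zeta> - \<zeta>^4\<close>, so the values of \<open>g\<close> lie in a cyclic quartic
  field generated by a multiple of \<open>s\<close> times the square root of \<open>d\<close>.
  Bounding all conjugates there deals with ideal classes and units in one stroke.\<close>

definition bru_disc :: "'a::field \<Rightarrow> 'a \<Rightarrow> 'a" where
  "bru_disc a t = -4*t^3 + (a^2 - 30*a + 1)*t^2 + 2*a*(3*a+1)*(4*a-7)*t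
            - a*(4*a^4 - 4*a^3 - 40*a^2 + 91*a - 4)"

definition bru_poly :: "'a::field \<Rightarrow> 'a \<Rightarrow> 'a poly" where
  "bru_poly a t = [:a, t, a^2 - a - 2*t - 1, -(a - t - 3), a - 3, 1:]"

definition lyness :: "(nat \<Rightarrow> 'a::field) \<Rightarrow> bool" where
  "lyness u \<longleftrightarrow> (\<forall>j. u j \<noteq> 0 \<and> u j * u (j+2) = 1 + u (j+1))"

definition ly_a :: "(nat \<Rightarrow> 'a::field) \<Rightarrow> 'a" where
  "ly_a u = u 0 * u 1 * u 2 * u 3 * u 4"

definition ly_t :: "(nat \<Rightarrow> 'a::field) \<Rightarrow> 'a" where
  "ly_t u = u 1 * u 2 * u 3 * u 4 + u 0 * u 2 * u 3 * u 4 + u 0 * u 1 * u 3 * u 4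
    + u 0 * u 1 * u 2 * u 4 + u 0 * u 1 * u 2 * u 3"

definition ly_y :: "(nat \<Rightarrow> 'a::field) \<Rightarrow> 'a" where
  "ly_y u = (u 0 - u 1) * (u 1 - u 2) * (u 2 - u 3) * (u 3 - u 4) * (u 4 - u 0)"

text \<open>In a cycle with \<open>u 0 = p\<close> the entries \<open>u 2\<close> and
  \<open>u 3\<close> opposite to \<open>p\<close> have this sum and, since
  \<open>u 4 * u 1 = 1 + p\<close>, the product \<open>ctr_prod\<close>. \<open>ctr_fac\<close> is
  the product of the other four differences in \<open>ly_y\<close>; it is symmetric under reflection
  about \<open>p\<close>, hence rational in \<open>a\<close> and \<open>p\<close>.\<close>

definition ctr_sum :: "'a::field \<Rightarrow> 'a \<Rightarrow> 'a" where "ctr_sum a p = (a - 1 - p) / (1 + p)"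
definition ctr_prod :: "'a::field \<Rightarrow> 'a \<Rightarrow> 'a" where "ctr_prod a p = a / (p * (1 + p))"
definition ctr_fac :: "'a::field \<Rightarrow> 'a \<Rightarrow> 'a" where
  "ctr_fac a p = - (p^2 + p + 1 - p * (p * ctr_sum a p - 2)) * (1 - p + ctr_sum a p - ctr_prod a p)"

text \<open>The quintic is linear in \<open>t\<close>, so a root \<open>-p\<close> determines
  \<open>t\<close> rationally and an identity in \<open>a\<close> and \<open>p\<close> remains. It
  relates the square class of \<open>bru_disc a t\<close> to the discriminant of the opposite
  pair.\<close>

lemma bru_disc_ctr:
  fixes a p t :: "'a::field_char_0"
  assumes p: "p \<noteq> 0" "1 + p \<noteq> 0" and root: "poly (bru_poly a t) (-p) = 0"
  shows "bru_disc a t = ((ctr_sum a p)^2 - 4 * ctr_prod a p) * (ctr_fac a p)^2"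
proof -
  have "t * (p*(1+p)^2) = a + (a^2-a-1)*p^2 + (a-3)*p^3 + (a-3)*p^4 - p^5"
    using root unfolding bru_poly_def by simp algebra
  then have t: "t = (a + (a^2-a-1)*p^2 + (a-3)*p^3 + (a-3)*p^4 - p^5) / (p*(1+p)^2)"
    using p by (metis no_zero_divisors nonzero_eq_divide_eq power_not_zero)
  have [simp]: "p + p^2 \<noteq> 0" using p by (metis mult_eq_0_iff distrib_left mult.right_neutral power2_eq_square)
  show ?thesis
    unfolding bru_disc_def ctr_fac_def t ctr_sum_def ctr_prod_def
    using p by (simp add: divide_simps) algebra
qed

lemma lynessD:
  assumes "lyness u"
  shows "u j \<noteq> 0" "u j * u (j+2) = 1 + u (j+1)"
  using assms unfolding lyness_def by auto

lemma lyness_period: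
  assumes "lyness u"
  shows "u (j+5) = u j"
proof -
  note nz = lynessD(1)[OF assms]
  have 0: "u j * u (j+2) = 1 + u (j+1)" and 1: "u (j+1) * u (j+3) = 1 + u (j+2)"
    and 2: "u (j+2) * u (j+4) = 1 + u (j+3)" and 3: "u (j+3) * u (j+5) = 1 + u (j+4)"
    using lynessD(2)[OF assms, of j] lynessD(2)[OF assms, of "j+1"]
      lynessD(2)[OF assms, of "j+2"] lynessD(2)[OF assms, of "j+3"] by (simp_all add: eval_nat_numeral)
  have "u (j+1) * u (j+2) * u (j+3) * (u (j+5) - u j) = 0"
    using 0 1 2 3 by algebra
  then show ?thesis using nz by simp
qed

lemma lyness_rels:
  assumes "lyness u"
  shows "u 0 * u 2 = 1 + u 1" "u 1 * u 3 = 1 + u 2" "u 2 * u 4 = 1 + u 3"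
    "u 3 * u 0 = 1 + u 4" "u 4 * u 1 = 1 + u 0" "u 0 \<noteq> 0" "u 1 \<noteq> 0" "u 2 \<noteq> 0" "u 3 \<noteq> 0" "u 4 \<noteq> 0"
  using lynessD(2)[OF assms, of 0] lynessD(2)[OF assms, of 1] lynessD(2)[OF assms, of 2]
    lynessD(2)[OF assms, of 3] lynessD(2)[OF assms, of 4] lyness_period[OF assms, of 0]
    lyness_period[OF assms, of 1] lynessD(1)[OF assms]
  by (simp_all add: eval_nat_numeral)

lemma lyness_solve:
  assumes "lyness u"
  shows "u 2 = (1 + u 1) / u 0" "u 3 = (1 + u 0 + u 1) / (u 0 * u 1)" "u 4 = (1 + u 0) / u 1"
proof -
  note r = lyness_rels[OF assms]
  show "u 2 = (1 + u 1) / u 0" "u 4 = (1 + u 0) / u 1"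
    using r by (simp_all add: field_simps)
  have "u 3 * (u 0 * u 1) = 1 + u 0 + u 1" using r(1,2,6) by algebra
  then show "u 3 = (1 + u 0 + u 1) / (u 0 * u 1)" using r by (simp add: field_simps)
qed

lemma lyness_shift:
  assumes "lyness u"
  shows "lyness (\<lambda>j. u (j+k))"
proof -
  have "u (j+k) \<noteq> 0 \<and> u (j+k) * u (j+k+2) = 1 + u (j+k+1)" for j
    using lynessD[OF assms, of "j+k"] by blast
  then show ?thesis unfolding lyness_def by (simp add: ac_simps)
qed

lemma ly_shift:
  assumes "lyness u"
  shows "ly_a (\<lambda>j. u (j+k)) = ly_a u" "ly_t (\<lambda>j. u (j+k)) = ly_t u" "ly_y (\<lambda>j. u (j+k)) = ly_y u"
proof -
  have *: "ly_a (\<lambda>j. u (j+k)) = ly_a u \<and> ly_t (\<lambda>j. u (j+k)) = ly_t u \<and> ly_y (\<lambda>j. u (j+k)) = ly_y u"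
  proof (induction k)
    case (Suc k)
    let ?v = "\<lambda>j. u (j+k)"
    have "?v 5 = ?v 0" using lyness_period[OF assms, of k] by (simp add: ac_simps)
    then have e: "u (5+k) = u k" by simp
    have "ly_a (\<lambda>j. u (j + Suc k)) = ly_a ?v \<and> ly_t (\<lambda>j. u (j + Suc k)) = ly_t ?v \<and> ly_y (\<lambda>j. u (j + Suc k)) = ly_y ?v"
      using e by (simp add: ly_a_def ly_t_def ly_y_def eval_nat_numeral algebra_simps)
    with Suc show ?case by simp
  qed simp
  show "ly_a (\<lambda>j. u (j+k)) = ly_a u" "ly_t (\<lambda>j. u (j+k)) = ly_t u" "ly_y (\<lambda>j. u (j+k)) = ly_y u"
    using * by auto
qed

lemma lyness_esym:
  assumes "lyness u"
  shows "u 0 + u 1 + u 2 + u 3 + u 4 = ly_a u - 3"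
    "u 0 * u 1 + u 0 * u 2 + u 0 * u 3 + u 0 * u 4 + u 1 * u 2 + u 1 * u 3 + u 1 * u 4
     + u 2 * u 3 + u 2 * u 4 + u 3 * u 4 = - (ly_a u - ly_t u - 3)"
    "u 0 * u 1 * u 2 + u 0 * u 1 * u 3 + u 0 * u 1 * u 4 + u 0 * u 2 * u 3 + u 0 * u 2 * u 4
     + u 0 * u 3 * u 4 + u 1 * u 2 * u 3 + u 1 * u 2 * u 4 + u 1 * u 3 * u 4 + u 2 * u 3 * u 4
     = (ly_a u)^2 - ly_a u - 2 * ly_t u - 1"
  unfolding ly_a_def ly_t_def using lyness_rels(1-5)[OF assms] by algebra+

lemma bru_poly_lyness:
  assumes "lyness u"
  shows "bru_poly (ly_a u) (ly_t u) = [:u 0, 1:] * [:u 1, 1:] * [:u 2, 1:] * [:u 3, 1:] * [:u 4, 1:]"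
  unfolding bru_poly_def using lyness_esym[OF assms] by (simp add: ly_a_def ly_t_def algebra_simps)

lemma lyness_centre:
  fixes u :: "nat \<Rightarrow> 'a::field_char_0"
  assumes "lyness u"
  defines "a \<equiv> ly_a u" and "p \<equiv> u 0"
  shows "1 + p \<noteq> 0" "u 2 + u 3 = ctr_sum a p" "u 2 * u 3 = ctr_prod a p" "ly_y u = (u 2 - u 3) * ctr_fac a p"
proof -
  note r = lyness_rels[OF assms(1)]
  show n: "1 + p \<noteq> 0" using r unfolding p_def by (metis no_zero_divisors)
  have "(u 2 + u 3) * (1 + p) = a - 1 - p" unfolding a_def p_def ly_a_def using r(1-5) by algebra
  then show S: "u 2 + u 3 = ctr_sum a p" using n by (simp add: ctr_sum_def nonzero_eq_divide_eq)
  have "(u 2 * u 3) * (p * (1 + p)) = a" unfolding a_def p_def ly_a_def using r(1-5) by algebra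
  then show P: "u 2 * u 3 = ctr_prod a p" using n r(6) by (simp add: ctr_prod_def nonzero_eq_divide_eq p_def)
  have "ly_y u = (u 2 - u 3) * - (p^2 + p + 1 - p * (p * (u 2 + u 3) - 2)) * (1 - p + (u 2 + u 3) - u 2 * u 3)"
    unfolding ly_y_def p_def using r(1-5) by algebra
  then show "ly_y u = (u 2 - u 3) * ctr_fac a p" unfolding ctr_fac_def S P by (simp add: algebra_simps)
qed

lemma poly_bru_poly_lyness:
  assumes "lyness u"
  shows "poly (bru_poly (ly_a u) (ly_t u)) x = (u 0 + x) * (u 1 + x) * (u 2 + x) * (u 3 + x) * (u 4 + x)"
  unfolding bru_poly_lyness[OF assms] poly_mult by simp

lemma bru_root_nz:
  fixes a t p :: "'a::field_char_0"
  assumes a: "a \<noteq> 0" and root: "poly (bru_poly a t) (-p) = 0"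
  shows "p \<noteq> 0" "1 + p \<noteq> 0"
proof -
  show "p \<noteq> 0" using root a by (auto simp: bru_poly_def)
  show "1 + p \<noteq> 0"
  proof
    assume "1 + p = 0"
    then have "-p = 1" by algebra
    then have "a^2 = 0" using root by (simp add: bru_poly_def algebra_simps)
    with a show False by simp
  qed
qed

text \<open>The opposite pair consists of the roots of a quadratic, and the square root
  \<open>q\<close> of its discriminant orders the pair. The neighbours of \<open>p\<close> follow
  from the recursion; passing to \<open>-q\<close> reverses the cycle and negates
  \<open>ly_y\<close>.\<close>

lemma lyness_of_pair:
  fixes a t p q :: "'a::field_char_0"
  assumes a: "a \<noteq> 0" and root: "poly (bru_poly a t) (-p) = 0"
    and q: "q^2 = (ctr_sum a p)^2 - 4 * ctr_prod a p"
  obtains u where "lyness u" "ly_a u = a" "ly_t u = t" "ly_y u = q * ctr_fac a p" "u 0 = p"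
    "u 2 = (ctr_sum a p + q)/2" "u 3 = (ctr_sum a p - q)/2"
proof -
  note p = bru_root_nz(1)[OF a root] and n = bru_root_nz(2)[OF a root]
  define u2 where "u2 = (ctr_sum a p + q)/2"
  define u3 where "u3 = (ctr_sum a p - q)/2"
  define u1 where "u1 = p * u2 - 1"
  define u4 where "u4 = p * u3 - 1"
  define u where "u = (\<lambda>j::nat. [p, u1, u2, u3, u4] ! (j mod 5))"
  have S: "u2 + u3 = ctr_sum a p" by (simp add: u2_def u3_def field_simps)
  have "4 * (u2 * u3) = (ctr_sum a p)^2 - q^2" unfolding u2_def u3_def by (simp add: field_simps power2_eq_square)
  then have P: "u2 * u3 = ctr_prod a p" using q by simp
  have S': "(u2 + u3) * (1 + p) = a - 1 - p" using n unfolding S ctr_sum_def by simp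
  have P': "(u2 * u3) * (p * (1 + p)) = a" using n p unfolding P ctr_prod_def by simp
  have r0: "p * u2 = 1 + u1" and r3: "u3 * p = 1 + u4" by (simp_all add: u1_def u4_def)
  have "(u1 * u3) * (1 + p) = (1 + u2) * (1 + p)" using S' P' r0 by algebra
  then have r1: "u1 * u3 = 1 + u2" using n by simp
  have "(u2 * u4) * (1 + p) = (1 + u3) * (1 + p)" using S' P' r3 by algebra
  then have r2: "u2 * u4 = 1 + u3" using n by simp
  have "(u4 * u1) * (1 + p) = (1 + p) * (1 + p)" using S' P' r0 r3 by algebra
  then have r4: "u4 * u1 = 1 + p" using n by simp
  have nz: "u1 \<noteq> 0" "u2 \<noteq> 0" "u3 \<noteq> 0" "u4 \<noteq> 0" using r4 n P' a by auto
  have L: "[p, u1, u2, u3, u4] ! i \<noteq> 0 \<and>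
      [p, u1, u2, u3, u4] ! i * [p, u1, u2, u3, u4] ! ((i+2) mod 5) = 1 + [p, u1, u2, u3, u4] ! ((i+1) mod 5)"
    if "i < 5" for i
  proof -
    consider "i = 0" | "i = 1" | "i = 2" | "i = 3" | "i = 4" using \<open>i < 5\<close> by linarith
    then show ?thesis using p nz r0 r1 r2 r3 r4 by cases simp_all
  qed
  have "u j \<noteq> 0 \<and> u j * u (j+2) = 1 + u (j+1)" for j
    using L[of "j mod 5"] unfolding u_def by (simp add: mod_simps del: nth_Cons_numeral)
  then have ly: "lyness u" by (simp add: lyness_def)
  have v: "u 0 = p" "u 1 = u1" "u 2 = u2" "u 3 = u3" "u 4 = u4" by (simp_all add: u_def)
  have "ly_a u = (u2 * u3) * (p * (u4 * u1))" unfolding ly_a_def v by (simp add: ac_simps)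
  then have A: "ly_a u = a" using P' r4 by simp
  \<comment> \<open>At \<open>-p\<close> the quintic has the coefficient
    \<open>- p * (1+p)^2\<close> at \<open>t\<close>, so \<open>a\<close> and the root determine
    \<open>t\<close>.\<close>
  have "poly (bru_poly a (ly_t u)) (-p) = 0"
    using poly_bru_poly_lyness[OF ly] unfolding A by (simp add: v)
  then have "(ly_t u - t) * (p * (1+p)^2) = 0" using root unfolding bru_poly_def by simp algebra
  then have T: "ly_t u = t" using p n by simp
  have "u 2 - u 3 = q" unfolding v u2_def u3_def by (simp add: field_simps)
  then have Y: "ly_y u = q * ctr_fac a p" using lyness_centre(4)[OF ly] A v by simp
  show ?thesis using that[OF ly A T Y] v u2_def u3_def by simp
qed

text \<open>Only adjacent differences enter \<open>ly_y\<close>. Since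
  \<open>u (j+1) * (u (j+3) - u (j+4)) = u (j+2) - u j\<close>, the other differences multiply to
  \<open>ly_a u * ly_y u\<close> up to sign, so the discriminant of the quintic is the square of
  \<open>a * bru_disc a t\<close>.\<close>

lemma lyness_disc:
  fixes u :: "nat \<Rightarrow> 'a::field_char_0"
  assumes "lyness u"
  shows "(ly_y u)^2 = bru_disc (ly_a u) (ly_t u)"
proof -
  note c = lyness_centre[OF assms]
  have "poly (bru_poly (ly_a u) (ly_t u)) (- u 0) = 0"
    by (simp add: poly_bru_poly_lyness[OF assms])
  then have "bru_disc (ly_a u) (ly_t u) = ((ctr_sum (ly_a u) (u 0))^2 - 4 * ctr_prod (ly_a u) (u 0)) * (ctr_fac (ly_a u) (u 0))^2"
    using bru_disc_ctr c(1) lynessD(1)[OF assms] by blast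
  also have "\<dots> = (ly_y u)^2" unfolding c(4) c(2,3)[symmetric] by algebra
  finally show ?thesis by simp
qed

lemma lyness_exists:
  fixes a t y x :: complex
  assumes a: "a \<noteq> 0" and root: "poly (bru_poly a t) x = 0" and y: "y^2 = bru_disc a t"
  obtains u where "lyness u" "ly_a u = a" "ly_t u = t" "ly_y u = y" "u 0 = -x"
proof -
  define p where "p = -x"
  have root': "poly (bru_poly a t) (-p) = 0" using root by (simp add: p_def)
  define q where "q = csqrt ((ctr_sum a p)^2 - 4 * ctr_prod a p)"
  have q: "q^2 = (ctr_sum a p)^2 - 4 * ctr_prod a p" "(-q)^2 = (ctr_sum a p)^2 - 4 * ctr_prod a p" by (simp_all add: q_def)
  obtain u where u: "lyness u" "ly_a u = a" "ly_t u = t" "ly_y u = q * ctr_fac a p" "u 0 = p"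
    using lyness_of_pair[OF a root' q(1)] by metis
  obtain u' where u': "lyness u'" "ly_a u' = a" "ly_t u' = t" "ly_y u' = (-q) * ctr_fac a p" "u' 0 = p"
    using lyness_of_pair[OF a root' q(2)] by metis
  have "(ly_y u)^2 = y^2" using lyness_disc[OF u(1)] u y by simp
  then have "y = ly_y u \<or> y = ly_y u'" using u(4) u'(4) by (auto simp: power2_eq_iff)
  with u u' that show ?thesis unfolding p_def by metis
qed

text \<open>Elimination of \<open>u\<^sub>1\<close>: when the cycle is symmetric, its centre is rational in \<open>a\<close> and \<open>t\<close>.\<close>

lemma double_root_centre:
  fixes u :: "nat \<Rightarrow> 'a::field_char_0"
  assumes "lyness u" and "u 2 = u 3"
  defines "a \<equiv> ly_a u" and "t \<equiv> ly_t u"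
  shows "u 0 * (a^2 - 11*a - 1)^2 = (16-12*a)*t^2 + (31*a - 74*a^2 - a^3)*t
    + (a^5 + 21*a^4 + 20*a^3 - 234*a^2 + 41*a - 1)"
proof -
  note r = lyness_rels[OF assms(1)]
  define p where "p = u 1"
  define q where "q = u 3"
  have p4: "u 4 = p" using r(1,4) assms(2) unfolding p_def by (simp add: algebra_simps)
  have p0: "u 0 = p^2 - 1" using r(5) p4 unfolding p_def by (simp add: power2_eq_square)
  have "(p - 1) * u 3 = 1" using r(2) assms(2) unfolding p_def by (simp add: algebra_simps)
  then have pq: "p * q = 1 + q" unfolding q_def by (simp add: algebra_simps)
  have A: "a = p^2 + 2*p + 2 + 2*q"
    unfolding a_def ly_a_def assms(2) p0 p4 p_def[symmetric] q_def[symmetric] using pq by algebra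
  have T: "t = (1+q)^2 + 2*(p+1)*(1+q) + 2*p^2*(p+1)"
    unfolding t_def ly_t_def assms(2) p0 p4 p_def[symmetric] q_def[symmetric] using pq by algebra
  show ?thesis unfolding A T p0 using pq by algebra
qed

section \<open>The Kummer function\<close>

definition ly_h :: "'a::field \<Rightarrow> (nat \<Rightarrow> 'a) \<Rightarrow> 'a" where
  "ly_h \<zeta> u = u 0 + \<zeta> * u 1 + \<zeta>^2 * u 2 + \<zeta>^3 * u 3 + \<zeta>^4 * u 4"

lemma ly_h_conj:
  assumes p: "\<zeta>^5 = 1"
  shows "ly_h (\<zeta>^3) u = u 0 + \<zeta>^3 * u 1 + \<zeta> * u 2 + \<zeta>^4 * u 3 + \<zeta>^2 * u 4"
    "ly_h (\<zeta>^4) u = u 0 + \<zeta>^4 * u 1 + \<zeta>^3 * u 2 + \<zeta>^2 * u 3 + \<zeta> * u 4"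
  unfolding ly_h_def using p by algebra+

text \<open>Weil reciprocity on the curve
  \<open>V^2 - (l*z + \<gamma>*\<delta>)*V + z^3 + \<delta>*z^2 = 0\<close>, where T is the origin
  and the choice of \<open>\<delta>\<close> gives T order 5. On the line \<open>V = c*z + m\<close>
  the function with divisor 5T - 5O is a quadratic in \<open>z\<close>; its product over the three
  intersections is a resultant, and what is left is the fifth power of \<open>m\<close>, the value
  of the line at T.\<close>

lemma kummer_product_on_line:
  fixes z1 z2 z3 c m \<gamma> l :: "'a::field_char_0"
  defines "\<delta> \<equiv> \<gamma> * (\<gamma> - l)"
  assumes e1: "z1 + z2 + z3 = - (\<delta> + c^2 - l*c)"
    and e2: "z1*z2 + z1*z3 + z2*z3 = 2*c*m - l*m - \<gamma>*\<delta>*c"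
    and e3: "z1*z2*z3 = - (m^2 - \<gamma>*\<delta>*m)"
  shows "((z1 - \<gamma>^2)*(c*z1+m) + \<gamma>*z1^2) * ((z2 - \<gamma>^2)*(c*z2+m) + \<gamma>*z2^2)
     * ((z3 - \<gamma>^2)*(c*z3+m) + \<gamma>*z3^2) = - (m^5)"
proof -
  define A where "A = c + \<gamma>"
  define B where "B = m - \<gamma>^2 * c"
  define C where "C = - (\<gamma>^2 * m)"
  define E1 where "E1 = z1 + z2 + z3"
  define E2 where "E2 = z1*z2 + z1*z3 + z2*z3"
  define E3 where "E3 = z1*z2*z3"
  have "((z1 - \<gamma>^2)*(c*z1+m) + \<gamma>*z1^2) * ((z2 - \<gamma>^2)*(c*z2+m) + \<gamma>*z2^2)
     * ((z3 - \<gamma>^2)*(c*z3+m) + \<gamma>*z3^2)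
     = (A*z1^2+B*z1+C)*(A*z2^2+B*z2+C)*(A*z3^2+B*z3+C)"
    unfolding A_def B_def C_def by algebra
  also have "\<dots> = A^3*E3^2 + A^2*B*E3*E2 + A^2*C*(E2^2-2*E1*E3) + A*B^2*E3*E1
     + A*B*C*(E1*E2-3*E3) + A*C^2*(E1^2-2*E2) + B^3*E3 + B^2*C*E2 + B*C^2*E1 + C^3"
    unfolding E1_def E2_def E3_def by algebra
  also have "\<dots> = - (m^5)"
    unfolding A_def B_def C_def E1_def E2_def E3_def e1 e2 e3 \<delta>_def by algebra
  finally show ?thesis .
qed

lemma ly_h_norm:
  fixes u :: "nat \<Rightarrow> 'a::field_char_0"
  assumes ly: "lyness u" and z: "1 + \<zeta> + \<zeta>^2 + \<zeta>^3 + \<zeta>^4 = 0"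
  defines "a \<equiv> ly_a u" and "\<tau> \<equiv> \<zeta> + \<zeta>^4"
  shows "ly_h \<zeta> u * ly_h (\<zeta>^4) u = (\<tau> - 2) * ly_t u + a^2 - (5 + 3*\<tau>)*a + 1 - \<tau>"
proof -
  note r = lyness_rels[OF ly]
  have p: "\<zeta>^5 = 1" using z by algebra
  have "ly_h \<zeta> u * ly_h (\<zeta>^4) u = (u 0^2 + u 1^2 + u 2^2 + u 3^2 + u 4^2)
    + \<tau> * (u 0*u 1+u 1*u 2+u 2*u 3+u 3*u 4+u 4*u 0) + (-1-\<tau>)*(u 0*u 2+u 1*u 3+u 2*u 4+u 3*u 0+u 4*u 1)"
    unfolding ly_h_def \<tau>_def using z by algebra
  also have "\<dots> = (\<tau> - 2) * ly_t u + a^2 - (5 + 3*\<tau>)*a + 1 - \<tau>"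
    unfolding a_def ly_a_def ly_t_def using r(1-5) by algebra
  finally show ?thesis .
qed

text \<open>The shift multiplies \<open>ly_h (\<zeta>^k) u\<close> by \<open>\<zeta>^(-k)\<close>.
  So \<open>h^3\<close>, \<open>ly_h (\<zeta>^3) u\<close> and \<open>(ly_h (\<zeta>^4) u)^2\<close>
  lie in one eigenspace of the shift, where a relation with invariant coefficients is to be
  expected. It is checked in the free coordinates \<open>u 0\<close>, \<open>u 1\<close> and their
  inverses.\<close>

lemma ly_h_cube:
  fixes u :: "nat \<Rightarrow> 'a::field_char_0"
  assumes ly: "lyness u" and z: "1 + \<zeta> + \<zeta>^2 + \<zeta>^3 + \<zeta>^4 = 0"
  defines "a \<equiv> ly_a u" and "\<tau> \<equiv> \<zeta> + \<zeta>^4"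
  defines "\<gamma> \<equiv> 1 - 2*\<tau> - (2+\<tau>)*a"
  shows "(ly_h \<zeta> u)^3 = - \<tau> * (ly_h \<zeta> u * ly_h (\<zeta>^4) u - \<gamma>^2) * ly_h (\<zeta>^3) u + \<gamma> * (ly_h (\<zeta>^4) u)^2"
proof -
  note r = lyness_rels[OF ly]
  have p: "\<zeta>^5 = 1" using z by algebra
  note h1 = ly_h_def[of \<zeta> u] and h3 = ly_h_conj(1)[OF p, of u] and h4 = ly_h_conj(2)[OF p, of u]
  define P where "P = 1 / u 0"
  define Q where "Q = 1 / u 1"
  have PQ: "u 0 * P = 1" "u 1 * Q = 1" using r by (simp_all add: P_def Q_def)
  have v: "u 2 = P + u 1 * P" "u 3 = P*Q + Q + P" "u 4 = Q + u 0 * Q" using lyness_solve[OF ly] r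
    by (simp_all add: P_def Q_def field_simps)
  have A: "a = (1+u 0)*(1+u 1)*(P*Q+Q+P)" unfolding a_def ly_a_def v using PQ by algebra
  show ?thesis unfolding h1 h3 h4 \<gamma>_def A \<tau>_def v using z PQ by algebra
qed

text \<open>Over \<open>\<rat>(\<surd>5)\<close> the curve \<open>y\<^sup>2 = bru_disc a t\<close> is put into Tate normal form at a point \<open>T\<close> of order 5
  in the kernel of the dual isogeny: \<open>kz\<close> and \<open>kV\<close> are the new coordinates, vanishing at \<open>T\<close>, and \<open>kg\<close> is
  the function with divisor \<open>5T - 5O\<close>.\<close>

definition kz :: "'a::field \<Rightarrow> 'a \<Rightarrow> 'a \<Rightarrow> 'a" where
  "kz \<tau> a t = (\<tau> - 2) * t + a^2 - (5 + 3*\<tau>)*a + 1 - \<tau>"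
definition kgam :: "'a::field \<Rightarrow> 'a \<Rightarrow> 'a" where "kgam \<tau> a = 1 - 2*\<tau> - (2+\<tau>)*a"
definition kell :: "'a::field \<Rightarrow> 'a \<Rightarrow> 'a" where "kell \<tau> a = 3 - \<tau> - (1+3*\<tau>)*a"
definition kdel :: "'a::field \<Rightarrow> 'a \<Rightarrow> 'a" where "kdel \<tau> a = kgam \<tau> a * (kgam \<tau> a - kell \<tau> a)"
definition kV :: "'a::field \<Rightarrow> 'a \<Rightarrow> 'a \<Rightarrow> 'a \<Rightarrow> 'a \<Rightarrow> 'a" where
  "kV \<tau> s a t y = ((1 - 3*\<tau>)*s*y + kell \<tau> a * kz \<tau> a t + kgam \<tau> a * kdel \<tau> a) / 2"
definition kg :: "'a::field \<Rightarrow> 'a \<Rightarrow> 'a \<Rightarrow> 'a \<Rightarrow> 'a \<Rightarrow> 'a" where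
  "kg \<tau> s a t y = (kz \<tau> a t - (kgam \<tau> a)^2) * kV \<tau> s a t y + kgam \<tau> a * (kz \<tau> a t)^2"

lemma cyclotomic_tau:
  fixes \<zeta> :: "'a::field"
  assumes z: "1 + \<zeta> + \<zeta>^2 + \<zeta>^3 + \<zeta>^4 = 0"
  shows "(\<zeta> + \<zeta>^4)^2 = 1 - (\<zeta> + \<zeta>^4)" "(\<zeta> - \<zeta>^4)^2 = - 3 - (\<zeta> + \<zeta>^4)"
  using z by algebra+

text \<open>As \<open>kz\<close> is \<open>(\<tau> - 2) * t\<close> plus a constant, the ordinate
  has to be scaled by a square root of \<open>(\<tau> - 2)^3 = 20*\<tau> - 15\<close>; this is the
  origin of \<open>(1 - 3*\<tau>)*s\<close>. The coefficients of the powers of \<open>t\<close> are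
  then compared.\<close>

lemma bru_disc_tate:
  fixes a t \<tau> s :: "'a::field_char_0"
  assumes t: "\<tau>^2 = 1 - \<tau>" and s: "s^2 = - 3 - \<tau>"
  shows "((1 - 3*\<tau>)*s)^2 * bru_disc a t
    = (kell \<tau> a * kz \<tau> a t + kgam \<tau> a * kdel \<tau> a)^2 - 4 * (kz \<tau> a t)^3 - 4 * kdel \<tau> a * (kz \<tau> a t)^2"
proof -
  have c: "((1 - 3*\<tau>)*s)^2 = 20*\<tau> - 15" using t s by algebra
  define e where "e = 1 + 11*a - a^2"
  have d: "kdel \<tau> a = \<tau> * e" unfolding kdel_def kgam_def kell_def e_def using t by algebra
  have gd: "kgam \<tau> a * kdel \<tau> a = (3*\<tau> - 2 - (1+\<tau>)*a) * e" unfolding d kgam_def using t by algebra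
  define m where "m = a^2 - (5 + 3*\<tau>)*a + 1 - \<tau>"
  define l where "l = kell \<tau> a"
  define f where "f = (3*\<tau> - 2 - (1+\<tau>)*a) * e"
  have z: "kz \<tau> a t = (\<tau> - 2) * t + m" by (simp add: kz_def m_def)
  have E: "(kell \<tau> a * kz \<tau> a t + kgam \<tau> a * kdel \<tau> a)^2 - 4 * (kz \<tau> a t)^3 - 4 * kdel \<tau> a * (kz \<tau> a t)^2
     = -4*(\<tau>-2)^3*t^3 + (\<tau>-2)^2*(l^2 - 12*m - 4*\<tau>*e)*t^2 + (\<tau>-2)*(2*l*(l*m+f) - 12*m^2 - 8*\<tau>*e*m)*t
       + ((l*m+f)^2 - 4*m^3 - 4*\<tau>*e*m^2)"
    unfolding gd unfolding d z l_def[symmetric] f_def[symmetric] by algebra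
  have T3: "(\<tau>-2)^3 = 20*\<tau> - 15" using t by algebra
  have T2: "(\<tau>-2)^2*(l^2 - 12*m - 4*\<tau>*e) = (20*\<tau>-15) * (a^2 - 30*a + 1)"
    unfolding l_def kell_def m_def e_def using t by algebra
  have T1: "(\<tau>-2)*(2*l*(l*m+f) - 12*m^2 - 8*\<tau>*e*m) = (20*\<tau>-15) * (2*a*(3*a+1)*(4*a-7))"
    unfolding l_def kell_def m_def e_def f_def using t by algebra
  have T0: "(l*m+f)^2 - 4*m^3 - 4*\<tau>*e*m^2 = (20*\<tau>-15) * (- a*(4*a^4 - 4*a^3 - 40*a^2 + 91*a - 4))"
    unfolding l_def kell_def m_def e_def f_def using t by algebra
  show ?thesis unfolding E T3 T2 T1 T0 c bru_disc_def by algebra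
qed

text \<open>\<open>kz\<close> has divisor T + (-T) - 2O, so both sides have divisor 5T + 5(-T) -
  10O. The values of \<open>kV\<close> at the two points are the roots of a quadratic with sum
  \<open>l*z + g*d\<close> and product \<open>z^3 + d*z^2\<close>, which leaves an identity in
  \<open>z\<close>.\<close>

lemma kg_uminus:
  fixes a t \<tau> s y :: "'a::field_char_0"
  assumes t: "\<tau>^2 = 1 - \<tau>" and s: "s^2 = - 3 - \<tau>" and y: "y^2 = bru_disc a t"
  shows "kg \<tau> s a t y * kg \<tau> s a t (-y) = (kz \<tau> a t)^5"
proof -
  define z where "z = kz \<tau> a t"
  define g where "g = kgam \<tau> a"
  define l where "l = kell \<tau> a"
  define V where "V = kV \<tau> s a t y"
  define W where "W = kV \<tau> s a t (-y)"
  define d where "d = kdel \<tau> a"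
  have dd: "d = g * (g - l)" by (simp add: d_def g_def l_def kdel_def)
  have sum: "V + W = l * z + g * d"
    unfolding V_def W_def kV_def z_def g_def l_def d_def by (simp add: field_simps)
  have "4 * (V * W) = (l * z + g * d)^2 - ((1 - 3*\<tau>)*s)^2 * y^2"
    unfolding V_def W_def kV_def z_def g_def l_def d_def by (simp add: field_simps power2_eq_square)
  then have "4 * (V * W) = 4 * z^3 + 4 * d * z^2"
    unfolding y bru_disc_tate[OF t s] z_def g_def l_def d_def by simp
  then have prod: "V * W = z^3 + d * z^2" by algebra
  have "kg \<tau> s a t y * kg \<tau> s a t (-y) = ((z - g^2) * V + g * z^2) * ((z - g^2) * W + g * z^2)"
    by (simp add: kg_def V_def W_def z_def g_def)
  also have "\<dots> = (z - g^2)^2 * (V * W) + g * z^2 * (z - g^2) * (V + W) + g^2 * z^4" by algebra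
  also have "\<dots> = z^5" unfolding sum prod dd by algebra
  finally show ?thesis by (simp add: z_def)
qed

text \<open>The product is invariant under the shift because 2 + 3 is divisible by 5, hence it is a
  combination of cyclic sums of cubic monomials. Under reversal of the cycle only
  \<open>c1 - c4\<close> and \<open>c2 - c3\<close> change sign; the former is \<open>ly_y\<close>,
  the latter vanishes.\<close>

lemma ly_h_square_mult:
  fixes u :: "nat \<Rightarrow> 'a::field_char_0"
  assumes ly: "lyness u" and z: "1 + \<zeta> + \<zeta>^2 + \<zeta>^3 + \<zeta>^4 = 0"
  defines "a \<equiv> ly_a u" and "\<tau> \<equiv> \<zeta> + \<zeta>^4" and "s \<equiv> \<zeta> - \<zeta>^4"
  shows "- 2 * \<tau> * (ly_h \<zeta> u)^2 * ly_h (\<zeta>^3) u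
    = (1 - 3*\<tau>)*s*ly_y u + kell \<tau> a * (ly_h \<zeta> u * ly_h (\<zeta>^4) u) + kgam \<tau> a * kdel \<tau> a"
proof -
  note r = lyness_rels[OF ly]
  have p: "\<zeta>^5 = 1" using z by algebra
  note h1 = ly_h_def[of \<zeta> u] and h3 = ly_h_conj(1)[OF p, of u] and h4 = ly_h_conj(2)[OF p, of u]
  define c0 where "c0 = u 0^3 + u 1^3 + u 2^3 + u 3^3 + u 4^3"
  define c1 where "c1 = u 0^2*u 1 + u 1^2*u 2 + u 2^2*u 3 + u 3^2*u 4 + u 4^2*u 0"
  define c2 where "c2 = u 0^2*u 2 + u 1^2*u 3 + u 2^2*u 4 + u 3^2*u 0 + u 4^2*u 1"
  define c3 where "c3 = u 0^2*u 3 + u 1^2*u 4 + u 2^2*u 0 + u 3^2*u 1 + u 4^2*u 2"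
  define c4 where "c4 = u 0^2*u 4 + u 1^2*u 0 + u 2^2*u 1 + u 3^2*u 2 + u 4^2*u 3"
  define d1 where "d1 = u 0*u 1*u 2 + u 1*u 2*u 3 + u 2*u 3*u 4 + u 3*u 4*u 0 + u 4*u 0*u 1"
  define d2 where "d2 = u 0*u 1*u 3 + u 1*u 2*u 4 + u 2*u 3*u 0 + u 3*u 4*u 1 + u 4*u 0*u 2"
  define t where "t = ly_t u"
  define y where "y = ly_y u"
  have E: "(ly_h \<zeta> u)^2 * ly_h (\<zeta>^3) u = c0 + (\<zeta>^3+2*\<zeta>)*c1 + (\<zeta>+2*\<zeta>^2)*c2 + (\<zeta>^4+2*\<zeta>^3)*c3
     + (\<zeta>^2+2*\<zeta>^4)*c4 + 2*(1+\<zeta>^2+\<zeta>^3)*d1 + 2*(1+\<zeta>+\<zeta>^4)*d2"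
    unfolding h1 h3 c0_def c1_def c2_def c3_def c4_def d1_def d2_def using p by algebra
  have C0: "c0 = -3 + 6*a - 3*a^2 + a^3 + 3*t - 3*a*t"
    unfolding c0_def a_def t_def ly_a_def ly_t_def using r(1-5) by algebra
  have C14: "c1 + c4 = -2 + 11*a - 4*a^2 + t + a*t"
    unfolding c1_def c4_def a_def t_def ly_a_def ly_t_def using r(1-5) by algebra
  have C23: "c2 + c3 = -4 - 2*a + 2*t"
    unfolding c2_def c3_def a_def t_def ly_a_def ly_t_def using r(1-5) by algebra
  have C1: "c1 - c4 = y"
    unfolding c1_def c4_def y_def ly_y_def using r(1-5) by algebra
  have C2: "c2 = c3"
    unfolding c2_def c3_def using r(1-5) by algebra
  have D1: "d1 = -3*a + a^2 - 2*t"
    unfolding d1_def a_def t_def ly_a_def ly_t_def using r(1-5) by algebra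
  have D2: "d2 = -1 + 2*a"
    unfolding d2_def a_def t_def ly_a_def ly_t_def using r(1-5) by algebra
  have Z: "ly_h \<zeta> u * ly_h (\<zeta>^4) u = (\<tau> - 2) * t + a^2 - (5 + 3*\<tau>)*a + 1 - \<tau>"
    using ly_h_norm[OF ly z] unfolding a_def \<tau>_def t_def .
  have "- 2 * \<tau> * ((ly_h \<zeta> u)^2 * ly_h (\<zeta>^3) u) = (1 - 3*\<tau>)*s*y + kell \<tau> a * (ly_h \<zeta> u * ly_h (\<zeta>^4) u) + kgam \<tau> a * kdel \<tau> a"
    unfolding E Z kell_def kdel_def kgam_def \<tau>_def s_def C0 D1 D2
    using C14 C23 C1 C2 z by algebra
  then show ?thesis by (simp add: y_def mult.assoc)
qed

text \<open>In \<open>h^2 * h^3\<close> the cube is replaced by its expression in the conjugate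
  resolvents. Then only the invariant products \<open>h * h4\<close> and
  \<open>- \<tau> * h^2 * h3\<close> occur, which are \<open>kz\<close> and
  \<open>kV\<close>.\<close>

lemma ly_h_power5:
  fixes u :: "nat \<Rightarrow> 'a::field_char_0"
  assumes ly: "lyness u" and z: "1 + \<zeta> + \<zeta>^2 + \<zeta>^3 + \<zeta>^4 = 0"
  shows "(ly_h \<zeta> u)^5 = kg (\<zeta> + \<zeta>^4) (\<zeta> - \<zeta>^4) (ly_a u) (ly_t u) (ly_y u)"
proof -
  define \<tau> where "\<tau> = \<zeta> + \<zeta>^4"
  define h where "h = ly_h \<zeta> u"
  define h3 where "h3 = ly_h (\<zeta>^3) u"
  define h4 where "h4 = ly_h (\<zeta>^4) u"
  have Z: "kz \<tau> (ly_a u) (ly_t u) = h * h4"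
    using ly_h_norm[OF ly z] by (simp add: kz_def \<tau>_def h_def h4_def)
  have "2 * kV \<tau> (\<zeta> - \<zeta>^4) (ly_a u) (ly_t u) (ly_y u)
      = (1 - 3*\<tau>)*(\<zeta> - \<zeta>^4)*ly_y u + kell \<tau> (ly_a u) * (h * h4) + kgam \<tau> (ly_a u) * kdel \<tau> (ly_a u)"
    unfolding kV_def Z by simp
  also have "\<dots> = - 2 * \<tau> * h^2 * h3"
    using ly_h_square_mult[OF ly z] unfolding \<tau>_def h_def h3_def h4_def by (rule sym)
  finally have "2 * kV \<tau> (\<zeta> - \<zeta>^4) (ly_a u) (ly_t u) (ly_y u) = 2 * (- \<tau> * h^2 * h3)" by algebra
  then have V: "kV \<tau> (\<zeta> - \<zeta>^4) (ly_a u) (ly_t u) (ly_y u) = - \<tau> * h^2 * h3"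
    by (rule mult_left_cancel[THEN iffD1, rotated]) simp
  have 3: "h^3 = - \<tau> * (h * h4 - (kgam \<tau> (ly_a u))^2) * h3 + kgam \<tau> (ly_a u) * h4^2"
    using ly_h_cube[OF ly z] unfolding kgam_def \<tau>_def h_def h3_def h4_def .
  have "kg \<tau> (\<zeta> - \<zeta>^4) (ly_a u) (ly_t u) (ly_y u)
    = h^2 * (- \<tau> * (h * h4 - (kgam \<tau> (ly_a u))^2) * h3 + kgam \<tau> (ly_a u) * h4^2)"
    unfolding kg_def Z V by algebra
  also have "\<dots> = h^5" unfolding 3[symmetric] by algebra
  finally show ?thesis by (simp add: h_def \<tau>_def)
qed

section \<open>Subfields of the complex numbers\<close>

abbreviation sf :: "complex set \<Rightarrow> bool" where "sf \<equiv> is_subfield_complex"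

lemma sfD:
  assumes "sf K"
  shows sf_0: "0 \<in> K" and sf_1: "1 \<in> K"
    and sf_add: "\<And>x y. x \<in> K \<Longrightarrow> y \<in> K \<Longrightarrow> x + y \<in> K"
    and sf_mult: "\<And>x y. x \<in> K \<Longrightarrow> y \<in> K \<Longrightarrow> x * y \<in> K"
    and sf_uminus: "\<And>x. x \<in> K \<Longrightarrow> - x \<in> K"
    and sf_diff: "\<And>x y. x \<in> K \<Longrightarrow> y \<in> K \<Longrightarrow> x - y \<in> K"
    and sf_inverse: "\<And>x. x \<in> K \<Longrightarrow> inverse x \<in> K"
    and sf_divide: "\<And>x y. x \<in> K \<Longrightarrow> y \<in> K \<Longrightarrow> x / y \<in> K"
    and sf_power: "\<And>x n. x \<in> K \<Longrightarrow> x ^ n \<in> K"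
    and sf_of_nat: "\<And>n. of_nat n \<in> K"
    and sf_numeral: "\<And>w. numeral w \<in> K"
    and sf_of_int: "\<And>k. of_int k \<in> K"
    and sf_of_rat: "\<And>q. of_rat q \<in> K"
proof -
  show z: "0 \<in> K" and o: "1 \<in> K" using assms by (auto simp: is_subfield_complex_def)
  show a: "x + y \<in> K" if "x \<in> K" "y \<in> K" for x y using assms that by (auto simp: is_subfield_complex_def)
  show m: "x * y \<in> K" if "x \<in> K" "y \<in> K" for x y using assms that by (auto simp: is_subfield_complex_def)
  show u: "- x \<in> K" if "x \<in> K" for x using assms that by (auto simp: is_subfield_complex_def)
  show "x - y \<in> K" if "x \<in> K" "y \<in> K" for x y using a[OF that(1) u[OF that(2)]] by simp
  show i: "inverse x \<in> K" if "x \<in> K" for x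
    using assms that z by (cases "x = 0") (auto simp: is_subfield_complex_def)
  show d: "x / y \<in> K" if "x \<in> K" "y \<in> K" for x y
    using m[OF that(1) i[OF that(2)]] by (simp add: divide_inverse)
  show "x ^ n \<in> K" if "x \<in> K" for x n using that o m by (induction n) auto
  show n: "of_nat n \<in> K" for n using z o a by (induction n) auto
  show "numeral w \<in> K" for w using n[of "numeral w"] by simp
  show k: "of_int k \<in> K" for k
  proof (cases "k \<ge> 0")
    case True then show ?thesis using n[of "nat k"] by simp
  next
    case False then show ?thesis using u[OF n[of "nat (-k)"]] by simp
  qed
  show "of_rat q \<in> K" for q
  proof (cases q)
    case (Fract b c)
    then have "of_rat q = (of_int b / of_int c :: complex)" by (simp add: of_rat_rat)
    then show ?thesis using d[OF k k] by simp
  qed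
qed

section \<open>Polynomials over a subfield and irreducibility\<close>

definition MX :: "complex set \<Rightarrow> complex poly set" where
  "MX K = {p. \<forall>i. coeff p i \<in> K}"

lemma MX_coeff: "p \<in> MX K \<Longrightarrow> coeff p i \<in> K" by (simp add: MX_def)

lemma MX_mono: "K \<subseteq> L \<Longrightarrow> p \<in> MX K \<Longrightarrow> p \<in> MX L" by (auto simp: MX_def)

lemma sf_sum:
  assumes "sf K" "\<And>i. i \<in> A \<Longrightarrow> f i \<in> K"
  shows "sum f A \<in> K"
  using assms(2) by (induction A rule: infinite_finite_induct) (auto intro: sf_0[OF assms(1)] sf_add[OF assms(1)])

lemma MX_closed:
  assumes K: "sf K"
  shows MX_0: "0 \<in> MX K" and MX_1: "1 \<in> MX K"
    and MX_add: "\<And>p q. p \<in> MX K \<Longrightarrow> q \<in> MX K \<Longrightarrow> p + q \<in> MX K"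
    and MX_diff: "\<And>p q. p \<in> MX K \<Longrightarrow> q \<in> MX K \<Longrightarrow> p - q \<in> MX K"
    and MX_uminus: "\<And>p. p \<in> MX K \<Longrightarrow> - p \<in> MX K"
    and MX_mult: "\<And>p q. p \<in> MX K \<Longrightarrow> q \<in> MX K \<Longrightarrow> p * q \<in> MX K"
    and MX_pCons: "\<And>c p. c \<in> K \<Longrightarrow> p \<in> MX K \<Longrightarrow> pCons c p \<in> MX K"
    and MX_monom: "\<And>c n. c \<in> K \<Longrightarrow> monom c n \<in> MX K"
    and MX_poly: "\<And>p x. p \<in> MX K \<Longrightarrow> x \<in> K \<Longrightarrow> poly p x \<in> K"
proof -
  note cl = sfD[OF K]
  show z: "0 \<in> MX K" by (simp add: MX_def cl)
  show "1 \<in> MX K" by (simp add: MX_def cl)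
  show "p + q \<in> MX K" if "p \<in> MX K" "q \<in> MX K" for p q using that by (simp add: MX_def cl)
  show "p - q \<in> MX K" if "p \<in> MX K" "q \<in> MX K" for p q using that by (simp add: MX_def cl)
  show "- p \<in> MX K" if "p \<in> MX K" for p using that by (simp add: MX_def cl)
  show "p * q \<in> MX K" if "p \<in> MX K" "q \<in> MX K" for p q
    using that by (auto simp: MX_def coeff_mult intro!: sf_sum[OF K] cl)
  show "pCons c p \<in> MX K" if "c \<in> K" "p \<in> MX K" for c p
    using that by (auto simp: MX_def coeff_pCons split: nat.splits)
  show "monom c n \<in> MX K" if "c \<in> K" for c n
    using that by (auto simp: MX_def cl)
  show "poly p x \<in> K" if "p \<in> MX K" "x \<in> K" for p x
    using that by (auto simp: poly_altdef MX_def intro!: sf_sum[OF K] cl)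
qed

lemma MX_const: "sf K \<Longrightarrow> c \<in> K \<Longrightarrow> [:c:] \<in> MX K"
  by (simp add: MX_pCons MX_0)

lemma MX_pcompose:
  assumes K: "sf K" and "p \<in> MX K" "q \<in> MX K"
  shows "pcompose p q \<in> MX K"
  using assms(2)
proof (induction p)
  case (pCons c p)
  have "c \<in> K" using MX_coeff[OF pCons.prems, of 0] by simp
  moreover have "p \<in> MX K" unfolding MX_def
  proof (intro CollectI allI)
    fix i show "coeff p i \<in> K" using MX_coeff[OF pCons.prems, of "Suc i"] by simp
  qed
  ultimately show ?case using pCons.IH assms(3) K
    by (simp add: pcompose_pCons MX_add MX_mult MX_const)
qed (simp add: MX_0 K)

lemma MX_divmod:
  assumes K: "sf K" and p: "p \<in> MX K" "p \<noteq> 0" and f: "f \<in> MX K"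
  shows "\<exists>q\<in>MX K. \<exists>r\<in>MX K. f = p * q + r \<and> (r = 0 \<or> degree r < degree p)"
  using f
proof (induction "degree f" arbitrary: f rule: less_induct)
  case less
  show ?case
  proof (cases "f = 0 \<or> degree f < degree p")
    case True
    then show ?thesis using less.prems MX_0[OF K] by (intro bexI[of _ 0] bexI[of _ f]) auto
  next
    case False
    define c where "c = lead_coeff f / lead_coeff p"
    define m where "m = monom c (degree f - degree p)"
    have m: "m \<in> MX K" unfolding m_def c_def
      by (intro MX_monom[OF K] sf_divide[OF K] MX_coeff p less.prems)
    define f' where "f' = f - p * m"
    have f': "f' \<in> MX K" unfolding f'_def by (intro MX_diff[OF K] MX_mult[OF K] p m less.prems)
    have lc: "lead_coeff p \<noteq> 0" "lead_coeff f \<noteq> 0" using p False by auto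
    then have c0: "c \<noteq> 0" by (simp add: c_def)
    have dm: "degree (p * m) = degree f"
      using False p c0 by (simp add: degree_mult_eq m_def degree_monom_eq)
    have "coeff (p * m) (degree f) = lead_coeff f"
    proof -
      have "lead_coeff (p * m) = lead_coeff p * c" using c0 by (simp add: lead_coeff_mult m_def degree_monom_eq)
      then show ?thesis using dm lc by (simp add: c_def)
    qed
    then have top: "coeff f' (degree f) = 0" by (simp add: f'_def)
    have le: "degree f' \<le> degree f" unfolding f'_def using dm by (simp add: degree_diff_le)
    show ?thesis
    proof (cases "f' = 0")
      case True
      then have "f = p * m + 0" by (simp add: f'_def)
      then show ?thesis using m MX_0[OF K] by blast
    next
      case f'0: False
      have "degree f' < degree f"
        using le top f'0 by (metis leading_coeff_0_iff le_neq_implies_less)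
      from less.hyps[OF this f'] obtain q r where qr: "q \<in> MX K" "r \<in> MX K" "f' = p * q + r" "r = 0 \<or> degree r < degree p"
        by blast
      have "f = p * (q + m) + r" using qr(3) by (simp add: f'_def algebra_simps)
      moreover have "q + m \<in> MX K" using MX_add[OF K qr(1) m] .
      ultimately show ?thesis using qr by blast
    qed
  qed
qed

text \<open>Irreducibility in terms of complex roots: no root of \<open>f\<close> satisfies an
  equation of smaller degree over \<open>K\<close>. In this form it transfers identities from one
  root to all.\<close>

definition irr_over :: "complex set \<Rightarrow> complex poly \<Rightarrow> bool" where
  "irr_over K f \<longleftrightarrow> (\<forall>p\<in>MX K. p \<noteq> 0 \<longrightarrow> degree p < degree f \<longrightarrow> (\<forall>z. poly f z = 0 \<longrightarrow> poly p z \<noteq> 0))"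

lemma irr_over_all_roots:
  assumes K: "sf K" and f: "f \<in> MX K" "f \<noteq> 0" "irr_over K f" and p: "p \<in> MX K"
    and z: "poly f z = 0" "poly p z = 0" and z': "poly f z' = 0"
  shows "poly p z' = 0"
proof -
  obtain q r where qr: "q \<in> MX K" "r \<in> MX K" "p = f * q + r" "r = 0 \<or> degree r < degree f"
    using MX_divmod[OF K f(1,2) p] by blast
  have "poly r z = 0" using qr(3) z by simp
  then have "r = 0" using f(3) qr z(1) unfolding irr_over_def by blast
  then show ?thesis using qr(3) z' by simp
qed

text \<open>This inverts \<open>p\<close> modulo \<open>f\<close>, so that one \<open>p'\<close>
  serves all roots. For small degrees, \<open>f\<close> is divided by \<open>p\<close>: the
  remainder has smaller degree and the value \<open>- p(z) * q(z)\<close> with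
  \<open>q(z) \<noteq> 0\<close>, so an inverse for it gives one for \<open>p\<close>.\<close>

lemma irr_over_inverse:
  assumes K: "sf K" and f: "f \<in> MX K" "f \<noteq> 0" "irr_over K f" and p: "p \<in> MX K"
    and z: "poly f z = 0" "poly p z \<noteq> 0"
  obtains p' where "p' \<in> MX K" "\<And>z'. poly f z' = 0 \<Longrightarrow> poly p z' * poly p' z' = 1"
proof -
  have small: "\<exists>p'\<in>MX K. poly p z * poly p' z = 1"
    if "p \<in> MX K" "poly p z \<noteq> 0" "degree p < degree f" for p
    using that
  proof (induction "degree p" arbitrary: p rule: less_induct)
    case less
    show ?case
    proof (cases "degree p = 0")
      case True
      then obtain c where c: "p = [:c:]" by (auto elim: degree_eq_zeroE)
      then have "c \<in> K" using MX_coeff[OF less.prems(1), of 0] by simp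
      then have "[:inverse c:] \<in> MX K" by (intro MX_const[OF K] sf_inverse[OF K])
      moreover have "poly p z * poly [:inverse c:] z = 1" using c less.prems(2) by simp
      ultimately show ?thesis by blast
    next
      case False
      have p0: "p \<noteq> 0" using less.prems(2) by auto
      obtain q r where qr: "q \<in> MX K" "r \<in> MX K" "f = p * q + r" "r = 0 \<or> degree r < degree p"
        using MX_divmod[OF K less.prems(1) p0 f(1)] by blast
      have q0: "q \<noteq> 0" using qr(3,4) f(2) less.prems(3) by auto
      have "degree f = degree p + degree q"
      proof (cases "r = 0")
        case True then show ?thesis using qr(3) p0 q0 by (simp add: degree_mult_eq)
      next
        case False
        then have "degree r < degree (p * q)" using qr(4) p0 q0 by (simp add: degree_mult_eq)
        then show ?thesis using qr(3) p0 q0 by (simp add: degree_add_eq_left degree_mult_eq)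
      qed
      then have "degree q < degree f" using False by simp
      then have qz: "poly q z \<noteq> 0" using f(3) qr(1) q0 z(1) unfolding irr_over_def by blast
      have rz: "poly r z = - (poly p z * poly q z)" using qr(3) z(1)
        by (metis add.commute eq_neg_iff_add_eq_0 poly_add poly_mult)
      then have rz0: "poly r z \<noteq> 0" using qz less.prems(2) by simp
      then have "degree r < degree p" using qr(4) by auto
      then obtain r' where r': "r' \<in> MX K" "poly r z * poly r' z = 1"
        using less.hyps[of r] qr(2) rz0 less.prems(3) by auto
      have "poly p z * poly (- (q * r')) z = 1" using rz r'(2) by (simp add: algebra_simps)
      moreover have "- (q * r') \<in> MX K" by (intro MX_uminus[OF K] MX_mult[OF K] qr r')
      ultimately show ?thesis by blast
    qed
  qed
  obtain q r where qr: "q \<in> MX K" "r \<in> MX K" "p = f * q + r" "r = 0 \<or> degree r < degree f"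
    using MX_divmod[OF K f(1,2) p] by blast
  have rz: "poly r z = poly p z" using qr(3) z(1) by simp
  then have "degree r < degree f" using qr(4) z(2) by auto
  then obtain p' where p': "p' \<in> MX K" "poly r z * poly p' z = 1" using small[of r] qr(2) rz z(2) by auto
  have "p * p' - 1 \<in> MX K" by (intro MX_diff[OF K] MX_mult[OF K] MX_1[OF K] p p')
  then have "poly (p * p' - 1) z' = 0" if "poly f z' = 0" for z'
    using irr_over_all_roots[OF K f, of "p * p' - 1" z z'] z(1) that p'(2) rz by simp
  then show ?thesis using that[OF p'(1)] by simp
qed

definition Ext :: "complex set \<Rightarrow> complex \<Rightarrow> complex set" where
  "Ext K x = (\<lambda>p. poly p x) ` MX K"

lemma Ext_base: "sf K \<Longrightarrow> K \<subseteq> Ext K x"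
  unfolding Ext_def by (auto intro!: image_eqI[OF _ MX_const])

lemma Ext_gen: "sf K \<Longrightarrow> x \<in> Ext K x"
  unfolding Ext_def by (rule image_eqI[of _ _ "[:0,1:]"]) (auto intro!: MX_pCons MX_0 sf_0 sf_1)

lemma sf_Ext:
  assumes K: "sf K" and f: "f \<in> MX K" "f \<noteq> 0" "irr_over K f" and x: "poly f x = 0"
  shows "sf (Ext K x)"
  unfolding is_subfield_complex_def
proof (intro conjI ballI impI)
  show "0 \<in> Ext K x" "1 \<in> Ext K x" using Ext_base[OF K] sf_0[OF K] sf_1[OF K] by auto
next
  fix y z assume "y \<in> Ext K x" "z \<in> Ext K x"
  then obtain p q where pq: "p \<in> MX K" "q \<in> MX K" "y = poly p x" "z = poly q x" by (auto simp: Ext_def)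
  show "y + z \<in> Ext K x" unfolding Ext_def
    by (rule image_eqI[of _ _ "p + q"]) (auto simp: pq intro!: MX_add K)
  show "y * z \<in> Ext K x" unfolding Ext_def
    by (rule image_eqI[of _ _ "p * q"]) (auto simp: pq intro!: MX_mult K)
next
  fix y assume "y \<in> Ext K x"
  then obtain p where p: "p \<in> MX K" "y = poly p x" by (auto simp: Ext_def)
  show "- y \<in> Ext K x" unfolding Ext_def
    by (rule image_eqI[of _ _ "- p"]) (auto simp: p intro!: MX_uminus K)
next
  fix y assume "y \<in> Ext K x" "y \<noteq> 0"
  then obtain p where p: "p \<in> MX K" "y = poly p x" by (auto simp: Ext_def)
  obtain p' where p': "p' \<in> MX K" "\<And>z'. poly f z' = 0 \<Longrightarrow> poly p z' * poly p' z' = 1"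
    using irr_over_inverse[OF K f p(1) x] \<open>y \<noteq> 0\<close> p(2) by metis
  then have "inverse y = poly p' x" using p x by (metis inverse_unique)
  then show "inverse y \<in> Ext K x" unfolding Ext_def using p' by blast
qed

section \<open>Quadratic extensions and quintics\<close>

definition Adj :: "complex set \<Rightarrow> complex \<Rightarrow> complex set" where
  "Adj K s = {x + y * s | x y. x \<in> K \<and> y \<in> K}"

lemma AdjI: "x \<in> K \<Longrightarrow> y \<in> K \<Longrightarrow> x + y * s \<in> Adj K s" by (auto simp: Adj_def)

lemma Adj_base: "sf K \<Longrightarrow> K \<subseteq> Adj K s"
  using AdjI[of _ K 0 s] by (auto simp: sf_0)

lemma Adj_gen: "sf K \<Longrightarrow> s \<in> Adj K s"
  using AdjI[of 0 K 1 s] by (simp add: sf_0 sf_1)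

lemma Adj_mono: "K \<subseteq> L \<Longrightarrow> Adj K s \<subseteq> Adj L s" by (auto simp: Adj_def)

lemma Adj_least: "sf L \<Longrightarrow> K \<subseteq> L \<Longrightarrow> s \<in> L \<Longrightarrow> Adj K s \<subseteq> L"
  by (auto simp: Adj_def intro!: sf_add sf_mult)

lemma sf_Adj:
  assumes K: "sf K" and s: "s^2 \<in> K"
  shows "sf (Adj K s)"
proof (cases "s \<in> K")
  case True
  then have "Adj K s = K" using Adj_base[OF K] Adj_least[OF K order_refl True] by blast
  with K show ?thesis by simp
next
  case False
  note cl = sfD[OF K]
  show ?thesis unfolding is_subfield_complex_def
  proof (intro conjI ballI impI)
    show "0 \<in> Adj K s" "1 \<in> Adj K s" using Adj_base[OF K] cl by auto
  next
    fix y z assume "y \<in> Adj K s" "z \<in> Adj K s"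
    then obtain a b c d where *: "a \<in> K" "b \<in> K" "c \<in> K" "d \<in> K" "y = a + b * s" "z = c + d * s"
      by (auto simp: Adj_def)
    have "y + z = (a + c) + (b + d) * s" using * by (simp add: algebra_simps)
    moreover have "(a + c) + (b + d) * s \<in> Adj K s" by (intro AdjI cl *)
    ultimately show "y + z \<in> Adj K s" by (simp only:)
    have "y * z = (a * c + b * d * s^2) + (a * d + b * c) * s" using * by algebra
    moreover have "(a * c + b * d * s^2) + (a * d + b * c) * s \<in> Adj K s" by (intro AdjI cl * s)
    ultimately show "y * z \<in> Adj K s" by (simp only:)
  next
    fix y assume "y \<in> Adj K s"
    then obtain a b where *: "a \<in> K" "b \<in> K" "y = a + b * s" by (auto simp: Adj_def)
    have "- y = (- a) + (- b) * s" using * by simp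
    moreover have "(- a) + (- b) * s \<in> Adj K s" by (intro AdjI cl *)
    ultimately show "- y \<in> Adj K s" by (simp only:)
  next
    fix y assume "y \<in> Adj K s" "y \<noteq> 0"
    then obtain a b where *: "a \<in> K" "b \<in> K" "y = a + b * s" by (auto simp: Adj_def)
    have n0: "a - b * s \<noteq> 0"
    proof
      assume e: "a - b * s = 0"
      show False
      proof (cases "b = 0")
        case True then show False using e * \<open>y \<noteq> 0\<close> by simp
      next
        case b: False
        then have "s = a / b" using e by (simp add: field_simps)
        then show False using False * cl by metis
      qed
    qed
    define n where "n = a^2 - b^2 * s^2"
    have n: "n = y * (a - b * s)" unfolding n_def * by algebra
    then have "n \<noteq> 0" using n0 \<open>y \<noteq> 0\<close> by simp
    then have "y * ((a - b * s) / n) = 1" using n by simp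
    then have "inverse y = (a - b * s) / n" by (rule inverse_unique)
    then have "inverse y = a / n + (- b / n) * s" by (simp add: diff_divide_distrib)
    moreover have "n \<in> K" unfolding n_def using * s by (auto intro!: cl)
    then have "a / n + (- b / n) * s \<in> Adj K s" by (intro AdjI cl *)
    ultimately show "inverse y \<in> Adj K s" by (simp only:)
  qed
qed

text \<open>A polynomial of least degree vanishing at the root in question divides \<open>f\<close>.
  As the degrees add up to 5, it or its cofactor has degree 1 or 2.\<close>

lemma not_irr_over_factor:
  assumes K: "sf K" and f: "f \<in> MX K" "degree f = 5" and ni: "\<not> irr_over K f"
  obtains g q where "g \<in> MX K" "f = g * q" "degree g = 1 \<or> degree g = 2"
proof -
  obtain z where z: "poly f z = 0" and ex: "\<exists>p. p \<in> MX K \<and> p \<noteq> 0 \<and> degree p < 5 \<and> poly p z = 0"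
    using ni f(2) unfolding irr_over_def by auto
  define p where "p = arg_min degree (\<lambda>p. p \<in> MX K \<and> p \<noteq> 0 \<and> degree p < 5 \<and> poly p z = 0)"
  have p: "p \<in> MX K" "p \<noteq> 0" "degree p < 5" "poly p z = 0"
    and pmin: "\<And>r. r \<in> MX K \<Longrightarrow> r \<noteq> 0 \<Longrightarrow> degree r < 5 \<Longrightarrow> poly r z = 0 \<Longrightarrow> degree p \<le> degree r"
    using arg_min_nat_lemma[of "\<lambda>p. p \<in> MX K \<and> p \<noteq> 0 \<and> degree p < 5 \<and> poly p z = 0" _ degree] ex
    unfolding p_def by blast+
  obtain q r where qr: "q \<in> MX K" "r \<in> MX K" "f = p * q + r" "r = 0 \<or> degree r < degree p"
    using MX_divmod[OF K p(1,2) f(1)] by blast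
  have "poly r z = 0" using qr(3) z p by simp
  then have "r = 0" using pmin[OF qr(2)] qr(4) p(3) by fastforce
  then have fpq: "f = p * q" using qr by simp
  have f0: "f \<noteq> 0" using f(2) by auto
  then have q0: "q \<noteq> 0" using fpq by auto
  have deg: "degree p + degree q = 5" using fpq f(2) p(2) q0 by (metis degree_mult_eq)
  have "degree p \<noteq> 0" using p(2,4) by (metis degree_0_id poly_0_coeff_0 degree_eq_zeroE poly_const_conv pCons_0_0)
  then consider "degree p = 1 \<or> degree p = 2" | "degree q = 1 \<or> degree q = 2" using deg p(3) by linarith
  then show ?thesis
  proof cases
    case 1 then show ?thesis using that[OF p(1) fpq] by blast
  next
    case 2 then show ?thesis using that[OF qr(1), of p] fpq by (simp add: mult.commute)
  qed
qed

text \<open>A factor \<open>g = u + s*v\<close> of degree at most 2 has the norm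
  \<open>u^2 - s^2*v^2\<close> over \<open>K\<close>, which is nonzero of degree at most 4 and
  shares a root with \<open>f\<close>.\<close>

lemma irr_over_Adj:
  assumes K: "sf K" and s: "s^2 \<in> K" and f: "f \<in> MX K" "degree f = 5" and irr: "irr_over K f"
  shows "irr_over (Adj K s) f"
proof (cases "s \<in> K")
  case True
  then have "Adj K s = K" using Adj_base[OF K] Adj_least[OF K order_refl True] by blast
  with irr show ?thesis by simp
next
  case sK: False
  note cl = sfD[OF K]
  show ?thesis
  proof (rule ccontr)
    assume "\<not> irr_over (Adj K s) f"
    then obtain g q where g: "g \<in> MX (Adj K s)" "f = g * q" "degree g = 1 \<or> degree g = 2"
      using not_irr_over_factor[OF sf_Adj[OF K s] MX_mono[OF Adj_base[OF K] f(1)] f(2)] by metis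
    have "\<forall>i. \<exists>x y. x \<in> K \<and> y \<in> K \<and> coeff g i = x + y * s" using g(1) unfolding MX_def Adj_def by blast
    then obtain cx cy where c: "\<And>i. cx i \<in> K" "\<And>i. cy i \<in> K" "\<And>i. coeff g i = cx i + cy i * s" by metis
    define u where "u = [:cx 0, cx 1, cx 2:]"
    define v where "v = [:cy 0, cy 1, cy 2:]"
    have uv: "u \<in> MX K" "v \<in> MX K" unfolding u_def v_def using c by (auto intro!: MX_pCons MX_0 K)
    have geq: "g = u + smult s v"
    proof (rule poly_eqI)
      fix i :: nat
      consider "i = 0" | "i = 1" | "i = 2" | "i > 2" by linarith
      then show "coeff g i = coeff (u + smult s v) i"
      proof cases
        case 4
        then have "coeff g i = 0" using g(3) by (auto intro: coeff_eq_0)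
        moreover obtain k where "i = Suc (Suc (Suc k))" using 4 by (metis Suc_eq_numeral less_imp_Suc_add numeral_2_eq_2 add_Suc)
        ultimately show ?thesis by (simp add: u_def v_def)
      qed (simp_all add: u_def v_def c(3) numeral_2_eq_2)
    qed
    define n where "n = u^2 - smult (s^2) (v^2)"
    have n: "n = g * (u - smult s v)" unfolding n_def geq by (simp add: algebra_simps power2_eq_square smult_add_right)
    have "n = u * u - [:s^2:] * (v * v)" by (simp add: n_def power2_eq_square)
    moreover have "u * u - [:s^2:] * (v * v) \<in> MX K" by (intro MX_diff MX_mult MX_const K uv s)
    ultimately have nK: "n \<in> MX K" by (simp only:)
    have "u - smult s v \<noteq> 0"
    proof
      assume e: "u - smult s v = 0"
      have "v = 0"
      proof (rule poly_eqI)
        fix i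
        have "coeff u i = s * coeff v i" using e by (metis coeff_smult eq_iff_diff_eq_0)
        then have "coeff v i \<noteq> 0 \<Longrightarrow> s = coeff u i / coeff v i" by simp
        then show "coeff v i = coeff 0 i" using sK cl(8)[OF MX_coeff[OF uv(1)] MX_coeff[OF uv(2)]] by (metis coeff_0)
      qed
      with e geq g(3) show False by auto
    qed
    moreover have g0: "g \<noteq> 0" using g(3) by auto
    ultimately have n0: "n \<noteq> 0" using n by simp
    have "degree u \<le> 2" "degree v \<le> 2" by (simp_all add: u_def v_def)
    then have "degree (u^2) \<le> 4" "degree (smult (s^2) (v^2)) \<le> 4"
      using degree_power_le[of u 2] degree_power_le[of v 2] degree_smult_le[of "s^2" "v^2"] by linarith+
    then have "degree n \<le> 4" unfolding n_def by (rule degree_diff_le)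
    then have dn: "degree n < degree f" using f(2) by simp
    have "\<not> constant (poly g)" using g(3) by (auto simp: constant_degree)
    then obtain w where w: "poly g w = 0" using fundamental_theorem_of_algebra by blast
    have "poly f w = 0" "poly n w = 0" using w n g(2) by simp_all
    then show False using irr nK n0 dn unfolding irr_over_def by blast
  qed
qed

lemma half_sum_diff:
  fixes x y :: "'a::field_char_0"
  shows "x + y = S \<Longrightarrow> x - y = D \<Longrightarrow> x = (S + D) / 2"
  by auto

section \<open>Roots of Brumer's quintic in a subfield\<close>

lemma degree_bru_poly [simp]: "degree (bru_poly a t) = 5"
  by (simp add: bru_poly_def)

lemma bru_poly_nz [simp]: "bru_poly a t \<noteq> 0"
  using degree_bru_poly[of a t] by force

lemma bru_poly_MX:
  assumes K: "sf K" and "a \<in> K" "t \<in> K"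
  shows "bru_poly a t \<in> MX K"
  unfolding bru_poly_def using assms by (intro MX_pCons[OF K] MX_0[OF K] sfD[OF K])

lemma lyness_mod: assumes "lyness u" shows "u j = u (j mod 5)"
proof -
  have "u (k + 5 * n) = u k" for k n
  proof (induction n)
    case (Suc n)
    then show ?case using lyness_period[OF assms, of "k + 5 * n"] by (simp add: algebra_simps)
  qed simp
  from this[of "j mod 5" "j div 5"] show ?thesis by simp
qed

lemma bru_poly_root_iff:
  assumes "lyness u"
  shows "poly (bru_poly (ly_a u) (ly_t u)) x = 0 \<longleftrightarrow> (\<exists>j. x = - u j)"
proof
  assume "poly (bru_poly (ly_a u) (ly_t u)) x = 0"
  then have "u 0 + x = 0 \<or> u 1 + x = 0 \<or> u 2 + x = 0 \<or> u 3 + x = 0 \<or> u 4 + x = 0"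
    unfolding poly_bru_poly_lyness[OF assms] by auto
  then show "\<exists>j. x = - u j" by (metis add_eq_0_iff)
next
  assume "\<exists>j. x = - u j"
  then obtain j where j: "x = - u j" by blast
  have "j mod 5 = 0 \<or> j mod 5 = 1 \<or> j mod 5 = 2 \<or> j mod 5 = 3 \<or> j mod 5 = 4" by presburger
  then have "x = - u 0 \<or> x = - u 1 \<or> x = - u 2 \<or> x = - u 3 \<or> x = - u 4"
    using j lyness_mod[OF assms, of j] by auto
  then show "poly (bru_poly (ly_a u) (ly_t u)) x = 0"
    unfolding poly_bru_poly_lyness[OF assms] by auto
qed

text \<open>This is what excludes a factorisation of type \<open>2 + 3\<close> without a root.\<close>

lemma lyness_pair_in_field:
  assumes K: "sf K" and ly: "lyness u" and j: "j < 5" "j \<noteq> 0"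
    and s: "u 0 + u j \<in> K" and p: "u 0 * u j \<in> K"
  shows "\<exists>k. u k \<in> K"
proof -
  note r = lyness_rels[OF ly] and cl = sfD[OF K]
  consider "j = 1" | "j = 2" | "j = 3" | "j = 4" using j by linarith
  then show ?thesis
  proof cases
    case 1
    have "u 3 = (1 + (u 0 + u j)) / (u 0 * u j)" using lyness_solve[OF ly] 1 by simp
    then show ?thesis using s p cl by metis
  next
    case 2
    have "u 1 = u 0 * u j - 1" using r(1) 2 by simp
    then show ?thesis using p cl by metis
  next
    case 3
    have "u 4 = u 0 * u j - 1" using r(4) 3 by (simp add: mult.commute)
    then show ?thesis using p cl by metis
  next
    case 4
    have "u 2 * (u 0 * u 4) = 1 + (u 0 + u 4)" using r(1,5) r(3) r(4) by algebra
    then have "u 2 = (1 + (u 0 + u j)) / (u 0 * u j)" using r 4 by (simp add: field_simps)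
    then show ?thesis using s p cl by metis
  qed
qed

text \<open>A quadratic factor puts the sum and the product of two entries into \<open>K\<close>,
  and then the Lyness relations put a third entry there. The cycle is shifted so that the first of
  the two entries becomes \<open>v 0\<close>.\<close>

lemma not_irr_root_in_field:
  assumes K: "sf K" and ly: "lyness u" and aK: "ly_a u \<in> K" "ly_t u \<in> K"
    and ni: "\<not> irr_over K (bru_poly (ly_a u) (ly_t u))"
  shows "\<exists>j. u j \<in> K"
proof -
  note cl = sfD[OF K]
  let ?f = "bru_poly (ly_a u) (ly_t u)"
  obtain g q where g: "g \<in> MX K" "?f = g * q" "degree g = 1 \<or> degree g = 2"
    using not_irr_over_factor[OF K bru_poly_MX[OF K aK] degree_bru_poly ni] by metis
  have "\<not> constant (poly g)" using g(3) by (auto simp: constant_degree)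
  then obtain w where w: "poly g w = 0" using fundamental_theorem_of_algebra by blast
  then have "poly ?f w = 0" using g(2) by simp
  then obtain i where i: "w = - u i" using bru_poly_root_iff[OF ly] by blast
  define v where "v = (\<lambda>j. u (j + i))"
  have lv: "lyness v" "ly_a v = ly_a u" "ly_t v = ly_t u"
    using lyness_shift[OF ly] ly_shift[OF ly] by (auto simp: v_def)
  have v0: "w = - v 0" using i by (simp add: v_def)
  have "[:v 0, 1:] dvd g" using w v0 by (simp add: poly_eq_0_iff_dvd)
  then obtain g1 where g1: "g = [:v 0, 1:] * g1" by (auto elim: dvdE)
  have g10: "g1 \<noteq> 0" using g1 g(3) by auto
  have "degree g = 1 + degree g1" using g1 g10 by (simp add: degree_mult_eq del: mult_pCons_left)
  then consider "degree g1 = 0" | "degree g1 = 1" using g(3) by linarith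
  then show ?thesis
  proof cases
    case 1
    then obtain c where c: "g1 = [:c:]" by (auto elim: degree_eq_zeroE)
    then have "coeff g 0 = c * v 0" "coeff g 1 = c" "c \<noteq> 0" using g1 g10 by auto
    then have "v 0 = coeff g 0 / coeff g 1" by simp
    then have "v 0 \<in> K" using MX_coeff[OF g(1)] cl by metis
    then show ?thesis by (auto simp: v_def)
  next
    case 2
    then obtain b c where bc: "g1 = [:b, c:]" "c \<noteq> 0" by (metis degree1_coeffs)
    have "[:v 0, 1:] * ([:v 1, 1:] * [:v 2, 1:] * [:v 3, 1:] * [:v 4, 1:]) = [:v 0, 1:] * (g1 * q)"
      using bru_poly_lyness[OF lv(1)] g(2) g1 lv by (simp only: mult.assoc)
    then have fac: "[:v 1, 1:] * [:v 2, 1:] * [:v 3, 1:] * [:v 4, 1:] = g1 * q"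
      by (metis mult_left_cancel pCons_eq_0_iff zero_neq_one)
    define x where "x = - b / c"
    have "poly g1 x = 0" using bc by (simp add: x_def)
    then have "poly ([:v 1, 1:] * [:v 2, 1:] * [:v 3, 1:] * [:v 4, 1:]) x = 0" using fac by simp
    then have "(v 1 + x) * (v 2 + x) * (v 3 + x) * (v 4 + x) = 0" unfolding poly_mult by simp
    then have "v 1 + x = 0 \<or> v 2 + x = 0 \<or> v 3 + x = 0 \<or> v 4 + x = 0" by auto
    then have "\<exists>j. j < 5 \<and> j \<noteq> 0 \<and> v j + x = 0"
      by (elim disjE) (rule exI[of _ 1], simp, rule exI[of _ 2], simp, rule exI[of _ 3], simp, rule exI[of _ 4], simp)
    then obtain j where j: "j < 5" "j \<noteq> 0" "v j + x = 0" by blast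
    then have b: "b = c * v j" using bc(2) by (simp add: x_def field_simps)
    have "coeff g 0 = c * (v 0 * v j)" "coeff g 1 = c * (v 0 + v j)" "coeff g 2 = c"
      using g1 bc b by (simp_all add: numeral_2_eq_2 algebra_simps)
    then have "v 0 + v j = coeff g 1 / coeff g 2" "v 0 * v j = coeff g 0 / coeff g 2" using bc(2) by simp_all
    then have "v 0 + v j \<in> K" "v 0 * v j \<in> K" using MX_coeff[OF g(1)] cl by metis+
    then show ?thesis using lyness_pair_in_field[OF K lv(1) j(1,2)] by (auto simp: v_def)
  qed
qed

lemma ctr_in_field:
  assumes K: "sf K" and "a \<in> K" "p \<in> K"
  shows "ctr_sum a p \<in> K" "ctr_prod a p \<in> K" "ctr_fac a p \<in> K"
proof -
  note cl = sfD[OF K]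
  show S: "ctr_sum a p \<in> K" and P: "ctr_prod a p \<in> K" unfolding ctr_sum_def ctr_prod_def by (intro cl assms)+
  show "ctr_fac a p \<in> K" unfolding ctr_fac_def by (intro cl assms S P)
qed

lemma lyness_in_field_of_pair:
  assumes K: "sf K" and ly: "lyness u" and "u 0 \<in> K" "u 2 \<in> K"
  shows "u j \<in> K"
proof -
  note cl = sfD[OF K] and r = lyness_rels[OF ly]
  have 1: "u 1 = u 0 * u 2 - 1" using r(1) by simp
  have u1: "u 1 \<in> K" unfolding 1 by (intro cl assms)
  have u3: "u 3 = (1 + u 0 + u 1) / (u 0 * u 1)" and u4: "u 4 = (1 + u 0) / u 1" using lyness_solve[OF ly] by auto
  have "u 3 \<in> K" "u 4 \<in> K" unfolding u3 u4 by (intro cl assms u1)+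
  moreover have "j mod 5 = 0 \<or> j mod 5 = 1 \<or> j mod 5 = 2 \<or> j mod 5 = 3 \<or> j mod 5 = 4" by presburger
  ultimately have "u (j mod 5) \<in> K" using u1 assms by auto
  then show ?thesis using lyness_mod[OF ly, of j] by simp
qed

text \<open>The opposite pair has a sum rational in the known entry and the difference
  \<open>ly_y u / ctr_fac\<close>. With the nonzero ordinate in \<open>K\<close>, one root therefore
  generates all others, as in a cyclic extension.\<close>

lemma lyness_all_in_field:
  assumes K: "sf K" and ly: "lyness u" and aK: "ly_a u \<in> K" and y: "ly_y u \<in> K" "ly_y u \<noteq> 0"
    and ui: "u i \<in> K"
  shows "u j \<in> K"
proof -
  note cl = sfD[OF K]
  define v where "v = (\<lambda>j. u (j + i))"
  have lv: "lyness v" "ly_a v = ly_a u" "ly_y v = ly_y u"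
    using lyness_shift[OF ly] ly_shift[OF ly] by (auto simp: v_def)
  have v0: "v 0 \<in> K" using ui by (simp add: v_def)
  note c = lyness_centre[OF lv(1)]
  note S = ctr_in_field[OF K aK v0]
  have K0: "ctr_fac (ly_a u) (v 0) \<noteq> 0" using c(4) y lv by auto
  then have "v 2 - v 3 = ly_y u / ctr_fac (ly_a u) (v 0)" using c(4) lv by (simp add: field_simps)
  then have "v 2 = (ctr_sum (ly_a u) (v 0) + ly_y u / ctr_fac (ly_a u) (v 0)) / 2"
    using c(2) lv by (intro half_sum_diff) simp_all
  moreover have "(ctr_sum (ly_a u) (v 0) + ly_y u / ctr_fac (ly_a u) (v 0)) / 2 \<in> K" by (intro cl S y)
  ultimately have "v 2 \<in> K" by (simp only:)
  \<comment> \<open>With period 5, shifting forward by \<open>4 * i\<close> undoes the shift by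
    \<open>i\<close>.\<close>
  then have "v (j + 4 * i) \<in> K" using lyness_in_field_of_pair[OF K lv(1) v0] by blast
  moreover have "v (j + 4 * i) = u j"
    unfolding v_def using lyness_mod[OF ly, of "j + 4 * i + i"] lyness_mod[OF ly, of j] by simp
  ultimately show ?thesis by simp
qed

text \<open>Functions of the index that are given by one polynomial over \<open>K\<close> in the roots: irreducibility over \<open>K\<close>
  makes the shift act on them, which replaces the Galois action.\<close>

definition Dset :: "complex set \<Rightarrow> (nat \<Rightarrow> complex) \<Rightarrow> (nat \<Rightarrow> complex) set" where
  "Dset K u = {\<phi>. \<exists>p\<in>MX K. \<forall>j. \<phi> j = poly p (- u j)}"

text \<open>As the ordinate lies in \<open>K\<close>, the orientation of the cycle is fixed over
  \<open>K\<close>, and the shift plays the role of a generator of the Galois group of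
  \<open>K(u 0)\<close> over \<open>K\<close>.\<close>

locale irr_cycle =
  fixes K :: "complex set" and u :: "nat \<Rightarrow> complex"
  assumes K: "sf K" and ly: "lyness u" and aK: "ly_a u \<in> K" and tK: "ly_t u \<in> K"
    and yK: "ly_y u \<in> K" and y0: "ly_y u \<noteq> 0"
    and irr: "irr_over K (bru_poly (ly_a u) (ly_t u))"
begin

lemmas cl = sfD[OF K]

lemma fK: "bru_poly (ly_a u) (ly_t u) \<in> MX K" by (rule bru_poly_MX[OF K aK tK])

lemma root: "poly (bru_poly (ly_a u) (ly_t u)) (- u j) = 0"
  using bru_poly_root_iff[OF ly] by blast

lemma D_const: "c \<in> K \<Longrightarrow> (\<lambda>j. c) \<in> Dset K u"
  unfolding Dset_def by (auto intro!: bexI[of _ "[:c:]"] MX_const K)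

lemma D_add: "\<phi> \<in> Dset K u \<Longrightarrow> \<psi> \<in> Dset K u \<Longrightarrow> (\<lambda>j. \<phi> j + \<psi> j) \<in> Dset K u"
  unfolding Dset_def by (auto, rename_tac p q, rule_tac x="p+q" in bexI, auto intro: MX_add K)

lemma D_diff: "\<phi> \<in> Dset K u \<Longrightarrow> \<psi> \<in> Dset K u \<Longrightarrow> (\<lambda>j. \<phi> j - \<psi> j) \<in> Dset K u"
  unfolding Dset_def by (auto, rename_tac p q, rule_tac x="p-q" in bexI, auto intro: MX_diff K)

lemma D_mult: "\<phi> \<in> Dset K u \<Longrightarrow> \<psi> \<in> Dset K u \<Longrightarrow> (\<lambda>j. \<phi> j * \<psi> j) \<in> Dset K u"
  unfolding Dset_def by (auto, rename_tac p q, rule_tac x="p*q" in bexI, auto intro: MX_mult K)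

lemma D_power: "\<phi> \<in> Dset K u \<Longrightarrow> (\<lambda>j. \<phi> j ^ n) \<in> Dset K u"
  by (induction n) (auto intro: D_const D_mult cl)

lemma D_inverse:
  assumes "\<phi> \<in> Dset K u" "\<phi> 0 \<noteq> 0"
  shows "(\<lambda>j. inverse (\<phi> j)) \<in> Dset K u"
proof -
  obtain p where p: "p \<in> MX K" "\<And>j. \<phi> j = poly p (- u j)" using assms by (auto simp: Dset_def)
  obtain p' where p': "p' \<in> MX K" "\<And>z'. poly (bru_poly (ly_a u) (ly_t u)) z' = 0 \<Longrightarrow> poly p z' * poly p' z' = 1"
    using irr_over_inverse[OF K fK bru_poly_nz irr p(1) root[of 0]] assms(2) p(2) by metis
  have "inverse (\<phi> j) = poly p' (- u j)" for j
    using p'(2)[OF root[of j]] p(2) by (intro inverse_unique) simp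
  then show ?thesis unfolding Dset_def using p'(1) by blast
qed

lemma D_divide:
  assumes "\<phi> \<in> Dset K u" "\<psi> \<in> Dset K u" "\<psi> 0 \<noteq> 0"
  shows "(\<lambda>j. \<phi> j / \<psi> j) \<in> Dset K u"
  using D_mult[OF assms(1) D_inverse[OF assms(2,3)]] by (simp add: divide_inverse)

lemma D_u: "u \<in> Dset K u"
  unfolding Dset_def by (auto intro!: bexI[of _ "[:0,-1:]"] MX_pCons MX_0 K cl)

text \<open>The formula for \<open>u (j+2)\<close> through the opposite pair of \<open>u j\<close>
  has the same coefficients for every \<open>j\<close>, because \<open>ly_a\<close> and
  \<open>ly_y\<close> are invariant under the shift. Irreducibility enters through the
  divisions.\<close>

lemma D_u2: "(\<lambda>j. u (j+2)) \<in> Dset K u"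
proof -
  let ?a = "ly_a u" and ?y = "ly_y u"
  have c: "1 + u j \<noteq> 0" "u (j+2) + u (j+3) = ctr_sum ?a (u j)" "?y = (u (j+2) - u (j+3)) * ctr_fac ?a (u j)" for j
    using lyness_centre[OF lyness_shift[OF ly, of j]] ly_shift[OF ly, of j] by (simp_all add: ac_simps)
  have K0: "ctr_fac ?a (u j) \<noteq> 0" for j using c(3)[of j] y0 by auto
  have e: "u (j+2) = (ctr_sum ?a (u j) + ?y / ctr_fac ?a (u j)) / 2" for j
  proof -
    have "u (j+2) - u (j+3) = ?y / ctr_fac ?a (u j)" using c(3)[of j] K0[of j] by simp
    with c(2)[of j] show ?thesis by (rule half_sum_diff)
  qed
  have S: "(\<lambda>j. ctr_sum ?a (u j)) \<in> Dset K u" unfolding ctr_sum_def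
    using c(1) by (intro D_divide D_diff D_add D_const D_u aK cl)
  have P: "(\<lambda>j. ctr_prod ?a (u j)) \<in> Dset K u" unfolding ctr_prod_def
    using c(1) lynessD(1)[OF ly] by (intro D_divide D_mult D_add D_const D_u aK cl) simp
  have uk: "(\<lambda>j. u j ^ n) \<in> Dset K u" for n by (rule D_power[OF D_u])
  have "(\<lambda>j. (0 - (u j^2 + u j + 1 - u j * (u j * ctr_sum ?a (u j) - 2))) * (1 - u j + ctr_sum ?a (u j) - ctr_prod ?a (u j))) \<in> Dset K u"
    by (intro D_diff D_mult D_add D_const D_u uk S P cl)
  then have Kd: "(\<lambda>j. ctr_fac ?a (u j)) \<in> Dset K u" unfolding ctr_fac_def by (simp only: diff_0)
  have "(\<lambda>j. (ctr_sum ?a (u j) + ?y / ctr_fac ?a (u j)) / 2) \<in> Dset K u"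
    using K0 by (intro D_divide D_add D_const S Kd yK cl) simp_all
  then show ?thesis unfolding e[symmetric] .
qed

lemma D_shift2:
  assumes "\<phi> \<in> Dset K u"
  shows "(\<lambda>j. \<phi> (j+2)) \<in> Dset K u"
proof -
  obtain p where p: "p \<in> MX K" "\<And>j. \<phi> j = poly p (- u j)" using assms by (auto simp: Dset_def)
  obtain r where r: "r \<in> MX K" "\<And>j. u (j+2) = poly r (- u j)" using D_u2 by (auto simp: Dset_def)
  have "\<phi> (j+2) = poly (pcompose p (- r)) (- u j)" for j
    using p(2)[of "j+2"] r(2)[of j] by (simp add: poly_pcompose)
  moreover have "pcompose p (- r) \<in> MX K" by (intro MX_pcompose MX_uminus K p r)
  ultimately show ?thesis unfolding Dset_def by blast
qed

lemma D_uk: "(\<lambda>j. u (j+k)) \<in> Dset K u"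
proof -
  have m: "(\<lambda>j. u (j + 2 * m)) \<in> Dset K u" for m
  proof (induction m)
    case (Suc m)
    then show ?case using D_shift2[OF Suc] by (simp add: ac_simps)
  qed (simp add: D_u)
  \<comment> \<open>2 and 3 are inverse modulo 5, so double shifts generate all shifts.\<close>
  have "u (j + 2 * (3 * k)) = u (j + k)" for j
  proof -
    have "(j + 2 * (3 * k)) mod 5 = (j + k) mod 5" by presburger
    then show ?thesis using lyness_mod[OF ly, of "j + 2 * (3 * k)"] lyness_mod[OF ly, of "j + k"] by simp
  qed
  then show ?thesis using m[of "3 * k"] by simp
qed

lemma D_h:
  assumes "\<zeta> \<in> K"
  shows "(\<lambda>j. ly_h \<zeta> (\<lambda>i. u (i + j))) \<in> Dset K u"
proof -
  have "(\<lambda>j. u (j+0) + \<zeta> * u (j+1) + \<zeta>^2 * u (j+2) + \<zeta>^3 * u (j+3) + \<zeta>^4 * u (j+4)) \<in> Dset K u"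
    by (intro D_add D_mult D_const D_uk cl assms)
  then show ?thesis unfolding ly_h_def by (simp add: ac_simps)
qed

lemma D_vanish:
  assumes "\<phi> \<in> Dset K u" "\<phi> 0 = 0"
  shows "\<phi> j = 0"
proof -
  obtain p where p: "p \<in> MX K" "\<And>j. \<phi> j = poly p (- u j)" using assms by (auto simp: Dset_def)
  then show ?thesis using irr_over_all_roots[OF K fK bru_poly_nz irr p(1) root[of 0] _ root[of j]] assms(2) by simp
qed

text \<open>Newton's identities settle the exponents below 5, the recurrence given by the quintic
  the others. This makes the sum over the five indices a trace with values in
  \<open>K\<close>.\<close>

lemma power_sum: "(\<Sum>j<5. (- u j) ^ n) \<in> K"
proof (induction n rule: less_induct)
  case (less n)
  note e = lyness_esym[OF ly]
  let ?a = "ly_a u" and ?t = "ly_t u"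
  have sum5: "(\<Sum>j<5. g j) = g 0 + g 1 + g 2 + g 3 + g 4" for g :: "nat \<Rightarrow> complex"
    by (simp add: eval_nat_numeral)
  define E1 where "E1 = ?a - 3"
  define E2 where "E2 = - (?a - ?t - 3)"
  define E3 where "E3 = ?a^2 - ?a - 2 * ?t - 1"
  have E: "E1 \<in> K" "E2 \<in> K" "E3 \<in> K" unfolding E1_def E2_def E3_def by (intro cl aK tK)+
  have c: "(\<Sum>j<5. (- u j) ^ 1) = - E1" "(\<Sum>j<5. (- u j) ^ 2) = E1^2 - 2 * E2"
    "(\<Sum>j<5. (- u j) ^ 3) = - (E1^3 - 3 * E1 * E2 + 3 * E3)"
    "(\<Sum>j<5. (- u j) ^ 4) = E1^4 - 4 * E1^2 * E2 + 2 * E2^2 + 4 * E1 * E3 - 4 * ?t"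
    unfolding sum5 e[folded E1_def E2_def E3_def, symmetric] ly_t_def by algebra+
  consider "n = 0" | "n = 1" | "n = 2" | "n = 3" | "n = 4" | "n \<ge> 5" by linarith
  then show ?case
  proof cases
    case 1 then show ?thesis by (auto intro: cl)
  next
    case 2 show ?thesis unfolding 2 c by (intro cl E)
  next
    case 3 show ?thesis unfolding 3 c by (intro cl E)
  next
    case 4 show ?thesis unfolding 4 c by (intro cl E)
  next
    case 5 show ?thesis unfolding 5 c by (intro cl E tK)
  next
    case 6
    then obtain m where m: "n = m + 5" by (metis add.commute le_Suc_ex)
    have f: "(- u j)^n = - (?a * (- u j)^m + ?t * (- u j)^(m+1) + E3 * (- u j)^(m+2) + E2 * (- u j)^(m+3) + E1 * (- u j)^(m+4))" for j
    proof -
      define x where "x = - u j"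
      have "poly (bru_poly ?a ?t) x = 0" using root by (simp add: x_def)
      then have "x^5 = - (?a + ?t * x + E3 * x^2 + E2 * x^3 + E1 * x^4)"
        unfolding bru_poly_def E1_def E2_def E3_def by simp algebra
      then have "x^m * x^5 = - (?a * x^m + ?t * (x^m * x) + E3 * (x^m * x^2) + E2 * (x^m * x^3) + E1 * (x^m * x^4))"
        by (simp only:) (simp add: algebra_simps power2_eq_square)
      then show ?thesis unfolding m x_def[symmetric] by (simp add: power_add power2_eq_square)
    qed
    have "(\<Sum>j<5. (- u j)^n) = - (?a * (\<Sum>j<5. (- u j)^m) + ?t * (\<Sum>j<5. (- u j)^(m+1)) + E3 * (\<Sum>j<5. (- u j)^(m+2))
        + E2 * (\<Sum>j<5. (- u j)^(m+3)) + E1 * (\<Sum>j<5. (- u j)^(m+4)))"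
      unfolding f by (simp only: sum_negf sum.distrib sum_distrib_left)
    moreover have "\<dots> \<in> K" by (intro cl aK tK E less.IH) (auto simp: m)
    ultimately show ?thesis by simp
  qed
qed

lemma D_trace:
  assumes "\<phi> \<in> Dset K u"
  shows "(\<Sum>j<5. \<phi> j) \<in> K"
proof -
  obtain p where p: "p \<in> MX K" "\<And>j. \<phi> j = poly p (- u j)" using assms by (auto simp: Dset_def)
  have "(\<Sum>j<5. \<phi> j) = (\<Sum>j<5. \<Sum>i\<le>degree p. coeff p i * (- u j)^i)"
    unfolding p(2) by (simp add: poly_altdef)
  also have "\<dots> = (\<Sum>i\<le>degree p. \<Sum>j<5. coeff p i * (- u j)^i)" by (rule sum.swap)
  also have "\<dots> = (\<Sum>i\<le>degree p. coeff p i * (\<Sum>j<5. (- u j)^i))" by (simp add: sum_distrib_left)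
  also have "\<dots> \<in> K" by (intro sf_sum K cl power_sum MX_coeff p)
  finally show ?thesis .
qed

end

section \<open>Kummer theory for the resolvent of a cycle\<close>

lemma fifth_roots:
  fixes \<zeta> h c :: "'a::field"
  assumes z: "1 + \<zeta> + \<zeta>^2 + \<zeta>^3 + \<zeta>^4 = 0" and "h^5 = c^5"
  shows "\<exists>k. h = \<zeta>^k * c"
proof -
  have "(h - c) * (h - \<zeta> * c) * (h - \<zeta>^2 * c) * (h - \<zeta>^3 * c) * (h - \<zeta>^4 * c) = h^5 - c^5"
    using z by algebra
  then have "h - \<zeta>^0 * c = 0 \<or> h - \<zeta>^1 * c = 0 \<or> h - \<zeta>^2 * c = 0 \<or> h - \<zeta>^3 * c = 0 \<or> h - \<zeta>^4 * c = 0"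
    using assms(2) by auto
  then show ?thesis by (metis eq_iff_diff_eq_0)
qed

lemma ly_h_shift:
  assumes ly: "lyness u" and z: "1 + \<zeta> + \<zeta>^2 + \<zeta>^3 + \<zeta>^4 = 0"
  shows "\<zeta>^j * ly_h \<zeta> (\<lambda>i. u (i + j)) = ly_h \<zeta> u"
proof (induction j)
  case (Suc j)
  have p: "\<zeta>^5 = 1" using z by algebra
  define v where "v = (\<lambda>i. u (i + j))"
  have v5: "v 5 = v 0" using lyness_period[OF ly, of j] by (simp add: v_def add.commute)
  have "\<zeta> * ly_h \<zeta> (\<lambda>i. v (i + 1)) = \<zeta> * v 1 + \<zeta>^2 * v 2 + \<zeta>^3 * v 3 + \<zeta>^4 * v 4 + \<zeta>^5 * v 5"
    unfolding ly_h_def by (simp add: eval_nat_numeral algebra_simps)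
  also have "\<dots> = ly_h \<zeta> v" unfolding v5 p ly_h_def by simp
  finally have e: "\<zeta> * ly_h \<zeta> (\<lambda>i. v (i + 1)) = ly_h \<zeta> v" .
  have "(\<lambda>i. v (i + 1)) = (\<lambda>i. u (i + Suc j))" by (simp add: v_def)
  then have "\<zeta>^Suc j * ly_h \<zeta> (\<lambda>i. u (i + Suc j)) = \<zeta>^j * (\<zeta> * ly_h \<zeta> (\<lambda>i. v (i + 1)))" by simp
  also have "\<dots> = ly_h \<zeta> u" unfolding e using Suc by (simp add: v_def)
  finally show ?case .
qed (simp)

context irr_cycle
begin

lemma not_fifth_power:
  assumes z: "1 + \<zeta> + \<zeta>^2 + \<zeta>^3 + \<zeta>^4 = 0" and zK: "\<zeta> \<in> K" and c: "c \<in> K" "c^5 = (ly_h \<zeta> u)^5"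
    and h0: "ly_h \<zeta> u \<noteq> 0"
  shows False
proof -
  obtain k where "ly_h \<zeta> u = \<zeta>^k * c" using fifth_roots[OF z] c(2) by metis
  then have hK: "ly_h \<zeta> u \<in> K" using c(1) zK by (simp add: cl)
  have "(\<lambda>j. ly_h \<zeta> (\<lambda>i. u (i + j)) - ly_h \<zeta> u) \<in> Dset K u" by (intro D_diff D_h D_const zK hK)
  from D_vanish[OF this, of 1] have "ly_h \<zeta> (\<lambda>i. u (i + 1)) = ly_h \<zeta> u" by simp
  then have "\<zeta> * ly_h \<zeta> u = ly_h \<zeta> u" using ly_h_shift[OF ly z, of 1] by simp
  then have "\<zeta> = 1" using h0 by simp
  then show False using z by simp
qed

text \<open>The conjugates \<open>Q j\<close> of \<open>q\<close> have the same fifth power, so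
  \<open>Q j = \<zeta>^(m j) * q\<close> with some exponents \<open>m j\<close>. The trace of
  \<open>h^i * q\<close> is \<open>h^i * q * c i\<close> with a sum \<open>c i\<close> of roots of
  unity. By orthogonality the \<open>c i\<close> add up to \<open>5 * \<zeta>^(m 0)\<close>, so one
  of them is nonzero and can be divided out.\<close>

lemma kummer_generator:
  assumes z: "1 + \<zeta> + \<zeta>^2 + \<zeta>^3 + \<zeta>^4 = 0" and zK: "\<zeta> \<in> K"
    and h0: "ly_h \<zeta> u \<noteq> 0" and q: "q \<in> Ext K (- u 0)" "q \<noteq> 0" "q^5 \<in> K"
  shows "\<exists>i. (ly_h \<zeta> u)^i * q \<in> K"
proof -
  have p5: "\<zeta>^5 = 1" using z by algebra
  have z0: "\<zeta> \<noteq> 0" using z by auto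
  obtain p where p: "p \<in> MX K" "q = poly p (- u 0)" using q(1) by (auto simp: Ext_def)
  define Q where "Q = (\<lambda>j. poly p (- u j))"
  have QD: "Q \<in> Dset K u" unfolding Dset_def Q_def using p(1) by blast
  have Q0: "Q 0 = q" using p(2) by (simp add: Q_def)
  have "(\<lambda>j. Q j ^ 5 - q^5) \<in> Dset K u" by (intro D_diff D_power QD D_const q)
  from D_vanish[OF this] have "Q j ^ 5 = q^5" for j by (simp add: Q0)
  then have "\<exists>k. Q j = \<zeta>^k * q" for j using fifth_roots[OF z] by blast
  then obtain m where m: "\<And>j. Q j = \<zeta>^(m j) * q" by metis
  define h where "h = ly_h \<zeta> u"
  define H where "H = (\<lambda>j. ly_h \<zeta> (\<lambda>i. u (i + j)))"
  have HD: "H \<in> Dset K u" unfolding H_def by (rule D_h[OF zK])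
  \<comment> \<open>The exponent \<open>4*j\<close> stands for \<open>-j\<close>, as
    \<open>\<zeta>^5 = 1\<close>.\<close>
  have Hj: "H j = \<zeta>^(4*j) * h" for j
  proof -
    have "\<zeta>^(4*j) * (\<zeta>^j * H j) = (\<zeta>^5)^j * H j" by (simp add: power_mult[symmetric] power_add[symmetric] mult.assoc[symmetric])
    then show ?thesis using ly_h_shift[OF ly z, of j] by (simp add: p5 H_def h_def)
  qed
  define S where "S = (\<lambda>i. \<Sum>j<5. H j ^ i * Q j)"
  have SK: "S i \<in> K" for i unfolding S_def by (intro D_trace D_mult D_power HD QD)
  define c where "c = (\<lambda>i. \<Sum>j<5. \<zeta>^(4*j*i + m j))"
  have ctr_fac: "c i \<in> K" for i unfolding c_def by (intro sf_sum K cl zK)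
  have Sc: "S i = h^i * q * c i" for i
    unfolding S_def c_def Hj m sum_distrib_left by (simp add: power_mult_distrib power_add power_mult[symmetric] algebra_simps)
  have "\<exists>i. c i \<noteq> 0"
  proof (rule ccontr)
    assume "\<not> ?thesis"
    then have "0 = (\<Sum>i<5. c i)" by simp
    also have "\<dots> = (\<Sum>j<5. \<Sum>i<5. \<zeta>^(4*j*i + m j))" unfolding c_def by (rule sum.swap)
    also have "\<dots> = (\<Sum>j<5. \<zeta>^(m j) * (\<Sum>i<5. (\<zeta>^(4*j))^i))"
      by (simp add: sum_distrib_left power_add power_mult[symmetric] mult.commute)
    also have "\<dots> = (\<Sum>j<(5::nat). if j = 0 then 5 * \<zeta>^(m 0) else 0)"
    proof (rule sum.cong[OF refl])
      fix j :: nat assume "j \<in> {..<5}"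
      then consider "j = 0" | "j = 1" | "j = 2" | "j = 3" | "j = 4" by (auto simp: eval_nat_numeral less_Suc_eq)
      then show "\<zeta>^(m j) * (\<Sum>i<5. (\<zeta>^(4*j))^i) = (if j = 0 then 5 * \<zeta>^(m 0) else 0)"
      proof cases
        case 1 then show ?thesis by simp
      next
        case 2
        have "(\<Sum>i<5. (\<zeta>^4)^i) = 1 + \<zeta>^4 + (\<zeta>^4)^2 + (\<zeta>^4)^3 + (\<zeta>^4)^4" by (simp add: eval_nat_numeral)
        also have "\<dots> = 0" using z by algebra
        finally show ?thesis using 2 by simp
      next
        case 3
        have "(\<Sum>i<5. (\<zeta>^8)^i) = 1 + \<zeta>^8 + (\<zeta>^8)^2 + (\<zeta>^8)^3 + (\<zeta>^8)^4" by (simp add: eval_nat_numeral)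
        also have "\<dots> = 0" using z by algebra
        finally show ?thesis using 3 by simp
      next
        case 4
        have "(\<Sum>i<5. (\<zeta>^12)^i) = 1 + \<zeta>^12 + (\<zeta>^12)^2 + (\<zeta>^12)^3 + (\<zeta>^12)^4" by (simp add: eval_nat_numeral)
        also have "\<dots> = 0" using z by algebra
        finally show ?thesis using 4 by simp
      next
        case 5
        have "(\<Sum>i<5. (\<zeta>^16)^i) = 1 + \<zeta>^16 + (\<zeta>^16)^2 + (\<zeta>^16)^3 + (\<zeta>^16)^4" by (simp add: eval_nat_numeral)
        also have "\<dots> = 0" using z by algebra
        finally show ?thesis using 5 by simp
      qed
    qed
    also have "\<dots> = 5 * \<zeta>^(m 0)" by (simp add: sum.delta)
    finally show False using z0 by simp
  qed
  then obtain i where ci: "c i \<noteq> 0" by blast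
  then have "h^i * q = S i / c i" by (simp add: Sc)
  also have "\<dots> \<in> K" by (intro cl SK ctr_fac)
  finally show ?thesis unfolding h_def by blast
qed

end

text \<open>\<open>K(\<zeta>)\<close> as a tower of quadratic extensions, over which a quintic stays irreducible.\<close>

definition N5 :: "complex \<Rightarrow> complex set \<Rightarrow> complex set" where
  "N5 \<zeta> K = Adj (Adj K (2 * (\<zeta> + \<zeta>^4) + 1)) (\<zeta> - \<zeta>^4)"

lemma N5_facts:
  assumes z: "1 + \<zeta> + \<zeta>^2 + \<zeta>^3 + \<zeta>^4 = 0" and K: "sf K"
  shows sf_N5: "sf (N5 \<zeta> K)" and N5_base: "K \<subseteq> N5 \<zeta> K" and N5_zeta: "\<zeta> \<in> N5 \<zeta> K"
    and N5_irr: "\<And>f. f \<in> MX K \<Longrightarrow> degree f = 5 \<Longrightarrow> irr_over K f \<Longrightarrow> irr_over (N5 \<zeta> K) f"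
proof -
  let ?w = "2 * (\<zeta> + \<zeta>^4) + 1" and ?s = "\<zeta> - \<zeta>^4"
  let ?L = "Adj K ?w"
  have w2: "?w^2 = 5" using z by algebra
  have w2K: "?w^2 \<in> K" unfolding w2 by (rule sf_numeral[OF K])
  have L: "sf ?L" by (rule sf_Adj[OF K w2K])
  have KL: "K \<subseteq> ?L" by (rule Adj_base[OF K])
  have wL: "?w \<in> ?L" by (rule Adj_gen[OF K])
  have "?s^2 = - 3 - (?w - 1) / 2" using cyclotomic_tau(2)[OF z] by (simp add: add_divide_distrib)
  also have "\<dots> \<in> ?L" by (intro sfD[OF L] wL)
  finally have s2L: "?s^2 \<in> ?L" .
  show N: "sf (N5 \<zeta> K)" unfolding N5_def by (rule sf_Adj[OF L s2L])
  have LN: "?L \<subseteq> N5 \<zeta> K" unfolding N5_def by (rule Adj_base[OF L])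
  show "K \<subseteq> N5 \<zeta> K" using KL LN by blast
  have sN: "?s \<in> N5 \<zeta> K" unfolding N5_def by (rule Adj_gen[OF L])
  have wN: "?w \<in> N5 \<zeta> K" using wL LN by blast
  have "\<zeta> = ((?w - 1) / 2 + ?s) / 2" by (simp add: field_simps)
  also have "\<dots> \<in> N5 \<zeta> K" by (intro sfD[OF N] wN sN)
  finally show "\<zeta> \<in> N5 \<zeta> K" .
  fix f assume f: "f \<in> MX K" "degree f = 5" "irr_over K f"
  have "irr_over ?L f" by (rule irr_over_Adj[OF K w2K f])
  then show "irr_over (N5 \<zeta> K) f" unfolding N5_def
    by (rule irr_over_Adj[OF L s2L MX_mono[OF KL f(1)] f(2)])
qed

lemma N5_mono: "K \<subseteq> L \<Longrightarrow> N5 \<zeta> K \<subseteq> N5 \<zeta> L"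
  unfolding N5_def by (intro Adj_mono)

section \<open>The curves and the Kummer map\<close>

lemma Bru_eq: "Bru a t = bru_poly a t"
  by (simp add: Bru_def bru_poly_def)

lemma of_rat_bru_disc: "(of_rat (bru_disc a t) :: 'a::field_char_0) = bru_disc (of_rat a) (of_rat t)"
  by (simp add: bru_disc_def of_rat_add of_rat_diff of_rat_mult of_rat_power of_rat_minus)

lemma map_poly_bru_poly: "map_poly (of_rat :: rat \<Rightarrow> 'a::field_char_0) (bru_poly a t) = bru_poly (of_rat a) (of_rat t)"
  by (simp add: bru_poly_def map_poly_pCons of_rat_add of_rat_diff of_rat_mult of_rat_power of_rat_minus)

lemma no_rat_sqrt5: "(x::rat)^2 \<noteq> 5"
proof
  assume x: "x^2 = 5"
  obtain p q where pq: "quotient_of x = (p, q)" by fastforce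
  then have q: "q > 0" "coprime p q" and xe: "x = of_int p / of_int q"
    using quotient_of_denom_pos quotient_of_coprime quotient_of_div by blast+
  have "(of_int p :: rat)^2 = 5 * (of_int q)^2" using x q xe by (simp add: field_simps power2_eq_square)
  then have "of_int (p^2) = (of_int (5 * q^2) :: rat)" by simp
  then have e: "p^2 = 5 * q^2" by (simp only: of_int_eq_iff)
  have d5: "5 dvd n" if "5 dvd n^2" for n :: int
  proof -
    define m where "m = n mod 5"
    have "m^2 mod 5 = 0" using that unfolding m_def by (simp add: power_mod dvd_eq_mod_eq_0)
    moreover have "m = 0 \<or> m = 1 \<or> m = 2 \<or> m = 3 \<or> m = 4" unfolding m_def by presburger
    ultimately have "m = 0" by auto
    then show ?thesis unfolding m_def by presburger
  qed
  have "5 dvd p" using e d5[of p] by simp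
  then obtain k where k: "p = 5 * k" by (auto elim: dvdE)
  then have "q^2 = 5 * k^2" using e by (simp add: power2_eq_square)
  then have "5 dvd q" using d5[of q] by simp
  then have "is_unit (5::int)" using \<open>5 dvd p\<close> q(2) coprime_common_divisor by blast
  then show False by simp
qed

text \<open>The quadratic has discriminant 125, so a rational zero would make 5 a square. This keeps
  rational points away from the zeros of \<open>kz\<close> and makes the centre of a symmetric cycle
  rational.\<close>

lemma brumer_disc_factor_nz: "(a::rat)^2 - 11*a - 1 \<noteq> 0"
proof
  assume "a^2 - 11*a - 1 = 0"
  then have "((2*a - 11)/5)^2 = 5" by (simp add: power2_eq_square field_simps)
  then show False using no_rat_sqrt5 by blast
qed

text \<open>Completing the square in the equation of E*_a: on that curve this is the square of
  \<open>2*y - (a-1)*s - a\<close>, where \<open>s\<close> is the abscissa.\<close>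

definition estar_cubic :: "rat \<Rightarrow> rat \<Rightarrow> rat" where
  "estar_cubic a s = 4*s^3 - 4*a*s^2 + ((a-1)*s + a)^2"

lemma on_curve_Eab:
  assumes "dd a b \<noteq> 0"
  defines "d \<equiv> dd a b"
  shows "Pt x y \<in> carrier (Eab a b) \<longleftrightarrow> d * (y / (4*d^2))^2 = bru_disc a (x / (-4*d))"
proof -
  have d: "d \<noteq> 0" using assms by simp
  define t where "t = x / (-4*d)"
  have x: "x = -4*d*t" using d by (simp add: t_def)
  have rhs: "x^3 + EA2 a b * x^2 + EA4 a b * x + EA6 a b = 16 * d^3 * bru_disc a t"
    unfolding x EA2_def EA4_def EA6_def d_def[symmetric] bru_disc_def by algebra
  have "Pt x y \<in> carrier (Eab a b) \<longleftrightarrow> y^2 = 16 * d^3 * bru_disc a t"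
    unfolding Eab_def ec_group_def on_curve_def using rhs by simp
  also have "\<dots> \<longleftrightarrow> d * (y / (4*d^2))^2 = bru_disc a t"
    using d by (simp add: field_simps power2_eq_square power3_eq_cube)
  finally show ?thesis by (simp add: t_def)
qed

lemma on_curve_Estar:
  assumes "dd a b \<noteq> 0"
  defines "d \<equiv> dd a b"
  shows "Pt x y \<in> carrier (Estar a b) \<longleftrightarrow> d * (y / (500*d^2))^2 = estar_cubic a (fstar_x a b x)"
proof -
  have d: "d \<noteq> 0" using assms by simp
  define s where "s = fstar_x a b x"
  have x: "x = 100*d*(s + 2*(a^2 - 5*a + 1)/25)" using d by (simp add: s_def fstar_x_def d_def)
  have rhs: "x^3 + SA2 a b * x^2 + SA4 a b * x + SA6 a b = 250000 * d^3 * estar_cubic a s"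
    unfolding x SA2_def SA4_def SA6_def d_def[symmetric] estar_cubic_def by (simp add: field_simps) algebra
  have "Pt x y \<in> carrier (Estar a b) \<longleftrightarrow> y^2 = 250000 * d^3 * estar_cubic a s"
    unfolding Estar_def ec_group_def on_curve_def using rhs by simp
  also have "\<dots> \<longleftrightarrow> d * (y / (500*d^2))^2 = estar_cubic a s"
    using d by (simp add: field_simps power2_eq_square power3_eq_cube)
  finally show ?thesis by (simp add: s_def)
qed

text \<open>The isomorphism \<open>f\<close> sends a point with parameter \<open>t\<close> to the
  abscissa \<open>- t - 2*a\<close>. So the left side vanishes when \<open>a/X\<close> is the
  abscissa of a point of E*_a above it.\<close>

lemma lam_bru:
  assumes "X \<noteq> 0" "a \<noteq> 0"
  shows "lamN a (a/X) + (t + 2*a) * lamD a (a/X) = a^4 / X^5 * poly (bru_poly a t) X"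
  unfolding lamN_def lamD_def bru_poly_def using assms by (simp add: divide_simps) algebra

text \<open>Up to a square this is the discriminant of the opposite pair: lifting the root
  \<open>-p\<close> to a point of E*_a amounts to ordering that pair.\<close>

lemma estar_cubic_ctr:
  fixes a p :: rat
  assumes "p \<noteq> 0" "1 + p \<noteq> 0"
  shows "estar_cubic a (- a / p) = (a * (1 + p) / p)^2 * ((ctr_sum a p)^2 - 4 * ctr_prod a p)"
  unfolding estar_cubic_def ctr_sum_def ctr_prod_def using assms by (simp add: divide_simps) algebra

text \<open>A preimage is a rational root, which gives the abscissa \<open>- a / p\<close>, together
  with an ordinate \<open>v\<close> on the twist by \<open>d\<close>. The excluded abscissas 0 and
  \<open>a\<close> belong to the kernel; they do not arise from a root since
  \<open>a \<noteq> 0\<close> and \<open>p \<noteq> -1\<close>.\<close>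

lemma phi_img_iff:
  assumes a: "a \<noteq> 0" and d0: "dd a b \<noteq> 0"
  defines "d \<equiv> dd a b"
  assumes P: "Pt x y \<in> carrier (Eab a b)"
  shows "Pt x y \<in> phi_img a b \<longleftrightarrow>
    (\<exists>p v. poly (bru_poly a (x / (-4*d))) (-p) = 0 \<and> d * v^2 = (a * (1 + p) / p)^2 * ((ctr_sum a p)^2 - 4 * ctr_prod a p))"
    (is "?L \<longleftrightarrow> ?R")
proof
  have d: "d \<noteq> 0" using d0 d_def by simp
  assume ?L
  then obtain x' y' where q: "Pt x' y' \<in> carrier (Estar a b)" "lamD a (fstar_x a b x') \<noteq> 0"
      "x = finv_x a b (lamN a (fstar_x a b x') / lamD a (fstar_x a b x'))"
    by (auto simp: phi_img_def)
  define s where "s = fstar_x a b x'"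
  define t where "t = x / (-4*d)"
  have s0: "s \<noteq> 0" "s \<noteq> a" using q(2) by (auto simp: lamD_def s_def)
  have "x = 4*d*(lamN a s / lamD a s + 2*a)" using q(3) by (simp add: finv_x_def s_def d_def)
  then have "t + 2 * a = - (lamN a s / lamD a s)" using d by (simp add: t_def field_simps)
  then have "lamN a s + (t + 2*a) * lamD a s = 0" using q(2) by (simp add: s_def)
  moreover have "s = a / (a / s)" using a s0 by simp
  ultimately have "a^4 / (a/s)^5 * poly (bru_poly a t) (a/s) = 0"
    using lam_bru[of "a/s" a t] a s0 by simp
  then have root: "poly (bru_poly a t) (-(-a/s)) = 0" using a s0 by simp
  note nz = bru_root_nz[OF a root]
  have "d * (y' / (500*d^2))^2 = estar_cubic a s"
    using on_curve_Estar[OF d0] q(1) by (simp add: s_def d_def)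
  also have "\<dots> = estar_cubic a (- a / (- a / s))" using a s0 by simp
  also have "\<dots> = (a * (1 + (-a/s)) / (-a/s))^2 * ((ctr_sum a (-a/s))^2 - 4 * ctr_prod a (-a/s))"
    by (rule estar_cubic_ctr[OF nz])
  finally show ?R using root unfolding t_def by blast
next
  have d: "d \<noteq> 0" using d0 d_def by simp
  assume ?R
  define t where "t = x / (-4*d)"
  from \<open>?R\<close> obtain p v where root: "poly (bru_poly a t) (-p) = 0"
      and v: "d * v^2 = (a * (1 + p) / p)^2 * ((ctr_sum a p)^2 - 4 * ctr_prod a p)" by (auto simp: t_def)
  note nz = bru_root_nz[OF a root]
  define s where "s = - a / p"
  have s: "s = a / (-p)" by (simp add: s_def)
  have "s * p = - a" using nz by (simp add: s_def)
  then have s0: "s \<noteq> 0" "s \<noteq> a" using nz a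
    by (auto simp: add_eq_0_iff) (metis mult_cancel_left mult_minus1_right minus_equation_iff)
  have D0: "lamD a s \<noteq> 0" using s0 by (simp add: lamD_def)
  have "lamN a s + (t + 2*a) * lamD a s = 0" using lam_bru[of "-p" a t] root nz a by (simp add: s)
  then have "lamN a s / lamD a s = - (t + 2*a)" using D0 by (simp add: field_simps)
  then have "finv_x a b (lamN a s / lamD a s) = - 4*d*t" by (simp add: finv_x_def d_def algebra_simps)
  then have fx: "x = finv_x a b (lamN a s / lamD a s)" using d by (simp add: t_def)
  define x' where "x' = 100*d*(s + 2*(a^2 - 5*a + 1)/25)"
  have fs: "fstar_x a b x' = s" using d by (simp add: fstar_x_def x'_def d_def)
  have "d * (500*d^2*v / (500*d^2))^2 = estar_cubic a s"
    using estar_cubic_ctr[OF nz] v d by (simp add: s_def)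
  then have "Pt x' (500*d^2*v) \<in> carrier (Estar a b)"
    using on_curve_Estar[OF d0] fs by (simp add: d_def)
  then show ?L using P D0 fx fs unfolding phi_img_def by blast
qed

definition rats :: "complex set" where "rats = range of_rat"

lemma sf_rats: "sf rats"
  unfolding is_subfield_complex_def rats_def
proof (intro conjI ballI impI)
  show "0 \<in> range (of_rat :: rat \<Rightarrow> complex)" by (rule image_eqI[of _ _ 0]) simp_all
  show "1 \<in> range (of_rat :: rat \<Rightarrow> complex)" by (rule image_eqI[of _ _ 1]) simp_all
next
  fix x y :: complex assume "x \<in> range of_rat" "y \<in> range of_rat"
  then obtain p q where "x = of_rat p" "y = of_rat q" by auto
  then have "x + y = of_rat (p + q)" "x * y = of_rat (p * q)" by (simp_all add: of_rat_add of_rat_mult)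
  then show "x + y \<in> range of_rat" "x * y \<in> range of_rat" by blast+
next
  fix x :: complex assume "x \<in> range of_rat"
  then obtain p where "x = of_rat p" by auto
  then have "- x = of_rat (- p)" "inverse x = of_rat (inverse p)" by (simp_all add: of_rat_minus of_rat_inverse)
  then show "- x \<in> range of_rat" "inverse x \<in> range of_rat" by blast+
qed

lemma tau_indep:
  fixes \<tau> :: "'a::field_char_0"
  assumes t: "\<tau>^2 = 1 - \<tau>" and e: "of_rat p + of_rat q * \<tau> = 0"
  shows "p = 0 \<and> q = 0"
proof (cases "q = 0")
  case True then show ?thesis using e by simp
next
  case False
  have "(of_rat (2 * p / q - 1) :: 'a)^2 = 5"
  proof -
    have "of_rat p = - (of_rat q * \<tau>)" using e by (simp add: eq_neg_iff_add_eq_0)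
    then have "(of_rat (2 * p / q - 1) :: 'a) = - 2 * \<tau> - 1"
      using False by (simp add: of_rat_diff of_rat_divide of_rat_mult)
    then have "(of_rat (2 * p / q - 1) :: 'a)^2 = (- 2 * \<tau> - 1)^2" by simp
    also have "\<dots> = 5" using t by algebra
    finally show ?thesis .
  qed
  then have "of_rat ((2 * p / q - 1)^2) = (of_rat 5 :: 'a)" by (simp add: of_rat_power)
  then have "(2 * p / q - 1)^2 = 5" by (simp only: of_rat_eq_iff)
  then show ?thesis using no_rat_sqrt5 by blast
qed

lemma two_cancel: "(2::'a::field_char_0) * x = 2 * y \<Longrightarrow> x = y"
  by simp

lemma cubic_coeffs:
  fixes x1 x2 x3 A B C :: "'a::field_char_0"
  assumes "\<And>x. x^3 + A * x^2 + B * x + C = (x - x1) * (x - x2) * (x - x3)"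
  shows "x1 + x2 + x3 = - A" "x1 * x2 + x1 * x3 + x2 * x3 = B" "x1 * x2 * x3 = - C"
proof -
  have c: "C = - (x1 * x2 * x3)" "1 + A + B + C = (1 - x1) * (1 - x2) * (1 - x3)"
    "- 1 + A - B + C = (- 1 - x1) * (- 1 - x2) * (- 1 - x3)"
    using assms[of 0] assms[of 1] assms[of "-1"] by simp_all
  show "x1 * x2 * x3 = - C" using c(1) by simp
  have "2 * (x1 + x2 + x3) = 2 * (- A)" using c by algebra
  then show "x1 + x2 + x3 = - A" by (rule two_cancel)
  have "2 * (x1 * x2 + x1 * x3 + x2 * x3) = 2 * B" using c by algebra
  then show "x1 * x2 + x1 * x3 + x2 * x3 = B" by (rule two_cancel)
qed

text \<open>Since \<open>kz\<close> and \<open>kV\<close> are affine in \<open>t\<close> and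
  \<open>y\<close>, a line stays a line and \<open>kummer_product_on_line\<close> applies. Here
  \<open>i\<close> is the inverse of \<open>\<tau> - 2\<close>, and \<open>m\<close> is the value of
  \<open>kV\<close> on the line where \<open>kz\<close> vanishes.\<close>

lemma kg_product_on_line:
  fixes a t1 t2 t3 L M \<tau> s :: "'a::field_char_0"
  assumes t: "\<tau>^2 = 1 - \<tau>" and s: "s^2 = - 3 - \<tau>"
    and cubic: "\<And>t. bru_disc a t - (L * t + M)^2 = - 4 * ((t - t1) * (t - t2) * (t - t3))"
  defines "c \<equiv> (1 - 3*\<tau>) * s" and "i \<equiv> - (3 + \<tau>) / 5"
  defines "m \<equiv> (kgam \<tau> a * kdel \<tau> a + c * (M - L * i * kz \<tau> a 0)) / 2"
  shows "kg \<tau> s a t1 (L * t1 + M) * kg \<tau> s a t2 (L * t2 + M) * kg \<tau> s a t3 (L * t3 + M) = - (m^5)"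
proof -
  define k where "k = (kell \<tau> a + c * L * i) / 2"
  define \<delta> where "\<delta> = kdel \<tau> a"
  have i5: "5 * i = - (3 + \<tau>)" by (simp add: i_def)
  have "5 * (i * (\<tau> - 2)) = 5" using i5 t by algebra
  then have i1: "i * (\<tau> - 2) = 1" by simp
  have tz: "x = i * (kz \<tau> a x - kz \<tau> a 0)" for x
  proof -
    have "kz \<tau> a x - kz \<tau> a 0 = (\<tau> - 2) * x" by (simp add: kz_def)
    then show ?thesis using i1 by (metis mult.assoc mult_1)
  qed
  have V: "kV \<tau> s a x (L * x + M) = k * kz \<tau> a x + m" for x
  proof -
    have "2 * kV \<tau> s a x (L * x + M) = c * (L * x + M) + kell \<tau> a * kz \<tau> a x + kgam \<tau> a * kdel \<tau> a"
      by (simp add: kV_def c_def)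
    moreover have "2 * k = kell \<tau> a + c * L * i" "2 * m = kgam \<tau> a * kdel \<tau> a + c * (M - L * i * kz \<tau> a 0)"
      by (simp_all add: k_def m_def)
    ultimately have "2 * kV \<tau> s a x (L * x + M) = 2 * (k * kz \<tau> a x + m)" using tz[of x] by algebra
    then show ?thesis by (rule two_cancel)
  qed
  have c3: "c^2 = (\<tau> - 2)^3" unfolding c_def using t s by algebra
  define z1 z2 z3 where "z1 = kz \<tau> a t1" and "z2 = kz \<tau> a t2" and "z3 = kz \<tau> a t3"
  have cub: "z^3 + (\<delta> + k^2 - kell \<tau> a * k) * z^2 + (2*k*m - kell \<tau> a * m - kgam \<tau> a * \<delta> * k) * z + (m^2 - kgam \<tau> a * \<delta> * m)
      = (z - z1) * (z - z2) * (z - z3)" for z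
  proof -
    define x where "x = i * (z - kz \<tau> a 0)"
    have zx: "z = kz \<tau> a x"
    proof -
      have "kz \<tau> a x = (\<tau> - 2) * x + kz \<tau> a 0" by (simp add: kz_def)
      also have "\<dots> = (i * (\<tau> - 2)) * (z - kz \<tau> a 0) + kz \<tau> a 0" by (simp add: x_def)
      finally show ?thesis by (simp add: i1)
    qed
    have d: "z - z1 = (\<tau> - 2) * (x - t1)" "z - z2 = (\<tau> - 2) * (x - t2)" "z - z3 = (\<tau> - 2) * (x - t3)"
      unfolding zx z1_def z2_def z3_def kz_def by (simp_all add: algebra_simps)
    define U where "U = kell \<tau> a * z + kgam \<tau> a * \<delta>"
    have cy: "c * (L * x + M) = 2 * (k * z + m) - U"
    proof -
      have "2 * kV \<tau> s a x (L * x + M) = c * (L * x + M) + U"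
        unfolding kV_def c_def U_def zx \<delta>_def by simp
      then show ?thesis unfolding V zx[symmetric] by simp
    qed
    have "- 4 * ((z - z1) * (z - z2) * (z - z3)) = (\<tau> - 2)^3 * (- 4 * ((x - t1) * (x - t2) * (x - t3)))"
      unfolding d by algebra
    also have "\<dots> = c^2 * bru_disc a x - (c * (L * x + M))^2"
      unfolding cubic[symmetric] c3[symmetric] by algebra
    also have "\<dots> = U^2 - 4 * z^3 - 4 * \<delta> * z^2 - (2 * (k * z + m) - U)^2"
      unfolding cy unfolding c_def bru_disc_tate[OF t s] U_def zx[symmetric] \<delta>_def[symmetric] ..
    finally have "4 * ((z - z1) * (z - z2) * (z - z3)) = 4 * (z^3 + \<delta> * z^2 + (k * z + m)^2 - U * (k * z + m))" by algebra
    then have "(z - z1) * (z - z2) * (z - z3) = z^3 + \<delta> * z^2 + (k * z + m)^2 - U * (k * z + m)"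
      by (simp only: mult_cancel_left) simp
    then show ?thesis unfolding U_def by algebra
  qed
  note e = cubic_coeffs[OF cub]
  have g: "kg \<tau> s a x (L * x + M) = (kz \<tau> a x - (kgam \<tau> a)^2) * (k * kz \<tau> a x + m) + kgam \<tau> a * (kz \<tau> a x)^2" for x
    unfolding kg_def V ..
  have dd: "\<delta> = kgam \<tau> a * (kgam \<tau> a - kell \<tau> a)" by (simp add: \<delta>_def kdel_def)
  show ?thesis unfolding g z1_def[symmetric] z2_def[symmetric] z3_def[symmetric]
    by (rule kummer_product_on_line[OF e(1)[unfolded dd] e(2)[unfolded dd] e(3)[unfolded dd]])
qed

section \<open>The Kummer map on rational points\<close>

locale brumer =
  fixes a b :: rat and \<zeta> r :: complex
  assumes a0: "a \<noteq> 0" and d0: "dd a b \<noteq> 0"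
    and z: "1 + \<zeta> + \<zeta>^2 + \<zeta>^3 + \<zeta>^4 = 0" and r2: "r^2 = of_rat (dd a b)"
begin

abbreviation "d \<equiv> dd a b"
abbreviation "ca \<equiv> (of_rat a :: complex)"
abbreviation "\<tau> \<equiv> \<zeta> + \<zeta>^4"
abbreviation "s \<equiv> \<zeta> - \<zeta>^4"

definition K2 :: "complex set" where "K2 = Adj rats r"
definition N :: "complex set" where "N = N5 \<zeta> K2"

lemma ca0: "ca \<noteq> 0" using a0 by simp

lemma r2K: "r^2 \<in> rats" unfolding r2 rats_def by blast

lemma r0: "r \<noteq> 0" using r2 d0 by auto

lemma sf_K2: "sf K2" unfolding K2_def by (rule sf_Adj[OF sf_rats r2K])
lemma r_K2: "r \<in> K2" unfolding K2_def by (rule Adj_gen[OF sf_rats])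
lemma sf_N: "sf N" unfolding N_def by (rule sf_N5[OF z sf_K2])
lemma K2_N: "K2 \<subseteq> N" unfolding N_def by (rule N5_base[OF z sf_K2])
lemma r_N: "r \<in> N" using r_K2 K2_N by blast
lemma zeta_N: "\<zeta> \<in> N" unfolding N_def by (rule N5_zeta[OF z sf_K2])

text \<open>In the coordinates \<open>t = xt x\<close>, \<open>w = yw y\<close> the curve \<open>E\<^sub>a\<^sub>,\<^sub>b\<close> is \<open>d w\<^sup>2 = bru_disc a t\<close>.\<close>

definition xt :: "rat \<Rightarrow> rat" where "xt x = x / (-4 * d)"
definition yw :: "rat \<Rightarrow> rat" where "yw y = y / (4 * d^2)"

text \<open>The function has a pole at O; the value 1 there is the one that suits a homomorphism
  modulo fifth powers.\<close>

fun gP :: "rat ecpt \<Rightarrow> complex" where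
  "gP Inf = 1"
| "gP (Pt x y) = kg \<tau> s ca (of_rat (xt x)) (r * of_rat (yw y))"

lemma t2: "\<tau>^2 = 1 - \<tau>" and s2: "s^2 = - 3 - \<tau>" using cyclotomic_tau[OF z] by auto

lemma curve_disc:
  assumes "Pt x y \<in> carrier (Eab a b)"
  shows "(r * of_rat (yw y))^2 = bru_disc ca (of_rat (xt x))"
proof -
  have "of_rat (d * (yw y)^2) = (of_rat (bru_disc a (xt x)) :: complex)"
    using on_curve_Eab[OF d0, of x y] assms by (simp add: xt_def yw_def)
  then show ?thesis by (simp add: of_rat_bru_disc of_rat_mult of_rat_power power_mult_distrib r2)
qed

text \<open>The zeros of \<open>kz\<close> are T and -T, whose coordinate \<open>t\<close> lies in
  Q(\<tau>). Comparing the coefficients of 1 and \<tau> shows that a rational \<open>t\<close> would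
  force \<open>a^2 - 11*a - 1 = 0\<close>.\<close>

lemma kz_nz: "kz \<tau> ca (of_rat t) \<noteq> 0"
proof
  assume "kz \<tau> ca (of_rat t) = 0"
  then have "of_rat (a^2 - 5*a + 1 - 2*t) + of_rat (t - 3*a - 1) * \<tau> = 0"
    unfolding kz_def of_rat_diff of_rat_add of_rat_mult of_rat_power by (simp add: algebra_simps)
  from tau_indep[OF t2 this] have "a^2 - 5*a + 1 - 2*t = 0" "t = 3*a + 1" by auto
  then have "a^2 - 11*a - 1 = 0" by simp
  then show False using brumer_disc_factor_nz by blast
qed

definition negP :: "rat ecpt \<Rightarrow> rat ecpt" where
  "negP P = (case P of Inf \<Rightarrow> Inf | Pt x y \<Rightarrow> Pt x (- y))"

lemma negP_simps [simp]: "negP Inf = Inf" "negP (Pt x y) = Pt x (- y)" by (simp_all add: negP_def)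

lemma carrier_neg: "P \<in> carrier (Eab a b) \<Longrightarrow> negP P \<in> carrier (Eab a b)"
  by (cases P) (auto simp: Eab_def ec_group_def on_curve_def)

lemma gP_neg:
  assumes "Pt x y \<in> carrier (Eab a b)"
  shows "gP (Pt x y) * gP (Pt x (- y)) = (kz \<tau> ca (of_rat (xt x)))^5"
  using kg_uminus[OF t2 s2 curve_disc[OF assms]] by (simp add: yw_def of_rat_minus)

lemma gP_nz: "P \<in> carrier (Eab a b) \<Longrightarrow> gP P \<noteq> 0"
proof (cases P)
  case (Pt x y)
  assume "P \<in> carrier (Eab a b)"
  then show ?thesis using gP_neg[of x y] kz_nz[of "xt x"] Pt by auto
qed simp

lemma consts_N: "ca \<in> N" "\<tau> \<in> N" "s \<in> N" "of_rat q \<in> N" "\<zeta>^n \<in> N"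
  by (intro sfD[OF sf_N] zeta_N)+

lemma kcoeffs_N: "kgam \<tau> ca \<in> N" "kell \<tau> ca \<in> N" "kdel \<tau> ca \<in> N" "kz \<tau> ca (of_rat t) \<in> N"
proof -
  show g: "kgam \<tau> ca \<in> N" and e: "kell \<tau> ca \<in> N" and "kz \<tau> ca (of_rat t) \<in> N"
    unfolding kgam_def kell_def kz_def by (intro sfD[OF sf_N] zeta_N)+
  show "kdel \<tau> ca \<in> N" unfolding kdel_def by (intro sfD[OF sf_N] g e)
qed

lemma gP_N: "gP P \<in> N"
proof (cases P)
  case (Pt x y)
  show ?thesis unfolding Pt gP.simps kg_def kV_def by (intro sfD[OF sf_N] zeta_N kcoeffs_N r_N)
qed (simp add: sf_1 sf_N)

definition same_class :: "complex \<Rightarrow> complex \<Rightarrow> bool" where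
  "same_class x y \<longleftrightarrow> (\<exists>c\<in>N. c \<noteq> 0 \<and> x = c^5 * y)"

text \<open>Untwisting by \<open>d\<close> multiplies slope and intercept by \<open>r\<close>, so
  the line is defined over \<open>N\<close>. The sign is harmless because -1 is a fifth
  power.\<close>

lemma gP_product_on_line:
  fixes x1 y1 x2 y2 x3 y3 l m :: rat
  assumes line: "y1 = l * x1 + m" "y2 = l * x2 + m" "y3 = l * x3 + m"
    and cubic: "\<And>x. x^3 + EA2 a b * x^2 + EA4 a b * x + EA6 a b - (l * x + m)^2 = (x - x1) * (x - x2) * (x - x3)"
  shows "\<exists>\<mu>\<in>N. gP (Pt x1 y1) * gP (Pt x2 y2) * gP (Pt x3 y3) = - (\<mu>^5)"
proof -
  define A B C where "A = EA2 a b" and "B = EA4 a b" and "C = EA6 a b"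
  have "x^3 + (A - l^2) * x^2 + (B - 2*l*m) * x + (C - m^2) = (x - x1) * (x - x2) * (x - x3)" for x
    unfolding cubic[symmetric] A_def B_def C_def by algebra
  note e = cubic_coeffs[OF this]
  have e1: "x1 + x2 + x3 = l^2 - A" and e2: "x1 * x2 + x1 * x3 + x2 * x3 = B - 2 * l * m"
    and e3: "x1 * x2 * x3 = m^2 - C" using e by simp_all
  have t: "xt x1 + xt x2 + xt x3 = - (l^2 - A) / (4*d)"
    "xt x1 * xt x2 + xt x1 * xt x3 + xt x2 * xt x3 = (B - 2*l*m) / (16 * d^2)"
    "xt x1 * xt x2 * xt x3 = - (m^2 - C) / (64 * d^3)"
    unfolding e1[symmetric] e2[symmetric] e3[symmetric] xt_def using d0
    by (simp_all add: field_simps power2_eq_square power3_eq_cube)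
  define q0 where "q0 = a^2 - 30*a + 1"
  define q1 where "q1 = 2*a*(3*a+1)*(4*a-7)"
  define q2 where "q2 = a*(4*a^4 - 4*a^3 - 40*a^2 + 91*a - 4)"
  have ABC: "A = d * q0" "B = - 4 * d^2 * q1" "C = - 16 * d^3 * q2"
    by (simp_all add: A_def B_def C_def EA2_def EA4_def EA6_def q0_def q1_def q2_def algebra_simps)
  define L where "L = - l / d"
  define M where "M = m / (4 * d^2)"
  have w: "yw (l * x + m) = L * xt x + M" for x
    using d0 by (simp add: yw_def xt_def L_def M_def field_simps power2_eq_square)
  have T1: "xt x1 + xt x2 + xt x3 = (q0 - d * L^2) / 4"
    unfolding t ABC L_def using d0 by (simp add: field_simps power2_eq_square)
  have T2: "xt x1 * xt x2 + xt x1 * xt x3 + xt x2 * xt x3 = (2 * d * L * M - q1) / 4"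
    unfolding t ABC L_def M_def using d0 by (simp add: field_simps power2_eq_square)
  have T3: "xt x1 * xt x2 * xt x3 = - (q2 + d * M^2) / 4"
    unfolding t ABC L_def M_def using d0 by (simp add: field_simps power2_eq_square power3_eq_cube)
  define t1 t2 t3 where "t1 = (of_rat (xt x1) :: complex)" and "t2 = (of_rat (xt x2) :: complex)" and "t3 = (of_rat (xt x3) :: complex)"
  define Lc Mc where "Lc = r * of_rat L" and "Mc = r * of_rat M"
  have o: "4 * (t1 + t2 + t3) = of_rat q0 - Lc^2" "4 * (t1 * t2 + t1 * t3 + t2 * t3) = 2 * Lc * Mc - of_rat q1"
    "4 * (t1 * t2 * t3) = - (of_rat q2 + Mc^2)"
  proof -
    have "4 * (xt x1 + xt x2 + xt x3) = q0 - d * L^2"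
      "4 * (xt x1 * xt x2 + xt x1 * xt x3 + xt x2 * xt x3) = 2 * d * L * M - q1"
      "4 * (xt x1 * xt x2 * xt x3) = - (q2 + d * M^2)" unfolding T1 T2 T3 by simp_all
    from this[THEN arg_cong[where f = "of_rat :: rat \<Rightarrow> complex"]]
    have "4 * (t1 + t2 + t3) = of_rat q0 - of_rat d * (of_rat L)^2"
      "4 * (t1 * t2 + t1 * t3 + t2 * t3) = 2 * of_rat d * of_rat L * of_rat M - of_rat q1"
      "4 * (t1 * t2 * t3) = - (of_rat q2 + of_rat d * (of_rat M)^2)"
      unfolding t1_def t2_def t3_def by (simp_all add: of_rat_add of_rat_diff of_rat_mult of_rat_power of_rat_minus)
    then show "4 * (t1 + t2 + t3) = of_rat q0 - Lc^2" "4 * (t1 * t2 + t1 * t3 + t2 * t3) = 2 * Lc * Mc - of_rat q1"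
      "4 * (t1 * t2 * t3) = - (of_rat q2 + Mc^2)"
      unfolding Lc_def Mc_def r2[symmetric] by algebra+
  qed
  have disc: "bru_disc ca x = - 4 * x^3 + of_rat q0 * x^2 + of_rat q1 * x - of_rat q2" for x
    by (simp add: bru_disc_def q0_def q1_def q2_def of_rat_add of_rat_diff of_rat_mult of_rat_power)
  have cub: "bru_disc ca x - (Lc * x + Mc)^2 = - 4 * ((x - t1) * (x - t2) * (x - t3))" for x
    unfolding disc using o by algebra
  have y: "r * of_rat (yw (l * x + m)) = Lc * of_rat (xt x) + Mc" for x
    unfolding w by (simp add: Lc_def Mc_def of_rat_add of_rat_mult algebra_simps)
  have "gP (Pt x1 y1) * gP (Pt x2 y2) * gP (Pt x3 y3)
     = kg \<tau> s ca t1 (Lc * t1 + Mc) * kg \<tau> s ca t2 (Lc * t2 + Mc) * kg \<tau> s ca t3 (Lc * t3 + Mc)"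
    unfolding line gP.simps y t1_def t2_def t3_def ..
  also note kg_product_on_line[OF t2 s2 cub]
  finally have e: "gP (Pt x1 y1) * gP (Pt x2 y2) * gP (Pt x3 y3) = - (((kgam \<tau> ca * kdel \<tau> ca
      + (1 - 3*\<tau>) * s * (Mc - Lc * (- (3 + \<tau>) / 5) * kz \<tau> ca 0)) / 2)^5)" .
  have "Lc \<in> N" "Mc \<in> N" unfolding Lc_def Mc_def by (intro sfD[OF sf_N] r_N)+
  then have "(kgam \<tau> ca * kdel \<tau> ca + (1 - 3*\<tau>) * s * (Mc - Lc * (- (3 + \<tau>) / 5) * kz \<tau> ca 0)) / 2 \<in> N"
    using kcoeffs_N(4)[of 0] by (intro sfD[OF sf_N] kcoeffs_N zeta_N) simp_all
  with e show ?thesis by blast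
qed

end

section \<open>The chord-tangent law\<close>

lemma chord_cubic:
  fixes A B C x1 y1 x2 y2 :: "'a::field_char_0"
  assumes c1: "y1^2 = x1^3 + A*x1^2 + B*x1 + C" and c2: "y2^2 = x2^3 + A*x2^2 + B*x2 + C"
    and ne: "\<not> (x1 = x2 \<and> y1 = - y2)"
  defines "l \<equiv> if x1 \<noteq> x2 then (y2 - y1) / (x2 - x1) else (3*x1^2 + 2*A*x1 + B) / (2*y1)"
  defines "x3 \<equiv> l^2 - A - x1 - x2" and "m \<equiv> y1 - l * x1"
  shows "y2 = l * x2 + m" and "x^3 + A*x^2 + B*x + C - (l*x+m)^2 = (x - x1)*(x - x2)*(x - x3)"
proof -
  have y1: "y1 = l * x1 + m" by (simp add: m_def)
  have "y2 = l * x2 + m \<and> x^3 + A*x^2 + B*x + C - (l*x+m)^2 = (x - x1)*(x - x2)*(x - x3)"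
  proof (cases "x1 = x2")
    case False
    then have "l * (x2 - x1) = y2 - y1" by (simp add: l_def)
    then have y2: "y2 = l * x2 + m" by (simp add: m_def algebra_simps)
    have "(x2 - x1) * (x^3 + A*x^2 + B*x + C - (l*x+m)^2) = (x2 - x1) * ((x - x1)*(x - x2)*(x - x3))"
      using c1 c2 unfolding y1 y2 x3_def by algebra
    then show ?thesis using False y2 by simp
  next
    case True
    have "y2^2 = y1^2" using c1 c2 True by simp
    then have y2: "y2 = y1" using ne True by (auto simp: power2_eq_iff)
    then have "y1 \<noteq> 0" using ne True by auto
    then have l: "l * (2*y1) = 3*x1^2 + 2*A*x1 + B" using True by (simp add: l_def)
    have "x^3 + A*x^2 + B*x + C - (l*x+m)^2 = (x - x1)*(x - x1)*(x - x3)"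
      using c1 l True unfolding y1 x3_def by algebra
    then show ?thesis using True y2 y1 by simp
  qed
  then show "y2 = l * x2 + m" "x^3 + A*x^2 + B*x + C - (l*x+m)^2 = (x - x1)*(x - x2)*(x - x3)" by auto
qed

lemma ec_add_line:
  fixes A B C x1 y1 x2 y2 :: "'a::field_char_0"
  assumes c1: "on_curve A B C (Pt x1 y1)" and c2: "on_curve A B C (Pt x2 y2)"
    and ne: "\<not> (x1 = x2 \<and> y1 = - y2)"
  obtains l m x3 where "ec_add A B (Pt x1 y1) (Pt x2 y2) = Pt x3 (- (l * x3 + m))"
    "y1 = l * x1 + m" "y2 = l * x2 + m"
    "\<And>x. x^3 + A*x^2 + B*x + C - (l*x+m)^2 = (x - x1)*(x - x2)*(x - x3)"
proof -
  define l where "l = (if x1 \<noteq> x2 then (y2 - y1) / (x2 - x1) else (3*x1^2 + 2*A*x1 + B) / (2*y1))"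
  define x3 where "x3 = l^2 - A - x1 - x2"
  define m where "m = y1 - l * x1"
  have c1': "y1^2 = x1^3 + A*x1^2 + B*x1 + C" and c2': "y2^2 = x2^3 + A*x2^2 + B*x2 + C"
    using c1 c2 by (simp_all add: on_curve_def)
  note ch = chord_cubic[OF c1' c2' ne, folded l_def, folded x3_def m_def]
  have "ec_add A B (Pt x1 y1) (Pt x2 y2) = Pt x3 (- (y1 + l * (x3 - x1)))"
    unfolding ec_add_def ecpt.case Let_def l_def[symmetric] x3_def[symmetric] using ne by simp
  also have "y1 + l * (x3 - x1) = l * x3 + m" by (simp add: m_def algebra_simps)
  finally have "ec_add A B (Pt x1 y1) (Pt x2 y2) = Pt x3 (- (l * x3 + m))" .
  moreover have "y1 = l * x1 + m" by (simp add: m_def)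
  ultimately show ?thesis by (rule that[OF _ _ ch])
qed

lemma ec_add_closed:
  fixes A B C :: "'a::field_char_0"
  assumes "on_curve A B C P" "on_curve A B C Q"
  shows "on_curve A B C (ec_add A B P Q)"
proof (cases P)
  case Inf then show ?thesis using assms by (simp add: ec_add_def)
next
  case P: (Pt x1 y1)
  show ?thesis
  proof (cases Q)
    case Inf then show ?thesis using assms P by (simp add: ec_add_def)
  next
    case Q: (Pt x2 y2)
    show ?thesis
    proof (cases "x1 = x2 \<and> y1 = - y2")
      case True then show ?thesis using P Q by (simp add: ec_add_def on_curve_def)
    next
      case False
      obtain l m x3 where e: "ec_add A B (Pt x1 y1) (Pt x2 y2) = Pt x3 (- (l * x3 + m))"
        "\<And>x. x^3 + A*x^2 + B*x + C - (l*x+m)^2 = (x - x1)*(x - x2)*(x - x3)"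
        using ec_add_line[OF assms[unfolded P Q] False] by metis
      show ?thesis unfolding P Q e(1) on_curve_def ecpt.case power2_minus using e(2)[of x3] by simp
    qed
  qed
qed

lemma nonsingular_rat:
  assumes "nonsingular A B C" "x^3 + A*x^2 + B*x + C = 0" "3*x^2 + 2*A*x + B = 0"
  shows False
proof -
  have "of_rat (x^3 + A*x^2 + B*x + C) = (0 :: complex)" "of_rat (3*x^2 + 2*A*x + B) = (0 :: complex)"
    using assms by simp_all
  then have "(0::complex)^2 = of_rat x^3 + of_rat A * of_rat x^2 + of_rat B * of_rat x + of_rat C
     \<and> 3 * of_rat x^2 + 2 * of_rat A * of_rat x + of_rat B = (0::complex) \<and> 2 * 0 = (0::complex)"
    by (simp add: of_rat_add of_rat_mult of_rat_power)
  then show False using assms(1) unfolding nonsingular_def by blast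
qed

lemma ec_add_chord:
  assumes "x1 \<noteq> x2" "(y2 - y1) / (x2 - x1) = l"
  shows "ec_add A B (Pt x1 y1) (Pt x2 y2) = Pt (l^2 - A - x1 - x2) (- (y1 + l * (l^2 - A - x1 - x2 - x1)))"
  unfolding ec_add_def ecpt.case Let_def using assms by (simp only: if_True if_False simp_thms)

lemma ec_add_tangent:
  assumes "y \<noteq> - y" "(3*x^2 + 2*A*x + B) / (2*y) = l"
  shows "ec_add A B (Pt x y) (Pt x y) = Pt (l^2 - A - x - x) (- (y + l * (l^2 - A - x - x - x)))"
  unfolding ec_add_def ecpt.case Let_def using assms by (simp only: if_True if_False simp_thms)

text \<open>The line used for P - Q passes through P and -Q. Its mirror image passes through P - Q,
  Q and -P, so it computes the second sum and returns P. The delicate case is P - Q = Q, where the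
  mirrored line has to be the tangent at Q.\<close>

lemma ec_add_neg_cancel:
  assumes ns: "nonsingular A B C" and P: "on_curve A B C P" and Q: "on_curve A B C (Pt x2 y2)"
  shows "ec_add A B (ec_add A B P (Pt x2 (- y2))) (Pt x2 y2) = P"
proof (cases P)
  case Inf then show ?thesis by (simp add: ec_add_def)
next
  case Pt: (Pt x1 y1)
  have Q': "on_curve A B C (Pt x2 (- y2))" using Q by (simp add: on_curve_def)
  show ?thesis
  proof (cases "x1 = x2 \<and> y1 = - (- y2)")
    case True then show ?thesis using Pt by (simp add: ec_add_def)
  next
    case False
    obtain l m x3 where e: "ec_add A B (Pt x1 y1) (Pt x2 (- y2)) = Pt x3 (- (l * x3 + m))"
        "y1 = l * x1 + m" "- y2 = l * x2 + m"
        "\<And>x. x^3 + A*x^2 + B*x + C - (l*x+m)^2 = (x - x1)*(x - x2)*(x - x3)"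
      using ec_add_line[OF P[unfolded Pt] Q' False] by metis
    have "x^3 + (A - l^2)*x^2 + (B - 2*l*m)*x + (C - m^2) = (x - x1)*(x - x2)*(x - x3)" for x
      unfolding e(4)[symmetric] by algebra
    note co = cubic_coeffs[OF this]
    have x1: "x1 = (- l)^2 - A - x3 - x2" using co(1) by simp
    define y3 where "y3 = - (l * x3 + m)"
    have y1: "y1 = - (y3 + - l * (x1 - x3))" using e(2) by (simp add: y3_def algebra_simps)
    \<comment> \<open>When \<open>x3 = x2\<close> this abscissa is a double root of the cubic minus
      the square of the line, so the derivative vanishes there.\<close>
    have der: "3*x2^2 + 2*A*x2 + B = 2 * l * (l * x2 + m)" if "x3 = x2"
      using co that by algebra
    show ?thesis
    proof (cases "x3 = x2")
      case x3: False
      have "(y2 - y3) / (x2 - x3) = - l" using e(3) x3 by (simp add: y3_def field_simps)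
      from ec_add_chord[OF x3 this] show ?thesis unfolding Pt e(1) y3_def[symmetric]
        using x1 y1 by simp
    next
      case x3: True
      have y23: "y3 = y2" using e(3) x3 by (simp add: y3_def)
      \<comment> \<open>A vanishing ordinate would make \<open>x2\<close> a multiple root of the
        cubic, against nonsingularity.\<close>
      have "y2 \<noteq> 0"
      proof
        assume "y2 = 0"
        then have "l * x2 + m = 0" using e(3) by simp
        then have "3*x2^2 + 2*A*x2 + B = 0" using der[OF x3] by simp
        moreover have "x2^3 + A*x2^2 + B*x2 + C = 0" using Q \<open>y2 = 0\<close> by (simp add: on_curve_def)
        ultimately show False using nonsingular_rat[OF ns] by blast
      qed
      moreover have "3*x2^2 + 2*A*x2 + B = (- l) * (2 * y2)" using der[OF x3] e(3)[symmetric] by simp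
      ultimately have sl: "(3*x2^2 + 2*A*x2 + B) / (2 * y2) = - l" by simp
      have "y2 \<noteq> - y2" using \<open>y2 \<noteq> 0\<close> by simp
      from ec_add_tangent[OF this sl] show ?thesis unfolding Pt e(1) unfolding y3_def[symmetric] unfolding x3 y23
        using x1 y1 unfolding x3 y23 by simp
    qed
  qed
qed

context brumer
begin

abbreviation "E \<equiv> Eab a b"

lemma E_mult: "P \<otimes>\<^bsub>E\<^esub> Q = ec_add (EA2 a b) (EA4 a b) P Q" by (simp add: Eab_def ec_group_def)

lemma E_carrier: "P \<in> carrier E \<longleftrightarrow> on_curve (EA2 a b) (EA4 a b) (EA6 a b) P"
  by (simp add: Eab_def ec_group_def)

lemma E_closed: "P \<in> carrier E \<Longrightarrow> Q \<in> carrier E \<Longrightarrow> P \<otimes>\<^bsub>E\<^esub> Q \<in> carrier E"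
  unfolding E_carrier E_mult by (rule ec_add_closed)

lemma E_Inf: "Inf \<in> carrier E" "Inf \<otimes>\<^bsub>E\<^esub> P = P" "P \<otimes>\<^bsub>E\<^esub> Inf = P"
  unfolding E_carrier E_mult by (auto simp: on_curve_def ec_add_def split: ecpt.splits)

lemma same_refl: "same_class x x"
  unfolding same_class_def by (rule bexI[of _ 1]) (auto intro: sf_1 sf_N)

lemma same_sym: "same_class x y \<Longrightarrow> same_class y x"
proof -
  assume "same_class x y"
  then obtain c where "c \<in> N" "c \<noteq> 0" "x = c^5 * y" by (auto simp: same_class_def)
  then have "y = (inverse c)^5 * x" "inverse c \<in> N" "inverse c \<noteq> 0"
    by (auto simp: power_inverse sf_inverse sf_N)
  then show ?thesis unfolding same_class_def by blast
qed

lemma same_mult: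
  assumes "same_class x y" "same_class x' y'"
  shows "same_class (x * x') (y * y')"
proof -
  obtain c c' where "c \<in> N" "c \<noteq> 0" "x = c^5 * y" "c' \<in> N" "c' \<noteq> 0" "x' = c'^5 * y'"
    using assms by (auto simp: same_class_def)
  then have "x * x' = (c * c')^5 * (y * y')" "c * c' \<in> N" "c * c' \<noteq> 0"
    by (auto simp: power_mult_distrib sf_mult sf_N)
  then show ?thesis unfolding same_class_def by blast
qed

lemma same_trans: "same_class x y \<Longrightarrow> same_class y z \<Longrightarrow> same_class x z"
proof -
  assume "same_class x y" "same_class y z"
  then obtain c c' where "c \<in> N" "c \<noteq> 0" "x = c^5 * y" "c' \<in> N" "c' \<noteq> 0" "y = c'^5 * z"
    by (auto simp: same_class_def)
  then have "x = (c * c')^5 * z" "c * c' \<in> N" "c * c' \<noteq> 0"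
    by (auto simp: power_mult_distrib sf_mult sf_N)
  then show ?thesis unfolding same_class_def by blast
qed

lemma same_power: "same_class x y \<Longrightarrow> same_class (x^n) (y^n)"
  by (induction n) (auto intro: same_refl same_mult)

lemma same_fifth: "c \<in> N \<Longrightarrow> c \<noteq> 0 \<Longrightarrow> same_class (c^5) 1"
  unfolding same_class_def by auto

lemma gP_neg_same:
  assumes "P \<in> carrier E"
  shows "same_class (gP P * gP (negP P)) 1"
proof (cases P)
  case (Pt x y)
  then show ?thesis using gP_neg[of x y] assms same_fifth[OF kcoeffs_N(4) kz_nz[of "xt x"]] by simp
qed (simp add: same_refl)

text \<open>The two points and the inverse of their sum lie on a line, so their three values
  multiply to a fifth power; the value at the inverse is then moved to the other side.\<close>

lemma gP_hom:
  assumes "P \<in> carrier E" "Q \<in> carrier E"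
  shows "same_class (gP (P \<otimes>\<^bsub>E\<^esub> Q)) (gP P * gP Q)"
proof (cases P)
  case Inf then show ?thesis by (simp add: E_Inf same_refl)
next
  case P: (Pt x1 y1)
  show ?thesis
  proof (cases Q)
    case Inf then show ?thesis by (simp add: E_Inf same_refl)
  next
    case Q: (Pt x2 y2)
    show ?thesis
    proof (cases "x1 = x2 \<and> y1 = - y2")
      case True
      then have "P \<otimes>\<^bsub>E\<^esub> Q = Inf" "Q = negP P" using P Q by (auto simp: E_mult ec_add_def)
      then show ?thesis using same_sym[OF gP_neg_same[OF assms(1)]] by simp
    next
      case False
      obtain l m x3 where e: "P \<otimes>\<^bsub>E\<^esub> Q = Pt x3 (- (l * x3 + m))" "y1 = l * x1 + m" "y2 = l * x2 + m"
        "\<And>x. x^3 + EA2 a b*x^2 + EA4 a b*x + EA6 a b - (l*x+m)^2 = (x - x1)*(x - x2)*(x - x3)"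
        using ec_add_line[OF assms[unfolded P Q E_carrier] False] unfolding E_mult P Q by metis
      define y3 where "y3 = l * x3 + m"
      obtain \<mu> where mu: "\<mu> \<in> N" "gP P * gP Q * gP (Pt x3 y3) = - (\<mu>^5)"
        using gP_product_on_line[OF e(2,3) y3_def e(4)] P Q by blast
      have R: "Pt x3 (- y3) \<in> carrier E" using E_closed[OF assms] e(1) by (simp add: y3_def)
      then have R': "Pt x3 y3 \<in> carrier E" using carrier_neg by fastforce
      note nz = gP_nz[OF assms(1)] gP_nz[OF assms(2)] gP_nz[OF R'] gP_nz[OF R]
      have m0: "- \<mu> \<noteq> 0" using mu nz by auto
      have "same_class ((- \<mu>)^5) 1" using mu m0 by (intro same_fifth sf_uminus sf_N)
      then have "same_class (gP P * gP Q * gP (Pt x3 y3)) 1" using mu by simp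
      then have "same_class ((gP P * gP Q * gP (Pt x3 y3)) * gP (Pt x3 (- y3))) (1 * gP (Pt x3 (- y3)))"
        by (rule same_mult[OF _ same_refl])
      moreover have "same_class ((gP P * gP Q) * (gP (Pt x3 y3) * gP (Pt x3 (- y3)))) ((gP P * gP Q) * 1)"
        using gP_neg_same[OF R'] by (intro same_mult same_refl) simp
      ultimately have "same_class (gP (Pt x3 (- y3))) (gP P * gP Q)"
        unfolding mult.assoc mult_1_left mult_1_right by (rule same_trans[OF same_sym])
      then show ?thesis unfolding e(1) y3_def by simp
    qed
  qed
qed

end

section \<open>The image of the isogeny and reducibility\<close>

lemma of_rat_poly_bru: "poly (bru_poly (of_rat a) (of_rat t)) (of_rat x :: 'a::field_char_0) = of_rat (poly (bru_poly a t) x)"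
  by (simp add: bru_poly_def of_rat_add of_rat_diff of_rat_mult of_rat_power of_rat_minus)

lemma of_rat_ctr_sum: "(of_rat (ctr_sum a p) :: 'a::field_char_0) = ctr_sum (of_rat a) (of_rat p)"
  by (simp add: ctr_sum_def of_rat_add of_rat_diff of_rat_divide)

lemma of_rat_ctr_prod: "(of_rat (ctr_prod a p) :: 'a::field_char_0) = ctr_prod (of_rat a) (of_rat p)"
  by (simp add: ctr_prod_def of_rat_add of_rat_mult of_rat_divide)

lemma lyness_y0_shift:
  assumes ly: "lyness u" and "ly_y u = 0"
  shows "\<exists>k. u (2 + k) = u (3 + k)"
proof -
  have "u 0 = u 1 \<or> u 1 = u 2 \<or> u 2 = u 3 \<or> u 3 = u 4 \<or> u 4 = u 0"
    using assms(2) unfolding ly_y_def by auto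
  moreover have "u 5 = u 0" "u 6 = u 1" "u 7 = u 2"
    using lyness_period[OF ly, of 0] lyness_period[OF ly, of 1] lyness_period[OF ly, of 2] by simp_all
  ultimately show ?thesis
    by (elim disjE) (rule exI[of _ 3], simp, rule exI[of _ 4], simp, rule exI[of _ 0], simp, rule exI[of _ 1], simp, rule exI[of _ 2], simp)
qed

context brumer
begin

lemma cycle_of_point:
  assumes P: "Pt x y \<in> carrier E"
  obtains u where "lyness u" "ly_a u = ca" "ly_t u = of_rat (xt x)" "ly_y u = r * of_rat (yw y)"
    "gP (Pt x y) = (ly_h \<zeta> u)^5" "ly_h \<zeta> u \<noteq> 0"
proof -
  have "\<not> constant (poly (bru_poly ca (of_rat (xt x))))" by (simp add: constant_degree)
  then obtain X where X: "poly (bru_poly ca (of_rat (xt x))) X = 0" using fundamental_theorem_of_algebra by blast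
  obtain u where u: "lyness u" "ly_a u = ca" "ly_t u = of_rat (xt x)" "ly_y u = r * of_rat (yw y)"
    using lyness_exists[OF ca0 X curve_disc[OF P]] by metis
  have g: "gP (Pt x y) = (ly_h \<zeta> u)^5" using ly_h_power5[OF u(1) z] u by simp
  moreover have "ly_h \<zeta> u \<noteq> 0" using g gP_nz[OF P] by auto
  ultimately show ?thesis using that u by blast
qed

lemma phi_iff:
  assumes P: "Pt x y \<in> carrier E"
  shows "Pt x y \<in> phi_img a b \<longleftrightarrow> (\<exists>p v. poly (bru_poly a (xt x)) (-p) = 0
      \<and> d * v^2 = (a * (1 + p) / p)^2 * ((ctr_sum a p)^2 - 4 * ctr_prod a p))"
  using phi_img_iff[OF a0 d0 P] by (simp add: xt_def)

text \<open>A point of order 2 lies in the image of an isogeny of odd degree. Concretely, its cycle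
  is symmetric, the centre is rational by \<open>double_root_centre\<close> and yields a rational
  root, and the opposite pair coincides, so that \<open>0\<close> is a rational ordinate above
  it.\<close>

lemma yw0_imp_phi:
  assumes P: "Pt x y \<in> carrier E" and w0: "yw y = 0"
  shows "Pt x y \<in> phi_img a b"
proof -
  obtain u where u: "lyness u" "ly_a u = ca" "ly_t u = of_rat (xt x)" "ly_y u = r * of_rat (yw y)"
    using cycle_of_point[OF P] by metis
  then obtain k where k: "u (2 + k) = u (3 + k)" using lyness_y0_shift[OF u(1)] w0 by auto
  define v where "v = (\<lambda>j. u (j + k))"
  have v: "lyness v" "ly_a v = ca" "ly_t v = of_rat (xt x)"
    using lyness_shift[OF u(1)] ly_shift[OF u(1)] u by (auto simp: v_def)
  have v23: "v 2 = v 3" using k by (simp add: v_def)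
  let ?A = "a^2 - 11*a - 1" and ?t = "xt x"
  define q where "q = ((16-12*a)*?t^2 + (31*a - 74*a^2 - a^3)*?t + (a^5 + 21*a^4 + 20*a^3 - 234*a^2 + 41*a - 1)) / ?A^2"
  have A0: "?A \<noteq> 0" by (rule brumer_disc_factor_nz)
  have "v 0 * of_rat (?A^2) = of_rat ((16-12*a)*?t^2 + (31*a - 74*a^2 - a^3)*?t + (a^5 + 21*a^4 + 20*a^3 - 234*a^2 + 41*a - 1))"
    using double_root_centre[OF v(1) v23] unfolding v
    by (simp add: of_rat_add of_rat_diff of_rat_mult of_rat_power)
  then have v0: "v 0 = of_rat q" using A0 unfolding q_def of_rat_divide by (simp add: nonzero_eq_divide_eq)
  have "poly (bru_poly ca (of_rat ?t)) (- v 0) = 0" using poly_bru_poly_lyness[OF v(1)] unfolding v by simp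
  then have "poly (bru_poly ca (of_rat ?t)) (of_rat (- q)) = 0" using v0 by (simp add: of_rat_minus)
  then have rq: "poly (bru_poly a ?t) (- q) = 0" unfolding of_rat_poly_bru by simp
  note c = lyness_centre[OF v(1)]
  have "of_rat ((ctr_sum a q)^2 - 4 * ctr_prod a q) = (v 2 + v 3)^2 - 4 * (v 2 * v 3)"
    using c(2,3) v v0 by (simp add: of_rat_diff of_rat_mult of_rat_power of_rat_ctr_sum of_rat_ctr_prod)
  also have "\<dots> = 0" unfolding v23 by algebra
  finally have "(ctr_sum a q)^2 - 4 * ctr_prod a q = 0" by simp
  then have "d * 0^2 = (a * (1 + q) / q)^2 * ((ctr_sum a q)^2 - 4 * ctr_prod a q)" by simp
  then show ?thesis unfolding phi_iff[OF P] using rq by blast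
qed

text \<open>At a rational root, \<open>bru_disc_ctr\<close> shows that the discriminant of the
  opposite pair is \<open>d\<close> times a square, so the ordinate of the lifted point is rational
  too.\<close>

lemma rat_root_imp_phi:
  assumes P: "Pt x y \<in> carrier E" and root: "poly (bru_poly a (xt x)) (- p) = 0"
  shows "Pt x y \<in> phi_img a b"
proof -
  have cu: "d * (yw y)^2 = bru_disc a (xt x)" using on_curve_Eab[OF d0, of x y] P by (simp add: xt_def yw_def)
  show ?thesis
  proof (cases "yw y = 0")
    case False
    note nz = bru_root_nz[OF a0 root]
    have e: "d * (yw y)^2 = ((ctr_sum a p)^2 - 4 * ctr_prod a p) * (ctr_fac a p)^2"
      using bru_disc_ctr[OF nz root] cu by simp
    then have K: "ctr_fac a p \<noteq> 0" using False d0 by auto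
    then have "(ctr_sum a p)^2 - 4 * ctr_prod a p = d * (yw y)^2 / (ctr_fac a p)^2" using e by simp
    then have "d * (a * (1 + p) / p * (yw y / ctr_fac a p))^2 = (a * (1 + p) / p)^2 * ((ctr_sum a p)^2 - 4 * ctr_prod a p)"
      by (simp add: power_mult_distrib power_divide)
    then show ?thesis unfolding phi_iff[OF P] using root by blast
  qed (rule yw0_imp_phi[OF P])
qed

lemma not_irr_imp_phi:
  assumes P: "Pt x y \<in> carrier E" and ni: "\<not> irr_over rats (bru_poly ca (of_rat (xt x)))"
  shows "Pt x y \<in> phi_img a b"
proof -
  obtain u where u: "lyness u" "ly_a u = ca" "ly_t u = of_rat (xt x)"
    using cycle_of_point[OF P] by metis
  have "\<exists>j. u j \<in> rats"
    using not_irr_root_in_field[OF sf_rats u(1)] ni unfolding u by (simp add: rats_def)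
  then obtain j p where j: "u j = of_rat p" by (auto simp: rats_def)
  have "poly (bru_poly ca (of_rat (xt x))) (- u j) = 0" using bru_poly_root_iff[OF u(1)] u by auto
  then have "poly (bru_poly ca (of_rat (xt x))) (of_rat (- p)) = 0" by (simp add: j of_rat_minus)
  then have "poly (bru_poly a (xt x)) (- p) = 0" unfolding of_rat_poly_bru by simp
  then show ?thesis by (rule rat_root_imp_phi[OF P])
qed

text \<open>A rational preimage orders the opposite pair over \<open>K2\<close>. Then the whole
  cycle lies in \<open>K2\<close> and \<open>h\<close> in \<open>N\<close>, and \<open>gP\<close> is
  the fifth power of \<open>h\<close>. Both signs of \<open>q\<close> are treated because only the
  square of the ordinate is determined.\<close>

lemma phi_imp_same:
  assumes P: "Pt x y \<in> carrier E" and phi: "Pt x y \<in> phi_img a b"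
  shows "same_class (gP (Pt x y)) 1"
proof -
  obtain p v where root: "poly (bru_poly a (xt x)) (-p) = 0"
    and v: "d * v^2 = (a * (1 + p) / p)^2 * ((ctr_sum a p)^2 - 4 * ctr_prod a p)"
    using phi_img_iff[OF a0 d0 P] phi by (auto simp: xt_def)
  note nz = bru_root_nz[OF a0 root]
  define e where "e = a * (1 + p) / p"
  have e0: "e \<noteq> 0" using nz a0 by (simp add: e_def)
  define q where "q = r * of_rat (v / e)"
  have "(ctr_sum a p)^2 - 4 * ctr_prod a p = d * (v / e)^2" using v e0 by (simp add: e_def[symmetric] power_divide)
  then have "of_rat ((ctr_sum a p)^2 - 4 * ctr_prod a p) = q^2"
    unfolding q_def by (simp add: of_rat_mult of_rat_power power_mult_distrib r2)
  then have q2: "q^2 = (ctr_sum ca (of_rat p))^2 - 4 * ctr_prod ca (of_rat p)"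
    by (simp add: of_rat_diff of_rat_mult of_rat_power of_rat_ctr_sum of_rat_ctr_prod)
  have rootc: "poly (bru_poly ca (of_rat (xt x))) (- of_rat p) = 0"
    using of_rat_poly_bru[of a "xt x" "- p", where 'a = complex] root by (simp add: of_rat_minus)
  have qK: "q \<in> K2" unfolding q_def by (intro sfD[OF sf_K2] r_K2)
  have main: "\<exists>h\<in>N. kg \<tau> s ca (of_rat (xt x)) (q' * ctr_fac ca (of_rat p)) = h^5"
    if q': "q' \<in> K2" "q'^2 = (ctr_sum ca (of_rat p))^2 - 4 * ctr_prod ca (of_rat p)" for q'
  proof -
    obtain u where u: "lyness u" "ly_a u = ca" "ly_t u = of_rat (xt x)" "ly_y u = q' * ctr_fac ca (of_rat p)" "u 0 = of_rat p"
      "u 2 = (ctr_sum ca (of_rat p) + q')/2"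
      using lyness_of_pair[OF ca0 rootc q'(2)] by metis
    have u0: "u 0 \<in> K2" unfolding u by (rule sf_of_rat[OF sf_K2])
    have u2: "u 2 \<in> K2" unfolding u
      by (intro sfD[OF sf_K2] ctr_in_field[OF sf_K2] q'(1))
    have uK: "u j \<in> N" for j using lyness_in_field_of_pair[OF sf_K2 u(1) u0 u2] K2_N by blast
    have "ly_h \<zeta> u \<in> N" unfolding ly_h_def by (intro sfD[OF sf_N] zeta_N uK)
    moreover have "kg \<tau> s ca (of_rat (xt x)) (q' * ctr_fac ca (of_rat p)) = (ly_h \<zeta> u)^5"
      using ly_h_power5[OF u(1) z] u by simp
    ultimately show ?thesis by blast
  qed
  have "(r * of_rat (yw y))^2 = (q * ctr_fac ca (of_rat p))^2"
  proof -
    have "1 + of_rat p \<noteq> (0::complex)" using nz(2) by (metis of_rat_1 of_rat_add of_rat_eq_0_iff)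
    then have "bru_disc ca (of_rat (xt x)) = ((ctr_sum ca (of_rat p))^2 - 4 * ctr_prod ca (of_rat p)) * (ctr_fac ca (of_rat p))^2"
      using bru_disc_ctr[OF _ _ rootc] nz by simp
    then show ?thesis unfolding curve_disc[OF P] q2[symmetric] by (simp add: power_mult_distrib)
  qed
  then have "r * of_rat (yw y) = q * ctr_fac ca (of_rat p) \<or> r * of_rat (yw y) = (- q) * ctr_fac ca (of_rat p)"
    by (auto simp: power2_eq_iff)
  then obtain h where h: "h \<in> N" "gP (Pt x y) = h^5"
    using main[OF qK q2] main[of "- q"] qK q2 sf_uminus[OF sf_K2 qK] by auto
  then have "h \<noteq> 0" using gP_nz[OF P] by auto
  then show ?thesis using same_fifth[OF h(1)] h(2) by simp
qed

lemma irr_towers: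
  assumes "irr_over rats (bru_poly ca (of_rat t))"
  shows "irr_over K2 (bru_poly ca (of_rat t))" "irr_over N (bru_poly ca (of_rat t))"
proof -
  have fr: "bru_poly ca (of_rat t) \<in> MX rats" by (intro bru_poly_MX sf_rats) (auto simp: rats_def)
  show k: "irr_over K2 (bru_poly ca (of_rat t))" unfolding K2_def
    by (rule irr_over_Adj[OF sf_rats r2K fr degree_bru_poly assms])
  have "bru_poly ca (of_rat t) \<in> MX K2" by (intro bru_poly_MX sf_K2 sf_of_rat[OF sf_K2])
  then show "irr_over N (bru_poly ca (of_rat t))" unfolding N_def
    by (rule N5_irr[OF z sf_K2 _ degree_bru_poly k])
qed

lemma irr_cycle_of_point:
  assumes P: "Pt x y \<in> carrier E" "Pt x y \<notin> phi_img a b"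
  obtains u where "lyness u" "ly_a u = ca" "ly_t u = of_rat (xt x)" "ly_y u = r * of_rat (yw y)"
    "gP (Pt x y) = (ly_h \<zeta> u)^5" "ly_h \<zeta> u \<noteq> 0" "irr_cycle K2 u" "irr_cycle N u"
proof -
  obtain u where u: "lyness u" "ly_a u = ca" "ly_t u = of_rat (xt x)" "ly_y u = r * of_rat (yw y)"
      "gP (Pt x y) = (ly_h \<zeta> u)^5" "ly_h \<zeta> u \<noteq> 0"
    using cycle_of_point[OF P(1)] by metis
  have irr: "irr_over rats (bru_poly ca (of_rat (xt x)))" using not_irr_imp_phi[OF P(1)] P(2) by blast
  have y0: "ly_y u \<noteq> 0" using yw0_imp_phi[OF P(1)] P(2) r0 u by auto
  have "irr_cycle K2 u"
    using irr_towers(1)[OF irr] u y0 by unfold_locales (auto intro: sfD[OF sf_K2] sf_K2 r_K2)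
  moreover have "irr_cycle N u"
    using irr_towers(2)[OF irr] u y0 by unfold_locales (auto intro: sfD[OF sf_N] sf_N r_N)
  ultimately show ?thesis using that u by blast
qed

lemma phi_iff_same:
  assumes P: "P \<in> carrier E"
  shows "P \<in> phi_img a b \<longleftrightarrow> same_class (gP P) 1"
proof (cases P)
  case Inf then show ?thesis by (simp add: phi_img_def same_refl)
next
  case Pt: (Pt x y)
  show ?thesis
  proof
    assume "P \<in> phi_img a b" then show "same_class (gP P) 1" using phi_imp_same P Pt by simp
  next
    assume sc: "same_class (gP P) 1"
    show "P \<in> phi_img a b"
    proof (rule ccontr)
      assume "P \<notin> phi_img a b"
      then obtain u where u: "gP P = (ly_h \<zeta> u)^5" "ly_h \<zeta> u \<noteq> 0" "irr_cycle N u"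
        using irr_cycle_of_point[of x y] P Pt by metis
      obtain c where "c \<in> N" "gP P = c^5" using sc by (auto simp: same_class_def)
      then show False using irr_cycle.not_fifth_power[OF u(3) z zeta_N] u by metis
    qed
  qed
qed

lemma reducible_iff_phi:
  assumes P: "P \<in> carrier E" "P \<noteq> Inf"
  shows "\<not> irreducible (BruP a b P) \<longleftrightarrow> P \<in> phi_img a b"
proof -
  obtain x y where Pt: "P = Pt x y" using P(2) by (cases P) auto
  define f where "f = bru_poly a (xt x)"
  have f: "BruP a b P = f" by (simp add: Pt BruP_def f_def xt_def Bru_eq)
  have df: "degree f = 5" "f \<noteq> 0" by (simp_all add: f_def)
  show ?thesis unfolding f
  proof
    assume "\<not> irreducible f"
    moreover have "\<not> is_unit f" using df by (simp add: is_unit_iff_degree)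
    ultimately obtain p q where pq: "f = p * q" "\<not> is_unit p" "\<not> is_unit q"
      using df(2) unfolding irreducible_def by blast
    have p0: "p \<noteq> 0" "q \<noteq> 0" using pq(1) df(2) by auto
    have dp: "degree p \<noteq> 0" "degree q \<noteq> 0" using pq p0 by (simp_all add: is_unit_iff_degree)
    have dpq: "degree p + degree q = 5" using pq(1) df p0 by (metis degree_mult_eq)
    define p' :: "complex poly" where "p' = map_poly of_rat p"
    define q' :: "complex poly" where "q' = map_poly of_rat q"
    have dp': "degree p' = degree p" unfolding p'_def by (rule degree_map_poly) auto
    have "bru_poly ca (of_rat (xt x)) = map_poly of_rat (p * q)"
      unfolding pq(1)[symmetric] f_def map_poly_bru_poly ..
    also have "\<dots> = p' * q'"
      unfolding p'_def q'_def
      by (rule poly_eqI) (simp add: coeff_map_poly coeff_mult of_rat_sum of_rat_mult)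
    finally have fc: "bru_poly ca (of_rat (xt x)) = p' * q'" .
    have "\<not> constant (poly p')" using dp dp' by (simp add: constant_degree)
    then obtain w where w: "poly p' w = 0" using fundamental_theorem_of_algebra by blast
    have "p' \<in> MX rats" unfolding MX_def p'_def by (auto simp: coeff_map_poly rats_def)
    moreover have "p' \<noteq> 0" using dp dp' by auto
    moreover have "degree p' < degree (bru_poly ca (of_rat (xt x)))" using dp dp' dpq by simp
    moreover have "poly (bru_poly ca (of_rat (xt x))) w = 0" using fc w by simp
    ultimately have "\<not> irr_over rats (bru_poly ca (of_rat (xt x)))"
      using w unfolding irr_over_def by blast
    then show "P \<in> phi_img a b" using not_irr_imp_phi P Pt by blast
  next
    assume "P \<in> phi_img a b"
    then obtain p where "poly f (- p) = 0"
      using phi_img_iff[OF a0 d0 P(1)[unfolded Pt]] Pt by (auto simp: xt_def f_def)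
    then obtain q where q: "f = [:p, 1:] * q" by (metis dvdE minus_minus poly_eq_0_iff_dvd)
    have "q \<noteq> 0" using q df by auto
    then have "degree f = degree [:p, 1:] + degree q" unfolding q by (rule degree_mult_eq[rotated]) simp
    then have "degree q = 4" using df by simp
    then have "\<not> is_unit q" using \<open>q \<noteq> 0\<close> by (simp add: is_unit_iff_degree)
    moreover have "\<not> is_unit [:p, 1:]" by (simp add: is_unit_iff_degree)
    ultimately show "\<not> irreducible f" unfolding irreducible_def using q by blast
  qed
qed

end

section \<open>Bounded representatives modulo fifth powers\<close>

lemma int_square_5:
  fixes x y :: int
  assumes "x^2 = 5 * y^2"
  shows "x = 0 \<and> y = 0"
proof (cases "y = 0")
  case True then show ?thesis using assms by simp
next
  case False
  have "(of_int x :: rat)^2 = 5 * (of_int y)^2" using assms by (metis of_int_mult of_int_numeral of_int_power)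
  then have "(of_int x / of_int y :: rat)^2 = 5" using False by (simp add: power_divide)
  then show ?thesis using no_rat_sqrt5 by blast
qed

text \<open>The form is the norm of \<open>p + q*\<tau>\<close>; completing the square brings in the
  irrationality of the square root of 5.\<close>

lemma int_norm_tau_zero:
  fixes p q :: int
  assumes "p^2 - p*q - q^2 = 0"
  shows "p = 0 \<and> q = 0"
proof -
  have "(2*p - q)^2 = 5 * q^2" using assms by algebra
  then show ?thesis using int_square_5 by fastforce
qed

text \<open>Minkowski's lattice point argument in the form of a pigeonhole principle.\<close>
lemma crowded_cell:
  fixes f :: "nat \<Rightarrow> int \<times> int \<times> int \<times> int \<Rightarrow> real" and b :: "nat \<Rightarrow> real" and L n :: real
  assumes L: "L > 0" and n: "n \<ge> 0" and b: "\<And>i. i < 4 \<Longrightarrow> b i > 0"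
    and f: "\<And>i (T::nat) p q p' q'. i < 4 \<Longrightarrow> p \<in> {0..int T} \<Longrightarrow> q \<in> {0..int T} \<Longrightarrow> p' \<in> {0..int T} \<Longrightarrow> q' \<in> {0..int T}
      \<Longrightarrow> \<bar>f i (p,q,p',q')\<bar> \<le> L * real T"
    and prod: "(\<Prod>i<4. b i) \<ge> (5 * L)^4 * n"
  shows "\<exists>S. finite S \<and> real (card S) > n \<and> (\<forall>c\<in>S. \<forall>c'\<in>S. \<forall>i<4. \<bar>f i c - f i c'\<bar> \<le> b i)"
proof -
  obtain T :: nat where T: "\<And>i. i < 4 \<Longrightarrow> b i / L \<le> real T" "T \<ge> 1"
  proof -
    obtain T0 :: nat where T0: "(\<Sum>i<4. b i / L) + 1 \<le> real T0" using real_arch_simple by blast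
    have s0: "b i / L \<le> (\<Sum>i<4. b i / L)" if "i < 4" for i
      using that b L by (intro member_le_sum) (auto simp: less_imp_le)
    have nn: "(\<Sum>i<4. b i / L) \<ge> 0" using b L by (intro sum_nonneg) (auto simp: less_imp_le)
    show ?thesis
    proof (rule that[of T0])
      show "b i / L \<le> real T0" if "i < 4" for i using s0[OF that] T0 by linarith
      show "T0 \<ge> 1" using nn T0 by linarith
    qed
  qed
  define I where "I = {0..int T}"
  define Box where "Box = I \<times> I \<times> I \<times> I"
  have cI: "finite I" "card I = T + 1" by (simp_all add: I_def)
  have cBox: "finite Box" "card Box = (T+1)^4" by (simp_all add: Box_def cI card_cartesian_product power4_eq_xxxx)
  define k where "k = (\<lambda>i. \<lceil>L * real T / b i\<rceil>)"
  define J where "J = (\<lambda>i. {- k i .. k i})"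
  define cell where "cell = (\<lambda>c. (\<lfloor>f 0 c / b 0\<rfloor>, \<lfloor>f 1 c / b 1\<rfloor>, \<lfloor>f 2 c / b 2\<rfloor>, \<lfloor>f 3 c / b 3\<rfloor>))"
  define Cells where "Cells = J 0 \<times> J 1 \<times> J 2 \<times> J 3"
  have fb: "\<lfloor>f i c / b i\<rfloor> \<in> J i" if "c \<in> Box" "i < 4" for c i
  proof -
    have "\<bar>f i c\<bar> \<le> L * real T" using that f unfolding Box_def I_def by auto
    then have "\<bar>f i c / b i\<bar> \<le> L * real T / b i" using b[OF that(2)] by (simp add: divide_right_mono)
    moreover have "L * real T / b i \<le> of_int (k i)" by (simp add: k_def)
    ultimately have "f i c / b i \<le> of_int (k i)" "- of_int (k i) \<le> f i c / b i" by linarith+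
    then show ?thesis unfolding J_def by (simp add: le_floor_iff floor_le_iff)
  qed
  have cellB: "cell ` Box \<subseteq> Cells" unfolding cell_def Cells_def using fb by auto
  \<comment> \<open>The constant 5 arises here: with \<open>x = L*T/b i \<ge> 1\<close> there are at
    most \<open>2*(x+1) + 1 \<le> 5*x\<close> cells in one direction.\<close>
  have cJ: "real (card (J i)) \<le> 5 * L * real T / b i" if "i < 4" for i
  proof -
    have bi: "b i > 0" using b that by blast
    have "1 \<le> L * real T / b i" using T(1)[OF that] L bi by (simp add: field_simps)
    moreover have "of_int (k i) < L * real T / b i + 1" unfolding k_def by linarith
    moreover have "k i \<ge> 0" using calculation(1) unfolding k_def by linarith
    ultimately show ?thesis unfolding J_def by simp
  qed
  have fC: "finite Cells" by (simp add: Cells_def J_def)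
  have "real (card Cells) = real (card (J 0)) * real (card (J 1)) * real (card (J 2)) * real (card (J 3))"
    by (simp add: Cells_def card_cartesian_product)
  also have "\<dots> \<le> (5 * L * real T / b 0) * (5 * L * real T / b 1) * (5 * L * real T / b 2) * (5 * L * real T / b 3)"
    using cJ b L by (intro mult_mono mult_nonneg_nonneg divide_nonneg_pos) (auto simp: less_imp_le)
  also have "\<dots> = (5 * L)^4 * real T^4 / (\<Prod>i<4. b i)"
    by (simp add: eval_nat_numeral algebra_simps)
  finally have cC: "real (card Cells) \<le> (5 * L)^4 * real T^4 / (\<Prod>i<4. b i)" .
  have pp: "(\<Prod>i<4. b i) > 0" using b by (intro prod_pos) auto
  have "\<exists>y\<in>Cells. real (card {c\<in>Box. cell c = y}) > n"
  proof (rule ccontr)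
    assume "\<not> ?thesis"
    then have le: "\<And>y. y \<in> Cells \<Longrightarrow> real (card {c\<in>Box. cell c = y}) \<le> n" by force
    have U: "(\<Union>y\<in>Cells. {c\<in>Box. cell c = y}) = Box" using cellB by auto
    have "card Box \<le> (\<Sum>y\<in>Cells. card {c\<in>Box. cell c = y})"
      using card_UN_le[OF fC, of "\<lambda>y. {c\<in>Box. cell c = y}"] unfolding U .
    then have "real (card Box) \<le> real (\<Sum>y\<in>Cells. card {c\<in>Box. cell c = y})" by (simp only: of_nat_le_iff)
    also have "\<dots> = (\<Sum>y\<in>Cells. real (card {c\<in>Box. cell c = y}))" by (rule of_nat_sum)
    also have "\<dots> \<le> real (card Cells) * n" by (rule sum_bounded_above) (rule le)
    also have "\<dots> \<le> (5 * L)^4 * real T^4 / (\<Prod>i<4. b i) * n" using cC n by (intro mult_right_mono)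
    also have "\<dots> = real T^4 * ((5 * L)^4 * n / (\<Prod>i<4. b i))" by simp
    also have "\<dots> \<le> real T^4 * 1" using prod pp by (intro mult_left_mono) auto
    finally have "real ((T+1)^4) \<le> real (T^4)" unfolding cBox by simp
    then have "(T+1)^4 \<le> T^4" by (simp only: of_nat_le_iff)
    then show False using power_strict_mono[of T "T+1" 4] by simp
  qed
  then obtain y where y: "real (card {c\<in>Box. cell c = y}) > n" by blast
  define S where "S = {c\<in>Box. cell c = y}"
  have "\<bar>f i c - f i c'\<bar> \<le> b i" if "c \<in> S" "c' \<in> S" "i < 4" for c c' i
  proof -
    have "cell c = cell c'" using that by (simp add: S_def)
    moreover have "i = 0 \<or> i = 1 \<or> i = 2 \<or> i = 3" using that(3) by linarith
    ultimately have e: "\<lfloor>f i c / b i\<rfloor> = \<lfloor>f i c' / b i\<rfloor>" unfolding cell_def by auto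
    have bi: "b i > 0" using b that by blast
    have "\<bar>f i c / b i - f i c' / b i\<bar> \<le> 1" using e by linarith
    then have "\<bar>(f i c - f i c') / b i\<bar> \<le> 1" by (simp add: diff_divide_distrib)
    then show ?thesis using bi by (simp add: field_simps)
  qed
  moreover have "finite S" using cBox by (simp add: S_def)
  ultimately show ?thesis using y unfolding S_def by blast
qed

section \<open>A cyclic quartic order and its conjugation\<close>

locale quartic =
  fixes T :: real and \<theta> :: complex and D0 :: int
  assumes T2: "T^2 = 1 - T" and D0: "D0 \<noteq> 0" and th2: "\<theta>^2 = - of_int D0 * (3 + of_real T)"
begin

abbreviation "\<tau> \<equiv> (of_real T :: complex)"

lemma tau2: "\<tau>^2 = 1 - \<tau>"
  using T2 by (metis of_real_1 of_real_diff of_real_power)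

fun ev :: "int \<times> int \<times> int \<times> int \<Rightarrow> complex" where
  "ev (p, q, p', q') = (of_int p + of_int q * \<tau>) + (of_int p' + of_int q' * \<tau>) * \<theta>"

text \<open>The conjugation sends \<tau> to \<open>-1 - \<tau>\<close> and \<theta> to
  \<open>\<tau> * \<theta>\<close>, consistently because
  \<open>(\<tau> * \<theta>)^2 = - D0 * (2 - \<tau>)\<close>. It has order 4, and its square fixes
  \<tau> and negates \<theta>.\<close>

fun sg4 :: "int \<times> int \<times> int \<times> int \<Rightarrow> int \<times> int \<times> int \<times> int" where
  "sg4 (p, q, p', q') = (p - q, - q, - q', p')"

fun mul4 :: "int \<times> int \<times> int \<times> int \<Rightarrow> int \<times> int \<times> int \<times> int \<Rightarrow> int \<times> int \<times> int \<times> int" where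
  "mul4 (a, b, c, d) (p, q, p', q') =
    (let B0 = c*p' + d*q'; B1 = c*q' + d*p' - d*q' in
    (a*p + b*q - D0*(3*B0 + B1), a*q + b*p - b*q - D0*(B0 + 2*B1),
     a*p' + b*q' + c*p + d*q, a*q' + b*p' - b*q' + c*q + d*p - d*q))"

lemma ev_mul4: "ev (mul4 c c') = ev c * ev c'"
proof -
  obtain a b cc d where c: "c = (a, b, cc, d)" by (metis surj_pair)
  obtain p q p' q' where c': "c' = (p, q, p', q')" by (metis surj_pair)
  show ?thesis unfolding c c' mul4.simps Let_def ev.simps
    of_int_add of_int_diff of_int_mult of_int_numeral using tau2 th2 by algebra
qed

lemma sg4_mul4: "sg4 (mul4 c c') = mul4 (sg4 c) (sg4 c')"
  by (cases c; cases c') (simp add: Let_def algebra_simps)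

lemma tau_int_indep:
  assumes "of_int p + of_int q * \<tau> = 0"
  shows "p = 0 \<and> q = 0"
proof -
  have "of_rat (of_int p) + of_rat (of_int q) * \<tau> = 0" using assms by simp
  from tau_indep[OF tau2 this] show ?thesis by simp
qed

text \<open>The norm of \<open>3 + \<tau>\<close> is 5, not a square, so \<theta> does not lie in
  Q(\<tau>). Taking norms in the squared relation leads to \<open>x^2 = 5 * y^2\<close> in
  integers.\<close>

lemma ev_zero:
  assumes "ev (p, q, p', q') = 0"
  shows "p = 0 \<and> q = 0 \<and> p' = 0 \<and> q' = 0"
proof -
  have e: "(of_int p + of_int q * \<tau>) = - ((of_int p' + of_int q' * \<tau>) * \<theta>)"
    using assms by (simp add: add_eq_0_iff2)
  define B0 B1 where "B0 = p'^2 + q'^2" and "B1 = 2*p'*q' - q'^2"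
  have "(of_int p + of_int q * \<tau>)^2 = (of_int p' + of_int q' * \<tau>)^2 * \<theta>^2"
    unfolding e by algebra
  then have "of_int (p^2 + q^2 + D0 * (3*B0 + B1)) + of_int (2*p*q - q^2 + D0 * (B0 + 2*B1)) * \<tau> = 0"
    unfolding B0_def B1_def of_int_add of_int_diff of_int_mult of_int_power of_int_numeral th2 using tau2 by algebra
  from tau_int_indep[OF this]
  have i: "p^2 + q^2 = - D0 * (3*B0 + B1)" "2*p*q - q^2 = - D0 * (B0 + 2*B1)" by auto
  have "(p^2 - p*q - q^2)^2 = (p^2+q^2)^2 - (p^2+q^2)*(2*p*q-q^2) - (2*p*q-q^2)^2" by algebra
  also have "\<dots> = 5 * (D0 * (p'^2 - p'*q' - q'^2))^2" unfolding i B0_def B1_def by algebra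
  finally have "D0 * (p'^2 - p'*q' - q'^2) = 0" using int_square_5 by blast
  then have B: "p' = 0 \<and> q' = 0" using D0 int_norm_tau_zero by simp
  then have "of_int p + of_int q * \<tau> = 0" using e by simp
  then show ?thesis using tau_int_indep B by blast
qed

lemma ev_add: "ev (p,q,p',q') + ev (a,b,c,d) = ev (p+a,q+b,p'+c,q'+d)" by (simp add: algebra_simps)
lemma ev_diff: "ev (p,q,p',q') - ev (a,b,c,d) = ev (p-a,q-b,p'-c,q'-d)" by (simp add: algebra_simps)

lemma inj_ev: "inj ev"
proof (rule injI)
  fix x y assume xy: "ev x = ev y"
  obtain a b c d where x: "x = (a, b, c, d)" by (metis surj_pair)
  obtain p q p' q' where y: "y = (p, q, p', q')" by (metis surj_pair)
  have "ev (a-p,b-q,c-p',d-q') = 0" using xy unfolding x y ev_diff[symmetric] by (simp del: ev.simps)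
  from ev_zero[OF this] show "x = y" by (simp add: x y)
qed

definition Oth :: "complex set" where "Oth = range ev"
definition sg :: "complex \<Rightarrow> complex" where "sg x = ev (sg4 (the_inv ev x))"

lemma sg_ev: "sg (ev c) = ev (sg4 c)" by (simp add: sg_def the_inv_f_f[OF inj_ev])

lemma Oth_cases: "x \<in> Oth \<Longrightarrow> (\<And>p q p' q'. x = ev (p,q,p',q') \<Longrightarrow> P) \<Longrightarrow> P"
  by (auto simp: Oth_def)

lemma Oth_ev: "ev c \<in> Oth" by (simp add: Oth_def)

lemma Oth_add: assumes "x \<in> Oth" "y \<in> Oth" shows "x + y \<in> Oth" "sg (x + y) = sg x + sg y"
proof -
  obtain a b c d where x: "x = ev (a, b, c, d)" using assms(1) by (rule Oth_cases)
  obtain p q p' q' where y: "y = ev (p, q, p', q')" using assms(2) by (rule Oth_cases)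
  show "x + y \<in> Oth" unfolding x y ev_add by (rule Oth_ev)
  show "sg (x + y) = sg x + sg y" unfolding x y ev_add sg_ev sg4.simps by (simp add: algebra_simps)
qed

lemma Oth_diff: assumes "x \<in> Oth" "y \<in> Oth" shows "x - y \<in> Oth" "sg (x - y) = sg x - sg y"
proof -
  obtain a b c d where x: "x = ev (a, b, c, d)" using assms(1) by (rule Oth_cases)
  obtain p q p' q' where y: "y = ev (p, q, p', q')" using assms(2) by (rule Oth_cases)
  show "x - y \<in> Oth" unfolding x y ev_diff by (rule Oth_ev)
  show "sg (x - y) = sg x - sg y" unfolding x y ev_diff sg_ev sg4.simps by (simp add: algebra_simps)
qed

lemma Oth_mult: assumes "x \<in> Oth" "y \<in> Oth" shows "x * y \<in> Oth" "sg (x * y) = sg x * sg y"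
proof -
  obtain c where x: "x = ev c" using assms(1) by (auto simp: Oth_def)
  obtain c' where y: "y = ev c'" using assms(2) by (auto simp: Oth_def)
  show "x * y \<in> Oth" unfolding x y ev_mul4[symmetric] by (rule Oth_ev)
  show "sg (x * y) = sg x * sg y" unfolding x y ev_mul4[symmetric] sg_ev sg4_mul4 ..
qed

lemma Oth_int: "of_int k \<in> Oth" "sg (of_int k) = of_int k"
proof -
  have "of_int k = ev (k, 0, 0, 0)" by simp
  then show "of_int k \<in> Oth" "sg (of_int k) = of_int k"
    using Oth_ev[of "(k,0,0,0)"] sg_ev[of "(k,0,0,0)"] by simp_all
qed

lemma Oth_consts: "0 \<in> Oth" "1 \<in> Oth" "numeral w \<in> Oth" "\<tau> \<in> Oth" "\<theta> \<in> Oth"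
  using Oth_int(1)[of 0] Oth_int(1)[of 1] Oth_int(1)[of "numeral w"] Oth_ev[of "(0,1,0,0)"] Oth_ev[of "(0,0,1,0)"] by simp_all

lemma Oth_power: "x \<in> Oth \<Longrightarrow> x ^ n \<in> Oth" "x \<in> Oth \<Longrightarrow> sg (x ^ n) = sg x ^ n"
proof -
  show "x ^ n \<in> Oth" if "x \<in> Oth" for x n using that by (induction n) (auto intro: Oth_consts Oth_mult)
  then show "sg (x ^ n) = sg x ^ n" if "x \<in> Oth" for x n
    using that Oth_int(2)[of 1] by (induction n) (auto simp: Oth_mult(2))
qed

lemma sg_Oth: "x \<in> Oth \<Longrightarrow> sg x \<in> Oth" by (simp add: sg_def Oth_ev)

lemma sg2_ev: "sg (sg (ev (p,q,p',q'))) = ev (p,q,-p',-q')" unfolding sg_ev sg4.simps by simp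

lemma sg4_id: assumes "x \<in> Oth" shows "sg (sg (sg (sg x))) = x"
proof -
  obtain p q p' q' where x: "x = ev (p, q, p', q')" using assms by (rule Oth_cases)
  show ?thesis unfolding x sg2_ev by simp
qed

lemma sg_0_iff: "x \<in> Oth \<Longrightarrow> sg x = 0 \<longleftrightarrow> x = 0"
  using sg4_id Oth_int(2)[of 0] by (metis of_int_0)

lemmas Oth_cl = Oth_add(1) Oth_diff(1) Oth_mult(1) Oth_int(1) Oth_consts Oth_power(1) sg_Oth

definition two_gen :: "complex \<Rightarrow> complex \<Rightarrow> complex set" where
  "two_gen M G = {u * M + v * G | u v. u \<in> Oth \<and> v \<in> Oth}"

lemma two_genI: "u \<in> Oth \<Longrightarrow> v \<in> Oth \<Longrightarrow> x = u * M + v * G \<Longrightarrow> x \<in> two_gen M G"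
  by (auto simp: two_gen_def)

lemma ev_cong_mod:
  fixes n :: int
  assumes n: "n \<noteq> 0" and "a mod n = p mod n" "b mod n = q mod n" "c mod n = p' mod n" "d mod n = q' mod n"
  shows "\<exists>o'\<in>Oth. ev (a,b,c,d) - ev (p,q,p',q') = of_int n * o'"
proof -
  obtain i j k l where "a - p = n * i" "b - q = n * j" "c - p' = n * k" "d - q' = n * l"
    using assms by (metis mod_eq_dvd_iff dvdE)
  then have "ev (a,b,c,d) - ev (p,q,p',q') = of_int n * ev (i,j,k,l)"
    unfolding ev_diff by (simp add: algebra_simps)
  then show ?thesis using Oth_ev by blast
qed

text \<open>A pairwise incongruent \<open>S\<close> would inject \<open>S\<^sup>4\<close> into the order modulo \<open>n = M sg(M)\<close>: the Chinese remainder
  theorem for the two ideals conjugate under \<open>sg\<^sup>2\<close>, whose product is nearly \<open>(M)\<close>, is used twice.\<close>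

lemma congruent_pair:
  fixes \<kappa> n :: int
  assumes O: "G \<in> Oth" "M \<in> Oth" "\<alpha> \<in> Oth" "\<beta> \<in> Oth" "\<gamma> \<in> Oth"
    and M0: "M \<noteq> 0" and MM: "sg (sg M) = M" and nM: "M * sg M = of_int n"
    and kap: "of_int \<kappa> = \<alpha> * G + \<beta> * sg (sg G) + \<gamma> * M"
    and S: "finite S" "S \<subseteq> Oth" "card S > nat \<bar>n\<bar>"
  shows "\<exists>x\<in>S. \<exists>x'\<in>S. x \<noteq> x' \<and> of_int \<kappa> * (x - x') \<in> two_gen M (sg (sg G))"
proof (rule ccontr)
  assume neg: "\<not> ?thesis"
  let ?I = "two_gen M (sg (sg G))"
  define G' where "G' = sg (sg G)"
  have G': "G' \<in> Oth" unfolding G'_def by (intro Oth_cl O)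
  have sgG': "sg (sg G') = G" unfolding G'_def by (rule sg4_id[OF O(1)])
  have n0: "n \<noteq> 0" using nM M0 sg_0_iff[OF O(2)] by auto
  have eqI: "x = x'" if "x \<in> S" "x' \<in> S" "of_int \<kappa> * (x - x') \<in> two_gen M G'" for x x'
    using neg that unfolding G'_def by blast
  \<comment> \<open>By the relation for \<open>\<kappa>\<close>, \<open>Z x y\<close> is congruent
    to \<open>\<kappa> * x\<close> modulo \<open>(M, G')\<close> and to
    \<open>\<kappa> * sg (sg y)\<close> modulo \<open>(M, G)\<close>.\<close>
  define Z where "Z = (\<lambda>x y. \<alpha> * G * x + \<beta> * G' * sg (sg y))"
  have ZO: "Z x y \<in> Oth" if "x \<in> Oth" "y \<in> Oth" for x y
    unfolding Z_def using that by (intro Oth_cl O G')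
  have Zinj: "x = x1 \<and> y = y1"
    if xy: "x \<in> S" "y \<in> S" "x1 \<in> S" "y1 \<in> S" and k: "k \<in> Oth" "Z x y - Z x1 y1 = M * k" for x y x1 y1 k
  proof -
    have xO: "x \<in> Oth" "y \<in> Oth" "x1 \<in> Oth" "y1 \<in> Oth" using xy S(2) by auto
    define e where "e = x - x1"
    define f where "f = sg (sg (y - y1))"
    have e: "e \<in> Oth" and f: "f \<in> Oth" unfolding e_def f_def by (intro Oth_cl xO)+
    have "f = sg (sg y) - sg (sg y1)" unfolding f_def using xO by (simp add: Oth_diff(2) sg_Oth)
    then have zz: "\<alpha> * G * e + \<beta> * G' * f = M * k"
      using k(2) unfolding Z_def e_def by algebra
    have "of_int \<kappa> * e = (k + \<gamma> * e) * M + (\<beta> * e - \<beta> * f) * G'"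
      using zz unfolding kap G'_def[symmetric] by algebra
    moreover have "k + \<gamma> * e \<in> Oth" "\<beta> * e - \<beta> * f \<in> Oth" by (intro Oth_cl k O e f)+
    ultimately have 1: "x = x1" using eqI[OF xy(1,3)] two_genI unfolding e_def by blast
    have "of_int \<kappa> * f = (k + \<gamma> * f) * M + (\<alpha> * f - \<alpha> * e) * G"
      using zz unfolding kap G'_def[symmetric] by algebra
    \<comment> \<open>The double conjugation exchanges \<open>G\<close> and \<open>G'\<close> and
      fixes \<open>M\<close>, so the second congruence also ends in the ideal
      \<open>(M, G')\<close>.\<close>
    then have "sg (sg (of_int \<kappa> * f)) = sg (sg ((k + \<gamma> * f) * M + (\<alpha> * f - \<alpha> * e) * G))" by simp
    also have "\<dots> = sg (sg (k + \<gamma> * f)) * M + sg (sg (\<alpha> * f - \<alpha> * e)) * G'"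
    proof -
      have a: "k + \<gamma> * f \<in> Oth" "\<alpha> * f - \<alpha> * e \<in> Oth" by (intro Oth_cl k O e f)+
      show ?thesis unfolding G'_def using a O MM by (simp add: Oth_add(2) Oth_mult Oth_cl)
    qed
    also have "sg (sg (of_int \<kappa> * f)) = of_int \<kappa> * (y - y1)"
      unfolding f_def using xO by (simp add: Oth_mult(2) Oth_int Oth_cl sg4_id)
    finally have "of_int \<kappa> * (y - y1) \<in> two_gen M G'"
      by (intro two_genI) (auto intro!: Oth_cl k O e f)
    then have "y = y1" by (rule eqI[OF xy(2,4)])
    with 1 show ?thesis by simp
  qed
  \<comment> \<open>Two digits in base \<open>M\<close>: as \<open>n = M * sg M\<close>, the class
    of \<open>R\<close> modulo \<open>n\<close> determines the first \<open>Z\<close> modulo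
    \<open>M\<close> and, once these agree, the conjugate of the second modulo
    \<open>sg M\<close>.\<close>
  define R where "R = (\<lambda>(x, y, x', y'). Z x y + M * sg (Z x' y'))"
  define red where "red = (\<lambda>z. case the_inv ev z of (a, b, c, d) \<Rightarrow> (a mod n, b mod n, c mod n, d mod n))"
  define SS where "SS = S \<times> S \<times> S \<times> S"
  have red: "\<exists>o'\<in>Oth. z - z' = of_int n * o'" if zr: "z \<in> Oth" "z' \<in> Oth" "red z = red z'" for z z'
  proof -
    obtain a b c d where z: "z = ev (a, b, c, d)" using zr(1) by (rule Oth_cases)
    obtain p q p' q' where z': "z' = ev (p, q, p', q')" using zr(2) by (rule Oth_cases)
    have "a mod n = p mod n" "b mod n = q mod n" "c mod n = p' mod n" "d mod n = q' mod n"
      using zr(3) unfolding z z' red_def the_inv_f_f[OF inj_ev] by simp_all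
    then show ?thesis unfolding z z' by (rule ev_cong_mod[OF n0])
  qed
  have inj: "inj_on (red \<circ> R) SS"
  proof (rule inj_onI)
    fix s1 s2 assume s: "s1 \<in> SS" "s2 \<in> SS" "(red \<circ> R) s1 = (red \<circ> R) s2"
    obtain x y x' y' where s1: "s1 = (x, y, x', y')" by (metis surj_pair)
    obtain u v u' v' where s2: "s2 = (u, v, u', v')" by (metis surj_pair)
    have m: "x \<in> S" "y \<in> S" "x' \<in> S" "y' \<in> S" "u \<in> S" "v \<in> S" "u' \<in> S" "v' \<in> S"
      using s(1,2) unfolding s1 s2 SS_def by auto
    have mO: "Z x y \<in> Oth" "Z x' y' \<in> Oth" "Z u v \<in> Oth" "Z u' v' \<in> Oth" using m S(2) ZO by blast+
    define w where "w = sg (Z x' y') - sg (Z u' v')"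
    have w: "w \<in> Oth" unfolding w_def by (intro Oth_cl mO)
    have RO: "R s1 \<in> Oth" "R s2 \<in> Oth" unfolding s1 s2 R_def prod.case by (intro Oth_cl mO O)+
    obtain o' where o': "o' \<in> Oth" "R s1 - R s2 = of_int n * o'" using red[OF RO] s(3) by auto
    have e: "Z x y - Z u v + M * w = M * (sg M * o')"
      using o'(2) unfolding nM[symmetric] s1 s2 R_def w_def by (simp add: algebra_simps)
    have "Z x y - Z u v = M * (sg M * o' - w)" using e by algebra
    moreover have "sg M * o' - w \<in> Oth" by (intro Oth_cl o' O w)
    ultimately have 1: "x = u \<and> y = v" using Zinj[OF m(1) m(2) m(5) m(6)] by blast
    then have "M * w = M * (sg M * o')" using e by simp
    then have we: "w = sg M * o'" using M0 by simp
    have "Z x' y' - Z u' v' = sg (sg (sg w))"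
      unfolding w_def using mO by (simp add: Oth_diff(2) sg_Oth sg4_id)
    also have "\<dots> = M * sg (sg (sg o'))"
      unfolding we using O o' by (simp add: Oth_mult(2) sg_Oth sg4_id)
    finally have "x' = u' \<and> y' = v'"
      by (rule Zinj[OF m(3) m(4) m(7) m(8) sg_Oth[OF sg_Oth[OF sg_Oth[OF o'(1)]]]])
    with 1 show "s1 = s2" unfolding s1 s2 by simp
  qed
  define Rg where "Rg = range (\<lambda>a. a mod n)"
  have sub: "(red \<circ> R) ` SS \<subseteq> Rg \<times> Rg \<times> Rg \<times> Rg"
  proof -
    have "red y \<in> Rg \<times> Rg \<times> Rg \<times> Rg" for y
      unfolding red_def Rg_def by (cases "the_inv ev y") simp
    then show ?thesis unfolding comp_def by (intro image_subsetI)
  qed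
  have fm: "finite (Rg) \<and> card (Rg) \<le> nat \<bar>n\<bar>"
  proof -
    have sb: "Rg \<subseteq> (if n > 0 then {0..<n} else {n<..0})"
      unfolding Rg_def using n0 by (auto simp: neg_mod_bound neg_mod_sign)
    have "finite (if n > 0 then {0..<n} else {n<..0})" by simp
    moreover have "card (if n > 0 then {0..<n} else {n<..0}) = nat \<bar>n\<bar>" by auto
    ultimately show ?thesis using sb by (metis card_mono finite_subset)
  qed
  have "card SS \<le> card (Rg \<times> Rg \<times> Rg \<times> Rg)" using fm by (intro card_inj_on_le[OF inj sub]) simp
  then have "card SS \<le> card Rg ^ 4" by (simp add: card_cartesian_product power4_eq_xxxx mult.assoc)
  also have "\<dots> \<le> (nat \<bar>n\<bar>)^4" using fm by (intro power_mono) auto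
  finally have "(card S)^4 \<le> (nat \<bar>n\<bar>)^4" by (simp add: SS_def card_cartesian_product power4_eq_xxxx mult.assoc)
  then have "card S \<le> nat \<bar>n\<bar>" by (simp add: power_mono_iff)
  then show False using S(3) by simp
qed

section \<open>Sizes of conjugates\<close>

definition sgn4 :: "nat \<Rightarrow> complex \<Rightarrow> complex" where "sgn4 i x = (sg ^^ i) x"

lemma sgn4_simps [simp]: "sgn4 0 x = x" "sgn4 (Suc i) x = sg (sgn4 i x)" by (simp_all add: sgn4_def)

lemma sgn4_Oth: "x \<in> Oth \<Longrightarrow> sgn4 i x \<in> Oth" by (induction i) (auto intro: sg_Oth)

lemma sgn4_hom:
  assumes "x \<in> Oth" "y \<in> Oth"
  shows "sgn4 i (x - y) = sgn4 i x - sgn4 i y" "sgn4 i (x * y) = sgn4 i x * sgn4 i y" "sgn4 i (x ^ n) = sgn4 i x ^ n"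
  using assms by (induction i) (auto simp: Oth_diff Oth_mult Oth_power sgn4_Oth)

lemma sgn4_int: "sgn4 i (of_int k) = of_int k" by (induction i) (auto simp: Oth_int)

lemma sgn4_nz: "x \<in> Oth \<Longrightarrow> x \<noteq> 0 \<Longrightarrow> sgn4 i x \<noteq> 0" by (induction i) (auto simp: sg_0_iff sgn4_Oth)

lemma th_real_or_imag: "(Im \<theta> = 0) \<or> (Re \<theta> = 0)"
proof -
  have "Im (\<theta>^2) = 0" unfolding th2 by simp
  then show ?thesis by (simp add: power2_eq_square)
qed

lemma th_nz: "\<theta> \<noteq> 0"
proof
  assume "\<theta> = 0"
  then have "(3 + \<tau>) = 0" using th2 D0 by simp
  then have "complex_of_real (3 + T) = 0" by simp
  then have "3 + T = 0" by (simp only: of_real_eq_0_iff)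
  then have "T = - 3" by simp
  then show False using T2 by simp
qed

lemma real_case: "Im \<theta> = 0 \<Longrightarrow> x \<in> Oth \<Longrightarrow> Im x = 0"
  by (auto simp: Oth_def)

lemma imag_case:
  assumes "Re \<theta> = 0" "x \<in> Oth"
  shows "sg (sg x) = cnj x"
proof -
  obtain p q p' q' where x: "x = ev (p, q, p', q')" using assms(2) by (rule Oth_cases)
  have "cnj \<theta> = - \<theta>" using assms(1) by (simp add: complex_eq_iff)
  then show ?thesis unfolding x sg2_ev by (simp add: algebra_simps)
qed

text \<open>Four real linear forms controlling all conjugates. For real \<theta> the conjugates are
  real; otherwise \<theta> is purely imaginary, \<open>sg\<close> applied twice is complex
  conjugation, and the real and imaginary parts of the first two conjugates are taken.\<close>

definition form :: "nat \<Rightarrow> complex \<Rightarrow> real" where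
  "form i x = (if Im \<theta> = 0 \<or> i < 2 then Re (sgn4 i x) else Im (sgn4 (i - 2) x))"

lemma form_le: "\<bar>form i x\<bar> \<le> cmod (sgn4 (if Im \<theta> = 0 \<or> i < 2 then i else i - 2) x)"
  unfolding form_def by (simp add: abs_Re_le_cmod abs_Im_le_cmod)

lemma form_diff: "x \<in> Oth \<Longrightarrow> y \<in> Oth \<Longrightarrow> form i (x - y) = form i x - form i y"
  by (simp add: form_def sgn4_hom)

lemma small_of_forms:
  assumes x: "x \<in> Oth" and f: "\<And>i. i < 4 \<Longrightarrow> \<bar>form i x\<bar> \<le> b i" and b: "Im \<theta> \<noteq> 0 \<Longrightarrow> b 2 = b 0 \<and> b 3 = b 1"
    and i: "i < 4"
  shows "cmod (sgn4 i x) \<le> 2 * b i"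
proof (cases "Im \<theta> = 0")
  case True
  have "Im (sgn4 i x) = 0" by (rule real_case[OF True sgn4_Oth[OF x]])
  then have "cmod (sgn4 i x) = \<bar>form i x\<bar>" using True by (simp add: form_def cmod_eq_Re)
  then show ?thesis using f[OF i] by linarith
next
  case False
  then have R: "Re \<theta> = 0" using th_real_or_imag by blast
  have bb: "b (Suc (Suc 0)) = b 0" "b (Suc (Suc (Suc 0))) = b (Suc 0)"
    using b[OF False] by (simp_all add: numeral_2_eq_2 numeral_3_eq_3)
  have s01: "cmod (sgn4 j x) \<le> 2 * b j" if "j < 2" for j
  proof -
    have "\<bar>form j x\<bar> \<le> b j" "\<bar>form (j + 2) x\<bar> \<le> b (j + 2)" using f[of j] f[of "j+2"] that by simp_all
    moreover have "j = 0 \<or> j = 1" using that by linarith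
    then have "b (j + 2) = b j" using bb by auto
    ultimately have "\<bar>Re (sgn4 j x)\<bar> \<le> b j" "\<bar>Im (sgn4 j x)\<bar> \<le> b j" using that False by (auto simp: form_def)
    then show ?thesis using cmod_le[of "sgn4 j x"] by linarith
  qed
  show ?thesis
  proof (cases "i < 2")
    case True then show ?thesis using s01 by blast
  next
    case F: False
    define j where "j = i - 2"
    have j: "i = j + 2" "j < 2" using F i by (simp_all add: j_def)
    have "sgn4 i x = sg (sg (sgn4 j x))" unfolding j by (simp add: numeral_2_eq_2)
    also have "\<dots> = cnj (sgn4 j x)" by (rule imag_case[OF R sgn4_Oth[OF x]])
    finally have "sgn4 i x = cnj (sgn4 j x)" .
    then have "cmod (sgn4 i x) \<le> 2 * b j" using s01[OF j(2)] by simp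
    moreover have "j = 0 \<or> j = 1" using j by linarith
    then have "b i = b j" using bb j by auto
    ultimately show ?thesis by simp
  qed
qed

text \<open>Each application of \<open>sg4\<close> at most doubles the coordinates, because of the
  entry \<open>p - q\<close>; three of them give the factor 8 in \<open>LL\<close>.\<close>

lemma ev_bound:
  assumes "\<bar>p\<bar> \<le> B" "\<bar>q\<bar> \<le> B" "\<bar>p'\<bar> \<le> B" "\<bar>q'\<bar> \<le> B"
  shows "cmod (sgn4 i (ev (p,q,p',q'))) \<le> 2^i * ((1 + \<bar>T\<bar>) * (1 + cmod \<theta>)) * of_int B"
  using assms
proof (induction i arbitrary: p q p' q' B)
  case 0
  have l: "cmod (of_int p + of_int q * \<tau>) \<le> of_int B * (1 + \<bar>T\<bar>)" if "\<bar>p\<bar> \<le> B" "\<bar>q\<bar> \<le> B" for p q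
  proof -
    have "cmod (of_int p + of_int q * \<tau>) \<le> of_int \<bar>p\<bar> + of_int \<bar>q\<bar> * \<bar>T\<bar>"
      using norm_triangle_ineq[of "of_int p :: complex" "of_int q * \<tau>"] by (simp add: norm_mult)
    also have "\<dots> \<le> of_int B + of_int B * \<bar>T\<bar>"
    proof -
      have "(of_int \<bar>p\<bar> :: real) \<le> of_int B" "(of_int \<bar>q\<bar> :: real) \<le> of_int B" using that by (simp_all only: of_int_le_iff)
      then show ?thesis by (intro add_mono mult_right_mono) auto
    qed
    finally show ?thesis by (simp add: algebra_simps)
  qed
  have "cmod (ev (p,q,p',q')) \<le> cmod (of_int p + of_int q * \<tau>) + cmod (of_int p' + of_int q' * \<tau>) * cmod \<theta>"
    unfolding ev.simps using norm_triangle_ineq norm_mult by metis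
  also have "\<dots> \<le> of_int B * (1 + \<bar>T\<bar>) + of_int B * (1 + \<bar>T\<bar>) * cmod \<theta>"
    using l[of p q] l[of p' q'] 0 by (intro add_mono mult_right_mono) auto
  finally show ?case by (simp add: algebra_simps)
next
  case (Suc i)
  have "sgn4 (Suc i) (ev (p,q,p',q')) = sgn4 i (sg (ev (p,q,p',q')))" by (simp add: sgn4_def funpow_swap1)
  also have "\<dots> = sgn4 i (ev (p-q,-q,-q',p'))" by (simp add: sg_ev del: ev.simps)
  finally have e: "sgn4 (Suc i) (ev (p,q,p',q')) = sgn4 i (ev (p-q,-q,-q',p'))" .
  have "cmod (sgn4 i (ev (p-q,-q,-q',p'))) \<le> 2^i * ((1 + \<bar>T\<bar>) * (1 + cmod \<theta>)) * of_int (2 * B)"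
    using Suc.prems by (intro Suc.IH) linarith+
  then show ?case unfolding e by (simp add: algebra_simps)
qed

definition LL :: real where "LL = 8 * ((1 + \<bar>T\<bar>) * (1 + cmod \<theta>))"

lemma LL_pos: "LL > 0" unfolding LL_def by (intro mult_pos_pos) (auto intro: add_pos_nonneg)

lemma form_bound:
  assumes "i < 4" "p \<in> {0..int N}" "q \<in> {0..int N}" "p' \<in> {0..int N}" "q' \<in> {0..int N}"
  shows "\<bar>form i (ev (p,q,p',q'))\<bar> \<le> LL * real N"
proof -
  define j where "j = (if Im \<theta> = 0 \<or> i < 2 then i else i - 2)"
  have "j \<le> i" by (simp add: j_def)
  then have "j \<le> 3" using assms(1) by linarith
  then have "(2::real)^j \<le> 2^3" by (intro power_increasing) auto
  then have "2^j * ((1 + \<bar>T\<bar>) * (1 + cmod \<theta>)) * real N \<le> 8 * ((1 + \<bar>T\<bar>) * (1 + cmod \<theta>)) * real N"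
    by (intro mult_right_mono) auto
  moreover have "cmod (sgn4 j (ev (p,q,p',q'))) \<le> 2^j * ((1 + \<bar>T\<bar>) * (1 + cmod \<theta>)) * of_int (int N)"
    using assms by (intro ev_bound) auto
  moreover have "\<bar>form i (ev (p,q,p',q'))\<bar> \<le> cmod (sgn4 j (ev (p,q,p',q')))" unfolding j_def by (rule form_le)
  ultimately show ?thesis unfolding LL_def by simp
qed

definition bounded_int :: "real \<Rightarrow> complex set" where
  "bounded_int C = {w \<in> Oth. \<forall>i<4. cmod (sgn4 i w) \<le> C}"

text \<open>Sums and differences of conjugates under the double conjugation separate
  \<open>p + q*\<tau>\<close> from the multiple of \<theta>. Each half and its conjugate then bound
  a positive definite quadratic form in its two integer coordinates.\<close>

lemma finite_bounded_int: "finite (bounded_int C)"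
proof -
  obtain k :: nat where k: "2 * \<bar>C\<bar> + 2 * (\<bar>C\<bar> / cmod \<theta>) \<le> real k" using real_arch_simple by blast
  define I where "I = {- int k .. int k}"
  have "bounded_int C \<subseteq> ev ` (I \<times> I \<times> I \<times> I)"
  proof
    fix w assume "w \<in> bounded_int C"
    then have w: "w \<in> Oth" and al: "\<And>i. i < 4 \<Longrightarrow> cmod (sgn4 i w) \<le> C"
      by (auto simp: bounded_int_def)
    obtain p q p' q' where e: "w = ev (p, q, p', q')" using w by (rule Oth_cases)
    have c: "cmod (ev (p,q,p',q')) \<le> C" "cmod (ev (p-q,-q,-q',p')) \<le> C" "cmod (ev (p,q,-p',-q')) \<le> C" "cmod (ev (p-q,-q,q',-p')) \<le> C"
      using al[of 0] al[of 1] al[of 2] al[of 3] unfolding e by (simp_all add: numeral_3_eq_3 numeral_2_eq_2 sg_ev del: ev.simps)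
    have C0: "C \<ge> 0" using c(1) norm_ge_zero[of "ev (p,q,p',q')"] by linarith
    have hs: "cmod x \<le> C" if "cmod y \<le> C" "cmod z \<le> C" "2 * x = y + z" for x y z :: complex
    proof -
      have "2 * cmod x = cmod (y + z)" using that(3) by (metis norm_mult norm_numeral)
      also have "\<dots> \<le> cmod y + cmod z" by (rule norm_triangle_ineq)
      finally show ?thesis using that by linarith
    qed
    have hd: "cmod x \<le> C" if "cmod y \<le> C" "cmod z \<le> C" "2 * x = y - z" for x y z :: complex
      using hs[of y "- z" x] that by simp
    have A: "cmod (of_int p + of_int q * \<tau>) \<le> C" by (rule hs[OF c(1) c(3)]) (simp add: algebra_simps)
    have A': "cmod (of_int (p-q) - of_int q * \<tau>) \<le> C" by (rule hs[OF c(2) c(4)]) (simp add: algebra_simps)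
    have B: "cmod ((of_int p' + of_int q' * \<tau>) * \<theta>) \<le> C" by (rule hd[OF c(1) c(3)]) (simp add: algebra_simps)
    have B': "cmod ((- of_int q' + of_int p' * \<tau>) * \<theta>) \<le> C" by (rule hd[OF c(2) c(4)]) (simp add: algebra_simps)
    define x x' where "x = of_int p + of_int q * T" and "x' = of_int (p - q) - of_int q * T"
    have ax: "\<bar>x\<bar> \<le> C" "\<bar>x'\<bar> \<le> C"
    proof -
      have "of_int p + of_int q * \<tau> = of_real x" "of_int (p-q) - of_int q * \<tau> = of_real x'" by (simp_all add: x_def x'_def)
      then show "\<bar>x\<bar> \<le> C" "\<bar>x'\<bar> \<le> C" using A A' by (metis norm_of_real)+
    qed
    have xx: "2 * (x^2 + x'^2) = 5 * (of_int q)^2 + (of_int (2*p - q))^2" unfolding x_def x'_def using T2 by (simp add: of_int_diff) algebra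
    have "x^2 \<le> C^2" "x'^2 \<le> C^2" using ax C0 by (metis abs_le_square_iff abs_of_nonneg)+
    then have "x^2 + x'^2 \<le> C^2 + C^2" by (rule add_mono)
    then have "2 * (x^2 + x'^2) \<le> 4 * C^2" by simp
    then have "5 * (of_int q)^2 + (of_int (2*p - q))^2 \<le> 4 * C^2" unfolding xx .
    moreover have "A \<le> D \<and> B \<le> 4 * D" if "5 * A + B \<le> 4 * D" "A \<ge> 0" "B \<ge> 0" for A B D :: real
      using that by linarith
    ultimately have "(of_int q)^2 \<le> C^2 \<and> (of_int (2*p - q))^2 \<le> 4 * C^2"
      using zero_le_power2 by blast
    then have "(of_int q)^2 \<le> C^2" "(of_int (2*p - q))^2 \<le> (2*C)^2" by (simp_all add: power_mult_distrib)
    then have qb: "\<bar>of_int q\<bar> \<le> C" "\<bar>of_int (2*p - q)\<bar> \<le> 2*C" using C0 by (metis abs_le_square_iff abs_of_nonneg mult_nonneg_nonneg zero_le_numeral)+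
    then have pb: "\<bar>of_int p\<bar> \<le> 2 * C" by simp
    define D where "D = C / cmod \<theta>"
    have D0': "D \<ge> 0" using C0 by (simp add: D_def)
    define y y' where "y = of_int p' + of_int q' * T" and "y' = - of_int q' + of_int p' * T"
    have ay: "\<bar>y\<bar> \<le> D" "\<bar>y'\<bar> \<le> D"
    proof -
      have "of_int p' + of_int q' * \<tau> = of_real y" "- of_int q' + of_int p' * \<tau> = of_real y'" by (simp_all add: y_def y'_def)
      then have "\<bar>y\<bar> * cmod \<theta> \<le> C" "\<bar>y'\<bar> * cmod \<theta> \<le> C" using B B' by (simp_all add: norm_mult)
      then show "\<bar>y\<bar> \<le> D" "\<bar>y'\<bar> \<le> D" unfolding D_def using th_nz by (simp_all add: pos_le_divide_eq)
    qed
    have yy: "y^2 + y'^2 = (1 + T^2) * ((of_int p')^2 + (of_int q')^2)" unfolding y_def y'_def by algebra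
    have "y^2 \<le> D^2" "y'^2 \<le> D^2" using ay D0' by (metis abs_le_square_iff abs_of_nonneg)+
    then have "(1 + T^2) * ((of_int p')^2 + (of_int q')^2) \<le> 2 * D^2" using yy by linarith
    moreover have "1 * ((of_int p')^2 + (of_int q')^2) \<le> (1 + T^2) * ((of_int p')^2 + (of_int q' :: real)^2)"
      by (intro mult_right_mono) auto
    ultimately have "(of_int p')^2 + (of_int q')^2 \<le> 2 * D^2" unfolding mult_1_left by (rule order_trans[rotated])
    moreover have "A \<le> 4 * D \<and> B \<le> 4 * D" if "A + B \<le> 2 * D" "A \<ge> 0" "B \<ge> 0" for A B D :: real
      using that by linarith
    ultimately have "(of_int p')^2 \<le> 4 * D^2 \<and> (of_int q')^2 \<le> 4 * D^2"
      using zero_le_power2 by blast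
    then have "(of_int p')^2 \<le> (2*D)^2" "(of_int q')^2 \<le> (2*D)^2" by (simp_all add: power_mult_distrib)
    then have pb': "\<bar>of_int p'\<bar> \<le> 2*D" "\<bar>of_int q'\<bar> \<le> 2*D"
      using D0' by (metis abs_le_square_iff abs_of_nonneg mult_nonneg_nonneg zero_le_numeral)+
    have kk: "2 * C + 2 * D \<le> real k" using k C0 by (simp add: D_def)
    have inI: "m \<in> I" if "\<bar>of_int m\<bar> \<le> 2 * C + 2 * D" for m
    proof -
      have "of_int \<bar>m\<bar> \<le> (of_int (int k) :: real)" using that kk by simp
      then have "\<bar>m\<bar> \<le> int k" by (simp only: of_int_le_iff)
      then show ?thesis by (auto simp: I_def)
    qed
    have "p \<in> I" "q \<in> I" "p' \<in> I" "q' \<in> I" using pb qb(1) pb' C0 D0' by (auto intro!: inI)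
    then show "w \<in> ev ` (I \<times> I \<times> I \<times> I)" unfolding e by blast
  qed
  then show ?thesis by (rule finite_subset) (simp add: I_def)
qed

text \<open>In the binomial expansion every term contains \<open>G'\<close>, the leading one because
  \<open>M^5 = G * G'\<close>.\<close>

lemma fifth_power_in_ideal:
  assumes "u \<in> Oth" "v \<in> Oth" "M \<in> Oth" "G \<in> Oth" "G' \<in> Oth" and "G * G' = M^5"
  shows "\<exists>w\<in>Oth. (u * M + v * G')^5 = G' * w"
proof -
  define w where "w = u^5 * G + (5 * u^4 * M^4 * v + 10 * u^3 * M^3 * v^2 * G' + 10 * u^2 * M^2 * v^3 * G'^2
    + 5 * u * M * v^4 * G'^3 + v^5 * G'^4)"
  have "w \<in> Oth" unfolding w_def by (intro Oth_cl assms)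
  moreover have "(u * M + v * G')^5 = G' * w" unfolding w_def using assms(6) by algebra
  ultimately show ?thesis by blast
qed

lemma sg2_fixed:
  assumes "M \<in> Oth" "sg (sg M) = M"
  obtains m0 m1 where "M = ev (m0, m1, 0, 0)" "M * sg M = of_int (m0^2 - m0*m1 - m1^2)"
proof -
  obtain p q p' q' where M: "M = ev (p, q, p', q')" using assms(1) by (rule Oth_cases)
  have "ev (p,q,-p',-q') = ev (p,q,p',q')" using assms(2) unfolding M sg2_ev .
  then have "(p,q,-p',-q') = (p,q,p',q')" using inj_ev by (rule injD[rotated])
  then have M': "M = ev (p, q, 0, 0)" unfolding M by simp
  have "M * sg M = of_int (p^2 - p*q - q^2)"
  proof -
    have "sg M = ev (p - q, - q, 0, 0)" unfolding M' sg_ev by (simp del: ev.simps)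
    then show ?thesis unfolding M' using tau2 by simp algebra
  qed
  then show ?thesis using that M' by blast
qed

text \<open>Up to divisors of \<open>\<kappa>\<close>, \<open>(G')\<close> is the fifth power of
  \<open>(M, G')\<close>. A box with sides proportional to the fifth roots of the conjugates of
  \<open>G'\<close> is just large enough for two points whose difference times
  \<open>\<kappa>\<close> is an \<open>e\<close> in \<open>(M, G')\<close>. Then
  \<open>w = e^5 / G'\<close> is integral, and the shape of the box cancels in its
  conjugates.\<close>

lemma bounded_representative:
  fixes \<kappa> :: int
  assumes O: "G \<in> Oth" "M \<in> Oth" "\<alpha> \<in> Oth" "\<beta> \<in> Oth" "\<gamma> \<in> Oth"
    and M0: "M \<noteq> 0" and MM: "sg (sg M) = M" and GG: "G * sg (sg G) = M^5"
    and kap: "of_int \<kappa> = \<alpha> * G + \<beta> * sg (sg G) + \<gamma> * M" and k0: "\<kappa> \<noteq> 0"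
  shows "\<exists>w\<in>bounded_int ((real_of_int \<bar>\<kappa>\<bar> * (2 * (5 * LL)))^5). \<exists>e\<in>Oth. e \<noteq> 0 \<and> G * e^5 = w * M^5"
proof -
  define G' where "G' = sg (sg G)"
  have G': "G' \<in> Oth" unfolding G'_def by (intro Oth_cl O)
  obtain m0 m1 where nM: "M * sg M = of_int (m0^2 - m0*m1 - m1^2)" using sg2_fixed[OF O(2) MM] by metis
  define n where "n = m0^2 - m0*m1 - m1^2"
  have GG': "G * G' = M^5" using GG by (simp add: G'_def)
  have G'0: "G' \<noteq> 0" using GG' M0 by auto
  define g where "g = (\<lambda>i. cmod (sgn4 i G'))"
  define b where "b = (\<lambda>i. 5 * LL * root 5 (g i))"
  have gpos: "g i > 0" for i unfolding g_def using sgn4_nz[OF G' G'0] by simp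
  have bpos: "b i > 0" for i unfolding b_def using gpos LL_pos by simp
  \<comment> \<open>\<open>G\<close> and \<open>G'\<close> are conjugate with product
    \<open>M^5\<close>, so the norm of \<open>G'\<close> is the fifth power of \<open>n\<close>;
    taking fifth roots matches the volume condition.\<close>
  have gprod: "(\<Prod>i<4. g i) = \<bar>of_int n\<bar>^5"
  proof -
    have "sgn4 2 G' = G" unfolding G'_def using sg4_id[OF O(1)] by (simp add: numeral_2_eq_2)
    then have "sgn4 3 G' = sg G" by (simp add: numeral_3_eq_3 numeral_2_eq_2)
    have "(\<Prod>i<4. g i) = g 0 * g 1 * g 2 * g 3" by (simp add: eval_nat_numeral)
    also have "\<dots> = cmod G' * cmod (sg G') * cmod G * cmod (sg G)"
      unfolding g_def using \<open>sgn4 2 G' = G\<close> \<open>sgn4 3 G' = sg G\<close> by simp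
    also have "\<dots> = cmod ((G * G') * sg (G * G'))" using Oth_mult(2)[OF O(1) G'] by (simp add: norm_mult)
    also have "\<dots> = cmod ((M * sg M)^5)" unfolding GG' using Oth_power(2)[OF O(2)] by (simp add: power_mult_distrib)
    also have "\<dots> = \<bar>of_int n\<bar>^5" unfolding nM n_def[symmetric] by (simp add: norm_power)
    finally show ?thesis .
  qed
  have bprod: "(\<Prod>i<4. b i) = (5 * LL)^4 * \<bar>of_int n\<bar>"
  proof -
    have "(\<Prod>i<4. b i) = (5 * LL)^4 * (root 5 (g 0) * root 5 (g 1) * root 5 (g 2) * root 5 (g 3))"
      unfolding b_def by (simp add: eval_nat_numeral)
    also have "root 5 (g 0) * root 5 (g 1) * root 5 (g 2) * root 5 (g 3) = root 5 (\<Prod>i<4. g i)"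
      by (simp add: eval_nat_numeral real_root_mult)
    also have "\<dots> = \<bar>of_int n\<bar>" unfolding gprod by (simp add: real_root_power_cancel)
    finally show ?thesis .
  qed
  obtain S4 where S4: "finite S4" "real (card S4) > \<bar>of_int n\<bar>"
    "\<And>c c' i. c \<in> S4 \<Longrightarrow> c' \<in> S4 \<Longrightarrow> i < 4 \<Longrightarrow> \<bar>form i (ev c) - form i (ev c')\<bar> \<le> b i"
    using crowded_cell[of LL "\<bar>of_int n\<bar>" b "\<lambda>i c. form i (ev c)"] LL_pos bpos form_bound bprod
    by (auto simp del: ev.simps)
  define S where "S = ev ` S4"
  have ctr_sum: "card S = card S4" unfolding S_def by (intro card_image inj_on_subset[OF inj_ev]) simp
  have "real (nat \<bar>n\<bar>) < real (card S)" using S4(2) ctr_sum by simp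
  then have cS': "nat \<bar>n\<bar> < card S" by (simp only: of_nat_less_iff)
  have SO: "finite S" "S \<subseteq> Oth" using S4(1) Oth_ev unfolding S_def by auto
  obtain x x' where x: "x \<in> S" "x' \<in> S" "x \<noteq> x'" "of_int \<kappa> * (x - x') \<in> two_gen M G'"
    using congruent_pair[OF O M0 MM nM[folded n_def] kap SO cS'] unfolding G'_def by blast
  have xO: "x \<in> Oth" "x' \<in> Oth" using x SO by auto
  define e0 where "e0 = x - x'"
  have e0: "e0 \<in> Oth" "e0 \<noteq> 0" unfolding e0_def using xO x(3) by (auto intro: Oth_cl)
  have fm: "\<bar>form i e0\<bar> \<le> b i" if "i < 4" for i
    unfolding e0_def form_diff[OF xO] using x(1,2) S4(3) that unfolding S_def by (auto simp del: ev.simps)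
  have bsym: "b 2 = b 0 \<and> b 3 = b 1" if "Im \<theta> \<noteq> 0"
  proof -
    have R: "Re \<theta> = 0" using that th_real_or_imag by blast
    have "sgn4 2 G' = cnj G'" using imag_case[OF R G'] by (simp add: numeral_2_eq_2)
    moreover have "sgn4 3 G' = cnj (sg G')" using imag_case[OF R sg_Oth[OF G']] by (simp add: numeral_3_eq_3)
    ultimately show ?thesis unfolding b_def g_def by simp
  qed
  have small: "cmod (sgn4 i e0) \<le> 2 * b i" if "i < 4" for i
    by (rule small_of_forms[OF e0(1) fm bsym that])
  define e where "e = of_int \<kappa> * e0"
  have e: "e \<in> Oth" "e \<noteq> 0" unfolding e_def using e0 k0 by (auto intro: Oth_cl)
  obtain u v where uv: "u \<in> Oth" "v \<in> Oth" "e = u * M + v * G'"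
    using x(4) unfolding e_def e0_def two_gen_def by blast
  obtain w where w: "w \<in> Oth" "e^5 = G' * w"
    using fifth_power_in_ideal[OF uv(1,2) O(2,1) G' GG'] uv(3) by blast
  have "cmod (sgn4 i w) \<le> (real_of_int \<bar>\<kappa>\<bar> * (2 * (5 * LL)))^5" if i: "i < 4" for i
  proof -
    have "sgn4 i e ^ 5 = sgn4 i G' * sgn4 i w"
      using w e G' by (metis sgn4_hom(2,3))
    then have eq: "cmod (sgn4 i e) ^ 5 = g i * cmod (sgn4 i w)" unfolding g_def by (metis norm_mult norm_power)
    have "cmod (sgn4 i e) \<le> real_of_int \<bar>\<kappa>\<bar> * (2 * b i)"
    proof -
      have "sgn4 i e = of_int \<kappa> * sgn4 i e0" unfolding e_def using sgn4_hom(2)[OF Oth_int(1) e0(1)] sgn4_int by simp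
      then have "cmod (sgn4 i e) = real_of_int \<bar>\<kappa>\<bar> * cmod (sgn4 i e0)" by (simp add: norm_mult)
      then show ?thesis using small[OF i] by (simp add: mult_left_mono)
    qed
    then have "cmod (sgn4 i e) ^ 5 \<le> (real_of_int \<bar>\<kappa>\<bar> * (2 * b i))^5" by (intro power_mono) auto
    also have "\<dots> = (real_of_int \<bar>\<kappa>\<bar> * (2 * (5 * LL)))^5 * (root 5 (g i))^5"
      unfolding b_def by (simp add: power_mult_distrib)
    also have "(root 5 (g i))^5 = g i" using gpos[of i] by (simp add: real_root_pow_pos2)
    finally have "g i * cmod (sgn4 i w) \<le> g i * (real_of_int \<bar>\<kappa>\<bar> * (2 * (5 * LL)))^5"
      unfolding eq by (simp only: mult.commute)
    then show ?thesis using gpos[of i] by (simp only: mult_le_cancel_left_pos)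
  qed
  then have "w \<in> bounded_int ((real_of_int \<bar>\<kappa>\<bar> * (2 * (5 * LL)))^5)" unfolding bounded_int_def using w(1) by blast
  moreover have "G * e^5 = w * M^5" unfolding w(2) GG'[symmetric] by algebra
  ultimately show ?thesis using e by blast
qed

end

section \<open>Finiteness of the set of Kummer classes\<close>

lemma integral_point:
  fixes A B C :: int and x y :: rat
  assumes eq: "y^2 = x^3 + of_int A * x^2 + of_int B * x + of_int C"
  obtains m n e :: int where "e > 0" "coprime m e" "x = of_int m / (of_int e)^2" "y = of_int n / (of_int e)^3"
proof -
  obtain p q where pq: "quotient_of x = (p, q)" by fastforce
  then have q: "q > 0" "coprime p q" and xe: "x = of_int p / of_int q"
    using quotient_of_denom_pos quotient_of_coprime quotient_of_div by blast+
  obtain r s where rs: "quotient_of y = (r, s)" by fastforce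
  then have s: "s > 0" "coprime r s" and ye: "y = of_int r / of_int s"
    using quotient_of_denom_pos quotient_of_coprime quotient_of_div by blast+
  define F where "F = p^3 + A * p^2 * q + B * p * q^2 + C * q^3"
  have "(of_int r)^2 * (of_int q)^3 = (of_int s)^2 * (of_int F :: rat)"
    using eq q(1) s(1) unfolding xe ye F_def by (simp add: field_simps power2_eq_square power3_eq_cube)
  then have "of_int (r^2 * q^3) = (of_int (s^2 * F) :: rat)" by simp
  then have e: "r^2 * q^3 = s^2 * F" by (simp only: of_int_eq_iff)
  \<comment> \<open>Modulo \<open>q\<close> only \<open>p^3\<close> is left of \<open>F\<close>, so
    \<open>q^3\<close> and \<open>s^2\<close> divide each other. From \<open>q^3 = s^2\<close> it
    follows that \<open>q\<close> is a square and \<open>s\<close> a cube.\<close>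
  have "F = p^3 + q * (A * p^2 + B * p * q + C * q^2)" unfolding F_def by algebra
  then have "coprime F q" using q(2) by (metis coprime_power_left_iff coprime_def dvd_add_left_iff dvd_mult2)
  then have cF: "coprime (q^3) F" by (simp add: coprime_commute)
  have "q^3 dvd s^2" using e cF by (metis coprime_dvd_mult_left_iff dvd_triv_right)
  moreover have "s^2 dvd q^3"
  proof -
    have "coprime (s^2) (r^2)" using s(2) by (simp add: coprime_commute)
    then show ?thesis using e by (metis coprime_dvd_mult_right_iff dvd_triv_left)
  qed
  ultimately have sq: "s^2 = q^3" using q(1) s(1) by (simp add: zdvd_antisym_nonneg)
  then have "q^2 dvd s^2" by (simp add: power3_eq_cube power2_eq_square)
  then have "q dvd s" by (simp add: pow_divides_pow_iff)
  then obtain f where f: "s = q * f" by (auto elim: dvdE)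
  have f0: "f > 0" using f s(1) q(1) by (simp add: zero_less_mult_iff)
  have "q^2 * f^2 = q^2 * q" using sq f by (simp add: power_mult_distrib power3_eq_cube power2_eq_square)
  then have qf: "q = f^2" using q(1) by simp
  then have sf3: "s = f^3" using f by (simp add: power3_eq_cube power2_eq_square)
  have "coprime p f" using q(2) qf by simp
  then show ?thesis using that[of f p r] f0 xe ye qf sf3 by simp
qed

lemma common_denominator:
  assumes "finite X" "X \<subseteq> {of_rat p + of_rat q * w | p q. True}"
  shows "\<exists>K::int. K > 0 \<and> (\<forall>x\<in>X. \<exists>p q::int. of_int K * x = of_int p + of_int q * (w::complex))"
  using assms
proof (induction X rule: finite_induct)
  case empty
  show ?case by (intro exI[of _ 1]) simp
next
  case (insert x X)
  then obtain K where K: "K > 0" "\<forall>x\<in>X. \<exists>p q::int. of_int K * x = of_int p + of_int q * w" by auto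
  obtain p q where x: "x = of_rat p + of_rat q * w" using insert.prems by auto
  obtain p1 p2 where p: "quotient_of p = (p1, p2)" by fastforce
  then have p': "p2 > 0" "p = of_int p1 / of_int p2" using quotient_of_denom_pos quotient_of_div by blast+
  obtain q1 q2 where q: "quotient_of q = (q1, q2)" by fastforce
  then have q': "q2 > 0" "q = of_int q1 / of_int q2" using quotient_of_denom_pos quotient_of_div by blast+
  define L where "L = K * (p2 * q2)"
  have "L > 0" unfolding L_def using K p' q' by simp
  moreover have "of_int L * x = of_int (K * q2 * p1) + of_int (K * p2 * q1) * w"
    unfolding x L_def p'(2) q'(2) using p'(1) q'(1) by (simp add: of_rat_divide field_simps)
  moreover have "\<exists>p q::int. of_int L * x' = of_int p + of_int q * w" if xX: "x' \<in> X" for x'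
  proof -
    obtain p q :: int where "of_int K * x' = of_int p + of_int q * w" using K(2) xX by blast
    moreover have "of_int L * x' = of_int (p2 * q2) * (of_int K * x')" unfolding L_def by (simp add: algebra_simps)
    ultimately have "of_int L * x' = of_int (p2 * q2) * (of_int p + of_int q * w)" by simp
    also have "\<dots> = of_int (p2 * q2 * p) + of_int (p2 * q2 * q) * w" by (simp add: algebra_simps)
    finally show ?thesis by blast
  qed
  ultimately show ?case by (intro exI[of _ L]) blast
qed

text \<open>The exponents 2, 4, 6 are the weights under which scaling by \<open>k\<close> makes a
  Weierstrass equation integral.\<close>

lemma rat_common_denominator:
  fixes A B C :: rat
  obtains k a' b' c' :: int where "k > 0" "of_int k^2 * A = of_int a'" "of_int k^4 * B = of_int b'" "of_int k^6 * C = of_int c'"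
proof -
  obtain a1 a2 where a: "quotient_of A = (a1, a2)" by fastforce
  then have a': "a2 > 0" "A = of_int a1 / of_int a2" using quotient_of_denom_pos quotient_of_div by blast+
  obtain b1 b2 where b: "quotient_of B = (b1, b2)" by fastforce
  then have b': "b2 > 0" "B = of_int b1 / of_int b2" using quotient_of_denom_pos quotient_of_div by blast+
  obtain c1 c2 where c: "quotient_of C = (c1, c2)" by fastforce
  then have c': "c2 > 0" "C = of_int c1 / of_int c2" using quotient_of_denom_pos quotient_of_div by blast+
  define k where "k = a2 * b2 * c2"
  show ?thesis
  proof (rule that[of k])
    show "k > 0" using a' b' c' by (simp add: k_def)
    show "of_int k^2 * A = of_int (k * (b2 * c2) * a1)" unfolding a'(2) k_def using a'(1) by (simp add: power2_eq_square)
    show "of_int k^4 * B = of_int (k^3 * (a2 * c2) * b1)" unfolding b'(2) k_def using b'(1)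
      by (simp add: power4_eq_xxxx power3_eq_cube)
    show "of_int k^6 * C = of_int (k^5 * (a2 * b2) * c1)" unfolding c'(2) k_def using c'(1)
      by (simp add: eval_nat_numeral)
  qed
qed

context brumer
begin

lemma tau_real: "\<exists>T::real. \<tau> = of_real T \<and> T^2 = 1 - T"
proof -
  have "(2 * \<tau> + 1)^2 = (of_real (sqrt 5))^2" using t2 by (simp flip: of_real_power) algebra
  then have "2 * \<tau> + 1 = of_real (sqrt 5) \<or> 2 * \<tau> + 1 = - of_real (sqrt 5)" by (simp only: power2_eq_iff)
  then have "\<exists>S::real. 2 * \<tau> + 1 = of_real S" by (metis of_real_minus)
  then obtain S :: real where S: "2 * \<tau> + 1 = of_real S" by blast
  have e: "\<tau> = of_real ((S - 1) / 2)"
  proof -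
    have "2 * \<tau> = of_real S - 1" using S by (simp add: eq_diff_eq)
    then have "2 * \<tau> = 2 * of_real ((S - 1) / 2)" by simp
    then show ?thesis by (rule two_cancel)
  qed
  have "complex_of_real (((S - 1) / 2)^2) = of_real (1 - (S - 1) / 2)" using t2 unfolding e of_real_power of_real_diff of_real_1 .
  then have "((S - 1) / 2)^2 = 1 - (S - 1) / 2" by (simp only: of_real_eq_iff)
  with e show ?thesis by blast
qed

lemma kcoeffs_nz: "kgam \<tau> ca \<noteq> 0" "kdel \<tau> ca \<noteq> 0"
proof -
  show g: "kgam \<tau> ca \<noteq> 0"
  proof
    assume "kgam \<tau> ca = 0"
    then have "of_rat (1 - 2*a) + of_rat (- 2 - a) * \<tau> = 0"
      unfolding kgam_def by (simp add: of_rat_diff of_rat_mult of_rat_minus algebra_simps)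
    from tau_indep[OF t2 this] show False by auto
  qed
  have "kgam \<tau> ca - kell \<tau> ca \<noteq> 0"
  proof
    assume "kgam \<tau> ca - kell \<tau> ca = 0"
    then have "of_rat (- 2 - a) + of_rat (2*a - 1) * \<tau> = 0"
      unfolding kgam_def kell_def by (simp add: of_rat_diff of_rat_mult of_rat_minus algebra_simps)
    from tau_indep[OF t2 this] show False by auto
  qed
  with g show "kdel \<tau> ca \<noteq> 0" unfolding kdel_def by simp
qed

text \<open>For \<open>x = m/e\<^sup>2\<close>, \<open>y = n/e\<^sup>3\<close> the numbers \<open>G\<close> and \<open>M\<close> are \<open>g(P)\<close> and \<open>kz\<close> cleared of denominators; \<open>\<kappa>\<close> bounds
  the common divisors of \<open>G\<close>, its conjugate and \<open>M\<close> uniformly in \<open>P\<close>.\<close>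

lemma finite_classes:
  "\<exists>W. finite W \<and> (\<forall>P\<in>carrier E. \<exists>w\<in>W. same_class (gP P) w)"
proof -
  obtain T where T: "\<tau> = of_real T" "T^2 = 1 - T" using tau_real by blast
  obtain d1 d2 where dq: "quotient_of d = (d1, d2)" by fastforce
  then have d2: "d2 > 0" "d = of_int d1 / of_int d2" using quotient_of_denom_pos quotient_of_div by blast+
  define D0 where "D0 = d1 * d2"
  \<comment> \<open>The ordinate enters \<open>g\<close> only multiplied by \<open>s * r\<close>, so
    the values of \<open>g\<close> lie in Q(\<theta>). The factor \<open>d2\<close> makes the square
    of \<theta> integral, as \<open>d2^2 * d = d1 * d2\<close>.\<close>
  define \<theta> where "\<theta> = of_int d2 * (s * r)"
  have D00: "D0 \<noteq> 0" using d2 d0 unfolding D0_def by auto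
  have th2: "\<theta>^2 = - of_int D0 * (3 + of_real T)"
  proof -
    have "of_int d2^2 * of_rat d = (of_int D0 :: complex)"
      unfolding D0_def d2(2) using d2(1) by (simp add: of_rat_divide power2_eq_square)
    then have e: "of_int d2^2 * r^2 = of_int D0" unfolding r2 .
    have "\<theta>^2 = s^2 * (of_int d2^2 * r^2)" unfolding \<theta>_def by algebra
    also have "\<dots> = - of_int D0 * (3 + \<tau>)" unfolding e s2 by algebra
    finally show ?thesis unfolding T(1) .
  qed
  interpret Q: quartic T \<theta> D0 using T(2) D00 th2 by unfold_locales
  note oc = Q.Oth_cl
  \<comment> \<open>The subring Z[\<tau>], described as the fixed elements of the double
    conjugation.\<close>
  define Zt where "Zt = {x \<in> Q.Oth. Q.sg (Q.sg x) = x}"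
  have ZtO: "x \<in> Q.Oth" if "x \<in> Zt" for x using that by (simp add: Zt_def)
  have Zadd: "x + y \<in> Zt" and Zdiff: "x - y \<in> Zt" and Zmult: "x * y \<in> Zt" if "x \<in> Zt" "y \<in> Zt" for x y
    using that unfolding Zt_def by (auto simp: Q.Oth_add Q.Oth_diff Q.Oth_mult Q.sg_Oth)
  have Zint: "of_int i \<in> Zt" for i unfolding Zt_def by (simp add: Q.Oth_int)
  have Znum: "numeral w \<in> Zt" for w using Zint[of "numeral w"] by simp
  have Z1: "1 \<in> Zt" using Zint[of 1] by simp
  have Zpow: "x ^ n \<in> Zt" if "x \<in> Zt" for x n using that by (induction n) (auto intro: Z1 Zmult)
  note Zc = Zadd Zdiff Zmult Zint Znum Zpow
  have OthN: "x \<in> N" if "x \<in> Q.Oth" for x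
  proof -
    have "of_real T \<in> N" using consts_N(2) T(1) by simp
    moreover have "\<theta> \<in> N" unfolding \<theta>_def by (intro sfD[OF sf_N] r_N zeta_N)
    ultimately show ?thesis using that unfolding Q.Oth_def by (auto intro!: sfD[OF sf_N])
  qed
  obtain k A' B' C' :: int where k: "k > 0" "of_int k^2 * EA2 a b = of_int A'" "of_int k^4 * EA4 a b = of_int B'"
      "of_int k^6 * EA6 a b = of_int C'"
    using rat_common_denominator by metis
  define kc where "kc = (of_int k :: complex)"
  define dc where "dc = (of_rat d :: complex)"
  have kd0: "kc \<noteq> 0" "dc \<noteq> 0" "(of_int d2 :: complex) \<noteq> 0" using k d0 d2 by (simp_all add: kc_def dc_def)
  define \<gamma> where "\<gamma> = kgam \<tau> ca"
  define l where "l = kell \<tau> ca"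
  define \<delta> where "\<delta> = kdel \<tau> ca"
  define \<alpha> where "\<alpha> = (\<tau> - 2) / (- 4 * dc * kc^2)"
  define \<beta> where "\<beta> = kz \<tau> ca 0"
  define \<eta> where "\<eta> = (1 - 3*\<tau>) / (4 * dc^2 * kc^3 * of_int d2)"
  \<comment> \<open>These coefficients do not depend on the point, so one integer \<open>K\<close>
    clears their denominators for all points.\<close>
  define X where "X = {\<alpha>, \<beta>, \<gamma>, \<gamma>^2, l, \<gamma> * \<delta>, \<gamma>^2 * l, \<gamma>^3 * \<delta>, \<eta>}"
  define Qt where "Qt = Adj rats (2 * \<tau> + 1)"
  have w5: "(2 * \<tau> + 1)^2 \<in> rats"
  proof -
    have "(2 * \<tau> + 1)^2 = 5" using t2 by algebra
    then show ?thesis using sf_numeral[OF sf_rats] by simp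
  qed
  have Qt: "sf Qt" unfolding Qt_def by (rule sf_Adj[OF sf_rats w5])
  have tQ: "\<tau> \<in> Qt"
  proof -
    have "2 * \<tau> + 1 \<in> Qt" unfolding Qt_def by (rule Adj_gen[OF sf_rats])
    then have "((2 * \<tau> + 1) - 1) / 2 \<in> Qt" by (intro sf_divide[OF Qt] sf_diff[OF Qt] sf_1[OF Qt] sf_numeral[OF Qt])
    then show ?thesis by (simp add: add_divide_distrib)
  qed
  have gQ: "\<gamma> \<in> Qt" "l \<in> Qt" "\<beta> \<in> Qt"
    unfolding \<gamma>_def l_def \<beta>_def kgam_def kell_def kz_def by (intro tQ sfD[OF Qt])+
  then have dQ: "\<delta> \<in> Qt" unfolding \<delta>_def kdel_def \<gamma>_def[symmetric] l_def[symmetric] by (intro sfD[OF Qt])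
  have "\<alpha> \<in> Qt" "\<eta> \<in> Qt" unfolding \<alpha>_def \<eta>_def kc_def dc_def by (intro tQ sfD[OF Qt])+
  then have "X \<subseteq> Qt" unfolding X_def using gQ dQ by (auto intro!: sfD[OF Qt])
  moreover have "Qt \<subseteq> {of_rat p + of_rat q * \<tau> | p q. True}"
  proof
    fix x assume "x \<in> Qt"
    then obtain p q where "x = of_rat p + of_rat q * (2 * \<tau> + 1)" unfolding Qt_def Adj_def rats_def by auto
    then have "x = of_rat (p + q) + of_rat (2 * q) * \<tau>" by (simp add: of_rat_add of_rat_mult algebra_simps)
    then show "x \<in> {of_rat p + of_rat q * \<tau> | p q. True}" by blast
  qed
  ultimately have "X \<subseteq> {of_rat p + of_rat q * \<tau> | p q. True}" by blast
  then obtain K :: int where K: "K > 0" "\<forall>x\<in>X. \<exists>p q::int. of_int K * x = of_int p + of_int q * \<tau>"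
    using common_denominator[of X \<tau>] unfolding X_def by auto
  define Kc where "Kc = (of_int K :: complex)"
  have Kc0: "Kc \<noteq> 0" using K by (simp add: Kc_def)
  have KX: "Kc * x \<in> Zt" if xX: "x \<in> X" for x
  proof -
    obtain p q :: int where "Kc * x = of_int p + of_int q * \<tau>" using K(2) xX unfolding Kc_def by blast
    then have "Kc * x = Q.ev (p, q, 0, 0)" using T(1) by simp
    moreover have "Q.ev (p, q, 0, 0) \<in> Zt" unfolding Zt_def using Q.sg2_ev[of p q 0 0] Q.Oth_ev[of "(p, q, 0, 0)"] by simp
    ultimately show ?thesis by simp
  qed
  have KZ: "Kc \<in> Zt" unfolding Kc_def by (rule Zint)
  define \<rho> where "\<rho> = 32 * Kc^4 * (Kc * (\<gamma>^3 * \<delta>))"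
  define A1 where "A1 = 4 * Kc * (Kc * \<alpha>)"
  define \<kappa>' where "\<kappa>' = \<rho> * A1^5"
  have rA: "\<rho> \<in> Zt" "A1 \<in> Zt" unfolding \<rho>_def A1_def by (intro Zc KZ KX; simp add: X_def)+
  then have kZ: "\<kappa>' \<in> Zt" unfolding \<kappa>'_def by (intro Zc)
  have tau2: "\<tau> \<noteq> 2"
  proof
    assume "\<tau> = 2"
    then show False using t2 by simp
  qed
  have k'0: "\<kappa>' \<noteq> 0"
    unfolding \<kappa>'_def \<rho>_def A1_def \<alpha>_def \<gamma>_def \<delta>_def using kcoeffs_nz kd0 Kc0 tau2 by simp
  obtain \<kappa> :: int where kap: "\<kappa>' * Q.sg \<kappa>' = of_int \<kappa>"
    using Q.sg2_fixed[of \<kappa>'] kZ unfolding Zt_def by blast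
  have k0: "\<kappa> \<noteq> 0" using kap k'0 Q.sg_0_iff[OF ZtO[OF kZ]] by auto
  define W where "W = Q.bounded_int ((real_of_int \<bar>\<kappa>\<bar> * (2 * (5 * Q.LL)))^5)"
  have main: "\<exists>w\<in>W. same_class (gP (Pt x y)) w" if P: "Pt x y \<in> carrier E" for x y
  proof -
    have "y^2 = x^3 + EA2 a b * x^2 + EA4 a b * x + EA6 a b" using P unfolding E_carrier on_curve_def by simp
    then have "(of_int k^3 * y)^2 = (of_int k^2 * x)^3 + (of_int k^2 * EA2 a b) * (of_int k^2 * x)^2
        + (of_int k^4 * EA4 a b) * (of_int k^2 * x) + of_int k^6 * EA6 a b"
      by algebra
    then obtain m n e :: int where e0: "e > 0" and cop: "coprime m e" and xm: "of_int k^2 * x = of_int m / (of_int e)^2"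
        and yn: "of_int k^3 * y = of_int n / (of_int e)^3"
      unfolding k(2-4) by (rule integral_point)
    define ec mc nc where "ec = (of_int e :: complex)" and "mc = (of_int m :: complex)" and "nc = (of_int n :: complex)"
    have ec0: "ec \<noteq> 0" using e0 by (simp add: ec_def)
    have eZ: "ec \<in> Zt" "mc \<in> Zt" "nc \<in> Zt" unfolding ec_def mc_def nc_def by (rule Zint)+
    define t where "t = (of_rat (xt x) :: complex)"
    define Y where "Y = r * of_rat (yw y)"
    have xc: "kc^2 * of_rat x * ec^2 = mc" and yc: "kc^3 * of_rat y * ec^3 = nc"
    proof -
      have "of_int k^2 * x * of_int e^2 = of_int m" "of_int k^3 * y * of_int e^3 = of_int n" using xm yn e0 by simp_all
      from this[THEN arg_cong[where f = "of_rat :: rat \<Rightarrow> complex"]]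
      show "kc^2 * of_rat x * ec^2 = mc" "kc^3 * of_rat y * ec^3 = nc"
        unfolding kc_def ec_def mc_def nc_def by (simp_all add: of_rat_mult of_rat_power)
    qed
    have tx: "t = of_rat x / (- 4 * dc)" unfolding t_def xt_def dc_def
      by (simp add: of_rat_divide of_rat_mult of_rat_minus)
    have Yy: "Y = r * (of_rat y / (4 * dc^2))" unfolding Y_def yw_def dc_def
      by (simp add: of_rat_divide of_rat_mult of_rat_power)
    define q where "q = \<alpha> * mc + \<beta> * ec^2"
    define z where "z = kz \<tau> ca t"
    have zq: "z * ec^2 = q"
    proof -
      have "\<alpha> * mc = (\<tau> - 2) * t * ec^2"
        unfolding \<alpha>_def xc[symmetric] tx using kd0 by (simp add: field_simps)
      moreover have "z = (\<tau> - 2) * t + \<beta>" unfolding z_def \<beta>_def kz_def by simp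
      ultimately show ?thesis unfolding q_def by algebra
    qed
    have cy: "ec^3 * ((1 - 3*\<tau>) * s * Y) = nc * (\<eta> * \<theta>)"
      unfolding \<eta>_def \<theta>_def yc[symmetric] Yy using kd0 by (simp add: field_simps)
    define A where "A = (q - \<gamma>^2 * ec^2) * (l * q + \<gamma> * \<delta> * ec^2) + 2 * \<gamma> * q^2"
    have gform: "2 * ec^5 * kg \<tau> s ca t Y' = ec * A + (q - \<gamma>^2 * ec^2) * (ec^3 * ((1 - 3*\<tau>) * s * Y'))" for Y'
    proof -
      have V: "2 * kV \<tau> s ca t Y' = (1 - 3*\<tau>) * s * Y' + l * z + \<gamma> * \<delta>"
        unfolding kV_def l_def z_def \<gamma>_def \<delta>_def by simp
      have "2 * ec^5 * kg \<tau> s ca t Y' = ec^5 * ((z - \<gamma>^2) * (2 * kV \<tau> s ca t Y') + 2 * \<gamma> * z^2)"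
        unfolding kg_def z_def[symmetric] \<gamma>_def[symmetric] by algebra
      also have "\<dots> = ec * A + (q - \<gamma>^2 * ec^2) * (ec^3 * ((1 - 3*\<tau>) * s * Y'))"
        unfolding V A_def zq[symmetric] by algebra
      finally show ?thesis .
    qed
    define E0 where "E0 = 16 * Kc^5 * ec * A"
    define F0 where "F0 = 16 * Kc^5 * nc * (q - \<gamma>^2 * ec^2) * \<eta>"
    \<comment> \<open>Multiplication by a fifth power keeps the class; the 2 removes the denominator
      of \<open>kV\<close>. Negating the ordinate gives \<open>G'\<close>, the image of
      \<open>G\<close> under the double conjugation.\<close>
    define G where "G = (2 * Kc * ec)^5 * gP (Pt x y)"
    define G' where "G' = (2 * Kc * ec)^5 * gP (Pt x (- y))"
    have gY: "gP (Pt x y) = kg \<tau> s ca t Y" "gP (Pt x (- y)) = kg \<tau> s ca t (- Y)"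
      unfolding gP.simps t_def Y_def yw_def by (simp_all add: of_rat_minus)
    have Geq: "G = E0 + F0 * \<theta>"
    proof -
      have "G = 16 * Kc^5 * (2 * ec^5 * kg \<tau> s ca t Y)" unfolding G_def gY by algebra
      also have "\<dots> = E0 + F0 * \<theta>" unfolding gform cy E0_def F0_def by algebra
      finally show ?thesis .
    qed
    have G'eq: "G' = E0 - F0 * \<theta>"
    proof -
      have "G' = 16 * Kc^5 * (2 * ec^5 * kg \<tau> s ca t (- Y))" unfolding G'_def gY by algebra
      also have "\<dots> = 16 * Kc^5 * (ec * A - (q - \<gamma>^2 * ec^2) * (ec^3 * ((1 - 3*\<tau>) * s * Y)))"
        unfolding gform by algebra
      also have "\<dots> = E0 - F0 * \<theta>" unfolding cy E0_def F0_def by algebra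
      finally show ?thesis .
    qed
    have Kq: "Kc * q \<in> Zt"
    proof -
      have "Kc * q = (Kc * \<alpha>) * mc + (Kc * \<beta>) * ec^2" unfolding q_def by algebra
      also have "\<dots> \<in> Zt" by (intro Zc KX eZ; simp add: X_def)
      finally show ?thesis .
    qed
    have E0Z: "E0 \<in> Zt"
    proof -
      have "E0 = 16 * Kc^2 * ec * ((Kc * q - (Kc * \<gamma>^2) * ec^2) * ((Kc * l) * (Kc * q) + Kc * (Kc * (\<gamma> * \<delta>)) * ec^2)
          + 2 * (Kc * \<gamma>) * (Kc * q)^2)" unfolding E0_def A_def by algebra
      also have "\<dots> \<in> Zt" by (intro Zc KX eZ KZ Kq; simp add: X_def)
      finally show ?thesis .
    qed
    have F0Z: "F0 \<in> Zt"
    proof -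
      have "F0 = 16 * Kc^3 * nc * (Kc * q - (Kc * \<gamma>^2) * ec^2) * (Kc * \<eta>)" unfolding F0_def by algebra
      also have "\<dots> \<in> Zt" by (intro Zc KX eZ KZ Kq; simp add: X_def)
      finally show ?thesis .
    qed
    have sgth: "Q.sg (Q.sg \<theta>) = - \<theta>" using Q.sg2_ev[of 0 0 1 0] by simp
    have GO: "G \<in> Q.Oth" unfolding Geq by (intro oc ZtO E0Z F0Z)
    have sgG: "Q.sg (Q.sg G) = G'"
    proof -
      have "Q.sg (Q.sg G) = Q.sg (Q.sg E0) + Q.sg (Q.sg F0) * Q.sg (Q.sg \<theta>)"
        unfolding Geq using ZtO[OF E0Z] ZtO[OF F0Z] by (simp add: Q.Oth_add(2) Q.Oth_mult oc)
      then show ?thesis using E0Z F0Z sgth unfolding Zt_def G'eq by simp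
    qed
    define M where "M = 4 * Kc * (Kc * q)"
    have MZ: "M \<in> Zt" unfolding M_def by (intro Zc KZ Kq)
    have Mz: "M = (2 * Kc * ec)^2 * z" unfolding M_def zq[symmetric] by algebra
    have z0: "z \<noteq> 0" unfolding z_def t_def by (rule kz_nz)
    have M0: "M \<noteq> 0" unfolding Mz using z0 Kc0 ec0 by simp
    have GG: "G * Q.sg (Q.sg G) = M^5"
    proof -
      have "G * G' = ((2 * Kc * ec)^2)^5 * (gP (Pt x y) * gP (Pt x (- y)))" unfolding G_def G'_def by algebra
      also have "\<dots> = M^5" unfolding gP_neg[OF P] Mz z_def t_def by algebra
      finally show ?thesis unfolding sgG .
    qed
    define b1 where "b1 = (Kc * l) * (Kc * q) + Kc * (Kc * (\<gamma> * \<delta>)) * ec^2 - Kc * (Kc * (\<gamma>^2 * l)) * ec^2 + 2 * (Kc * \<gamma>) * (Kc * q)"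
    have b1Z: "b1 \<in> Zt" unfolding b1_def by (intro Zc KX eZ KZ Kq; simp add: X_def)
    define U where "U = 8 * Kc * ec * b1"
    have UZ: "U \<in> Zt" unfolding U_def by (intro Zc KZ eZ b1Z)
    \<comment> \<open>Modulo \<open>q\<close> only \<open>- \<gamma>^3 * \<delta> * ec^4\<close> is
      left of \<open>A\<close>, so \<open>G + G'\<close> is \<open>- \<rho> * ec^5\<close> modulo
      \<open>M\<close>.\<close>
    have re: "\<rho> * ec^5 = M * U - (G + G')"
    proof -
      have "G + G' = 2 * E0" unfolding Geq G'eq by simp
      then show ?thesis unfolding \<rho>_def M_def U_def b1_def E0_def A_def by algebra
    qed
    obtain iu iv :: int where bez: "iu * m + iv * e = 1"
      using bezout_int[of m e] cop by auto
    define cu cv where "cu = (of_int iu :: complex)" and "cv = (of_int iv :: complex)"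
    have uvZ: "cu \<in> Zt" "cv \<in> Zt" unfolding cu_def cv_def by (rule Zint)+
    have bezc: "cu * mc + cv * ec = 1"
      using arg_cong[OF bez, of "of_int :: int \<Rightarrow> complex"] unfolding cu_def cv_def mc_def ec_def by simp
    define v where "v = 4 * Kc * (Kc * \<alpha>) * cv - 4 * Kc * (Kc * \<beta>) * ec * cu"
    have vZ: "v \<in> Zt" unfolding v_def by (intro Zc KX eZ KZ uvZ; simp add: X_def)
    have A1: "A1 = cu * M + ec * v"
    proof -
      have "cu * M + ec * v = 4 * Kc * (Kc * \<alpha>) * (cu * mc + cv * ec)" unfolding M_def v_def q_def by algebra
      then show ?thesis unfolding bezc A1_def by simp
    qed
    \<comment> \<open>The binomial expansion of \<open>(cu*M + ec*v)^5\<close> without its last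
      term, divided by \<open>M\<close>.\<close>
    define W1 where "W1 = cu * ((cu * M)^4 + 5 * (cu * M)^3 * (ec * v) + 10 * (cu * M)^2 * (ec * v)^2
        + 10 * (cu * M) * (ec * v)^3 + 5 * (ec * v)^4)"
    have W1Z: "W1 \<in> Zt" unfolding W1_def by (intro Zc eZ uvZ MZ vZ)
    have A15: "A1^5 = M * W1 + ec^5 * v^5" unfolding A1 W1_def by algebra
    have kp: "\<kappa>' = M * (\<rho> * W1 + v^5 * U) - v^5 * (G + G')"
    proof -
      have "\<kappa>' = \<rho> * M * W1 + v^5 * (\<rho> * ec^5)" unfolding \<kappa>'_def A15 by algebra
      also have "\<dots> = M * (\<rho> * W1 + v^5 * U) - v^5 * (G + G')" unfolding re by algebra
      finally show ?thesis .
    qed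
    define sk where "sk = Q.sg \<kappa>'"
    have skO: "sk \<in> Q.Oth" unfolding sk_def by (intro oc ZtO kZ)
    have nO: "- (sk * v^5) \<in> Q.Oth"
    proof -
      have "0 - sk * v^5 \<in> Q.Oth" by (intro oc skO ZtO[OF vZ])
      then show ?thesis by simp
    qed
    have rO: "sk * (\<rho> * W1 + v^5 * U) \<in> Q.Oth" by (intro oc skO ZtO[OF vZ] ZtO[OF UZ] ZtO[OF W1Z] ZtO[OF rA(1)])
    have ka: "of_int \<kappa> = - (sk * v^5) * G + - (sk * v^5) * Q.sg (Q.sg G) + (sk * (\<rho> * W1 + v^5 * U)) * M"
    proof -
      have "of_int \<kappa> = \<kappa>' * sk" using kap by (simp add: sk_def)
      then show ?thesis unfolding sgG using kp by algebra
    qed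
    have MM: "Q.sg (Q.sg M) = M" using MZ by (simp add: Zt_def)
    obtain w f where w: "w \<in> W" and f: "f \<in> Q.Oth" "f \<noteq> 0" "G * f^5 = w * M^5"
      using Q.bounded_representative[OF GO ZtO[OF MZ] nO nO rO M0 MM GG ka k0] unfolding W_def by blast
    define c where "c = M / (f * (2 * Kc * ec))"
    have c0: "c \<noteq> 0" unfolding c_def using M0 f(2) Kc0 ec0 by simp
    have cN: "c \<in> N" unfolding c_def using OthN[OF f(1)] OthN[OF ZtO[OF MZ]] OthN[OF ZtO[OF KZ]] OthN[OF ZtO[OF eZ(1)]]
      by (intro sfD[OF sf_N])
    have "gP (Pt x y) * (f * (2 * Kc * ec))^5 = w * M^5" using f(3) unfolding G_def by (simp add: power_mult_distrib algebra_simps)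
    then have "gP (Pt x y) = c^5 * w" unfolding c_def power_divide using f(2) Kc0 ec0 by (simp add: field_simps)
    then show ?thesis unfolding same_class_def using w cN c0 by blast
  qed
  have "\<exists>w\<in>insert 1 W. same_class (gP P) w" if "P \<in> carrier E" for P
  proof (cases P)
    case Inf then show ?thesis using same_refl by auto
  next
    case (Pt x y) then show ?thesis using main that by blast
  qed
  moreover have "finite (insert 1 W)" unfolding W_def using Q.finite_bounded_int by simp
  ultimately show ?thesis by blast
qed

end

section \<open>Splitting fields and subgroups of order 5\<close>

lemma sf_Inter:
  assumes "\<And>K. K \<in> F \<Longrightarrow> sf K"
  shows "sf (\<Inter>F)"
  using assms unfolding is_subfield_complex_def by (auto simp: Ball_def)

context brumer
begin

lemma Spl_cycle:
  assumes P: "Pt x y \<in> carrier E" and u: "lyness u" "ly_a u = ca" "ly_t u = of_rat (xt x)"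
  shows "sf (Spl (BruP a b (Pt x y)))" "u j \<in> Spl (BruP a b (Pt x y))"
    "\<And>K. sf K \<Longrightarrow> (\<And>j. u j \<in> K) \<Longrightarrow> Spl (BruP a b (Pt x y)) \<subseteq> K"
proof -
  have e: "map_poly of_rat (BruP a b (Pt x y)) = bru_poly (ly_a u) (ly_t u)"
    unfolding u by (simp add: BruP_def Bru_eq xt_def map_poly_bru_poly)
  have roots: "{z. poly (map_poly of_rat (BruP a b (Pt x y))) z = 0} = range (\<lambda>j. - u j)"
    unfolding e bru_poly_root_iff[OF u(1)] by auto
  show "sf (Spl (BruP a b (Pt x y)))" unfolding Spl_def by (rule sf_Inter) auto
  then have "- (- u j) \<in> Spl (BruP a b (Pt x y))"
    by (rule sf_uminus) (unfold Spl_def roots, auto)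
  then show "u j \<in> Spl (BruP a b (Pt x y))" by simp
  fix K assume K: "sf K" "\<And>j. u j \<in> K"
  then have "range (\<lambda>j. - u j) \<subseteq> K" by (auto intro: sf_uminus)
  then show "Spl (BruP a b (Pt x y)) \<subseteq> K" unfolding Spl_def roots using K(1) by auto
qed

text \<open>Let \<open>M = K2(u 0)\<close>; it lies in the splitting field for P because
  \<open>r\<close> is the ordinate of the cycle divided by a rational number. The class relation
  gives a fifth root of \<open>(ly_h \<zeta> v)^5\<close> in \<open>M(\<zeta>)\<close>, so the
  quintic of Q becomes reducible there. As \<open>M(\<zeta>)\<close> arises by quadratic steps, it
  is reducible over \<open>M\<close> already, and all its roots lie in \<open>M\<close>.\<close>

lemma Spl_subset:
  assumes P: "P \<in> carrier E" "P \<notin> phi_img a b" and Q: "Q \<in> carrier E" "Q \<notin> phi_img a b"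
    and same: "same_class (gP Q) (gP P ^ i)"
  shows "Spl (BruP a b Q) \<subseteq> Spl (BruP a b P)"
proof -
  have "Inf \<in> phi_img a b" by (simp add: phi_img_def)
  then obtain x y x' y' where Pt: "P = Pt x y" "Q = Pt x' y'" using P Q by (cases P; cases Q) auto
  obtain u where u: "lyness u" "ly_a u = ca" "ly_t u = of_rat (xt x)" "ly_y u = r * of_rat (yw y)"
    "gP (Pt x y) = (ly_h \<zeta> u)^5" "ly_h \<zeta> u \<noteq> 0" "irr_cycle K2 u" "irr_cycle N u"
    by (rule irr_cycle_of_point[OF P[unfolded Pt]])
  obtain v where v: "lyness v" "ly_a v = ca" "ly_t v = of_rat (xt x')" "ly_y v = r * of_rat (yw y')"
    "gP (Pt x' y') = (ly_h \<zeta> v)^5" "ly_h \<zeta> v \<noteq> 0" "irr_cycle K2 v" "irr_cycle N v"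
    by (rule irr_cycle_of_point[OF Q[unfolded Pt]])
  interpret U: irr_cycle K2 u by (rule u(7))
  interpret V: irr_cycle K2 v by (rule v(7))
  let ?SP = "Spl (BruP a b P)" and ?SQ = "Spl (BruP a b Q)"
  note SP = Spl_cycle[OF P(1)[unfolded Pt] u(1-3), folded Pt]
  note SQ = Spl_cycle[OF Q(1)[unfolded Pt] v(1-3), folded Pt]
  define M where "M = Ext K2 (- u 0)"
  have M: "sf M" unfolding M_def by (rule sf_Ext[OF U.K U.fK bru_poly_nz U.irr U.root])
  have KM: "K2 \<subseteq> M" unfolding M_def by (rule Ext_base[OF sf_K2])
  have "- u 0 \<in> M" unfolding M_def by (rule Ext_gen[OF sf_K2])
  from sf_uminus[OF M this] have "u 0 \<in> M" by simp
  then have uM: "u j \<in> M" for j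
    by (rule lyness_all_in_field[OF M u(1) subsetD[OF KM U.aK] subsetD[OF KM U.yK] U.y0])
  define NM where "NM = N5 \<zeta> M"
  have NM: "sf NM" and MNM: "M \<subseteq> NM" and zNM: "\<zeta> \<in> NM"
    unfolding NM_def by (rule sf_N5[OF z M] N5_base[OF z M] N5_zeta[OF z M])+
  have NNM: "N \<subseteq> NM" unfolding N_def NM_def by (rule N5_mono[OF KM])
  obtain c where c: "c \<in> N" "gP Q = c^5 * gP P ^ i" using same by (auto simp: same_class_def)
  define e where "e = c * (ly_h \<zeta> u)^i"
  have uNM: "u j \<in> NM" for j using uM MNM by blast
  have cNM: "c \<in> NM" using c(1) NNM by blast
  have eNM: "e \<in> NM" unfolding e_def ly_h_def by (intro sfD[OF NM] uNM zNM cNM)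
  have e5: "e^5 = (ly_h \<zeta> v)^5"
    using c(2) u(5) v(5) Pt by (simp add: e_def power_mult_distrib power_mult[symmetric] mult.commute)
  have "\<not> irr_over M (bru_poly (ly_a v) (ly_t v))"
  proof
    assume "irr_over M (bru_poly (ly_a v) (ly_t v))"
    then have "irr_over NM (bru_poly (ly_a v) (ly_t v))"
      unfolding NM_def by (intro N5_irr[OF z M MX_mono[OF KM V.fK] degree_bru_poly])
    then have "irr_cycle NM v"
      using V.aK V.tK V.yK V.y0 KM MNM NM v(1) by unfold_locales auto
    then show False using irr_cycle.not_fifth_power[OF _ z zNM eNM e5 v(6)] by blast
  qed
  then obtain j where "v j \<in> M" using not_irr_root_in_field[OF M v(1)] V.aK V.tK KM by blast
  then have vM: "v k \<in> M" for k
    by (rule lyness_all_in_field[OF M v(1) subsetD[OF KM V.aK] subsetD[OF KM V.yK] V.y0])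
  have w0: "of_rat (yw y) \<noteq> (0::complex)" using U.y0 u(4) by auto
  have "ly_y u \<in> ?SP" unfolding ly_y_def by (intro sfD[OF SP(1)] SP(2))
  then have "ly_y u / of_rat (yw y) \<in> ?SP" by (intro sfD[OF SP(1)])
  then have rS: "r \<in> ?SP" using u(4) w0 by simp
  have "rats \<subseteq> ?SP" unfolding rats_def using sf_of_rat[OF SP(1)] by blast
  then have "K2 \<subseteq> ?SP" unfolding K2_def by (rule Adj_least[OF SP(1) _ rS])
  then have "M \<subseteq> ?SP" unfolding M_def Ext_def
    using MX_poly[OF SP(1) MX_mono sf_uminus[OF SP(1) SP(2)]] by blast
  then show ?thesis using SQ(3)[OF SP(1)] vM by blast
qed

text \<open>Equal splitting fields put the resolvent of Q into \<open>N(u 0)\<close>, while its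
  fifth power is in \<open>N\<close>. By \<open>kummer_generator\<close> some power of the resolvent
  of P brings it into \<open>N\<close>.\<close>

lemma Spl_eq_imp_same:
  assumes P: "P \<in> carrier E" "P \<notin> phi_img a b" and Q: "Q \<in> carrier E" "Q \<notin> phi_img a b"
    and eq: "Spl (BruP a b Q) = Spl (BruP a b P)"
  shows "\<exists>i. same_class (gP P ^ i * gP Q) 1"
proof -
  have "Inf \<in> phi_img a b" by (simp add: phi_img_def)
  then obtain x y x' y' where Pt: "P = Pt x y" "Q = Pt x' y'" using P Q by (cases P; cases Q) auto
  obtain u where u: "lyness u" "ly_a u = ca" "ly_t u = of_rat (xt x)" "ly_y u = r * of_rat (yw y)"
    "gP (Pt x y) = (ly_h \<zeta> u)^5" "ly_h \<zeta> u \<noteq> 0" "irr_cycle K2 u" "irr_cycle N u"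
    by (rule irr_cycle_of_point[OF P[unfolded Pt]])
  obtain v where v: "lyness v" "ly_a v = ca" "ly_t v = of_rat (xt x')" "ly_y v = r * of_rat (yw y')"
    "gP (Pt x' y') = (ly_h \<zeta> v)^5" "ly_h \<zeta> v \<noteq> 0" "irr_cycle K2 v" "irr_cycle N v"
    by (rule irr_cycle_of_point[OF Q[unfolded Pt]])
  interpret U: irr_cycle N u by (rule u(8))
  note SP = Spl_cycle[OF P(1)[unfolded Pt] u(1-3), folded Pt]
  note SQ = Spl_cycle[OF Q(1)[unfolded Pt] v(1-3), folded Pt]
  define M where "M = Ext N (- u 0)"
  have M: "sf M" unfolding M_def by (rule sf_Ext[OF U.K U.fK bru_poly_nz U.irr U.root])
  have NM: "N \<subseteq> M" unfolding M_def by (rule Ext_base[OF sf_N])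
  have "- u 0 \<in> M" unfolding M_def by (rule Ext_gen[OF sf_N])
  from sf_uminus[OF M this] have "u 0 \<in> M" by simp
  then have uM: "u j \<in> M" for j
    by (rule lyness_all_in_field[OF M u(1) subsetD[OF NM U.aK] subsetD[OF NM U.yK] U.y0])
  have vM: "v j \<in> M" for j using SP(3)[OF M uM] SQ(2)[of j] eq by blast
  have zM: "\<zeta> \<in> M" using zeta_N NM by blast
  have "ly_h \<zeta> v \<in> M" unfolding ly_h_def by (intro sfD[OF M] vM zM)
  moreover have "(ly_h \<zeta> v)^5 \<in> N" using gP_N[of Q] v(5) Pt by simp
  ultimately obtain i where i: "(ly_h \<zeta> u)^i * ly_h \<zeta> v \<in> N"
    using U.kummer_generator[OF z zeta_N u(6) _ v(6)] unfolding M_def by blast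
  have "gP P ^ i * gP Q = ((ly_h \<zeta> u)^i * ly_h \<zeta> v)^5"
    using u(5) v(5) Pt by (simp add: power_mult_distrib power_mult[symmetric] mult.commute)
  then have "same_class (gP P ^ i * gP Q) 1" using same_fifth[OF i] u(6) v(6) by simp
  then show ?thesis by blast
qed

text \<open>The exponent is inverted modulo 5, using \<open>2*3 = 5 + 1\<close> and
  \<open>4*4 = 15 + 1\<close>.\<close>

lemma same_pow_one:
  assumes g: "g \<in> N" "g \<noteq> 0" and k: "same_class (g^k) 1" "0 < k" "k < 5"
  shows "same_class g 1"
proof -
  have 5: "same_class (g^5) 1" by (rule same_fifth[OF g])
  have red: "same_class g 1" if "same_class (g^(5*n+1)) 1" for n
  proof -
    have "same_class ((g^5)^n * g) (1^n * g)" by (intro same_mult same_power 5 same_refl)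
    then have "same_class (g^(5*n+1)) g" by (simp add: power_mult[symmetric] power_add mult.commute)
    from same_trans[OF same_sym[OF this] that] show ?thesis .
  qed
  have pw: "same_class (g^(k*m)) 1" for m using same_power[OF k(1), of m] by (simp add: power_mult)
  consider "k = 1" | "k = 2" | "k = 3" | "k = 4" using k by linarith
  then show ?thesis
  proof cases
    case 1 then show ?thesis using k by simp
  next
    case 2 then show ?thesis using red[of 1] pw[of 3] by simp
  next
    case 3 then show ?thesis using red[of 1] pw[of 2] by simp
  next
    case 4 then show ?thesis using red[of 3] pw[of 4] by simp
  qed
qed

end

section \<open>The quotient group and its subgroups of order 5\<close>

locale brumer_ns = brumer +
  assumes ns: "nonsingular (EA2 a b) (EA4 a b) (EA6 a b)"
begin

abbreviation "H \<equiv> phi_img a b"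

definition cls :: "rat ecpt \<Rightarrow> rat ecpt set" where
  "cls P = {Q \<in> carrier E. same_class (gP Q) (gP P)}"

lemma H_carrier: "H \<subseteq> carrier E"
  unfolding phi_img_def using E_Inf(1) by auto

text \<open>The cosets turn out to be the fibres of the Kummer map, so this cancellation law is all that is needed
  of the associativity of the chord-tangent law.\<close>

lemma split_off:
  assumes "Q \<in> carrier E" "P \<in> carrier E"
  obtains R where "R \<in> carrier E" "Q = R \<otimes>\<^bsub>E\<^esub> P" "same_class (gP Q) (gP R * gP P)"
proof -
  define R where "R = Q \<otimes>\<^bsub>E\<^esub> negP P"
  have R: "R \<in> carrier E" unfolding R_def by (intro E_closed carrier_neg assms)
  have "R \<otimes>\<^bsub>E\<^esub> P = Q"
  proof (cases P)
    case Inf then show ?thesis by (simp add: R_def E_Inf)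
  next
    case (Pt x y)
    then show ?thesis unfolding R_def E_mult
      using ec_add_neg_cancel[OF ns] assms[unfolded E_carrier] by simp
  qed
  then show ?thesis using that[OF R] gP_hom[OF R assms(2)] by metis
qed

lemma same_cancel:
  assumes "same_class (x * g) (y * g)" "g \<in> N" "g \<noteq> 0"
  shows "same_class x y"
proof -
  have "same_class (x * g * inverse g) (y * g * inverse g)" by (rule same_mult[OF assms(1) same_refl])
  then show ?thesis using assms(3) by (simp add: mult.assoc)
qed

lemma rcos_eq:
  assumes P: "P \<in> carrier E"
  shows "H #>\<^bsub>E\<^esub> P = cls P"
proof (intro equalityI subsetI)
  fix Q assume "Q \<in> H #>\<^bsub>E\<^esub> P"
  then obtain h where h: "h \<in> H" "Q = h \<otimes>\<^bsub>E\<^esub> P" by (auto simp: r_coset_def)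
  then have hE: "h \<in> carrier E" using H_carrier by blast
  have "same_class (gP Q) (gP h * gP P)" using gP_hom[OF hE P] h by simp
  moreover have "same_class (gP h * gP P) (1 * gP P)"
    using phi_iff_same[OF hE] h by (intro same_mult same_refl) simp
  ultimately have "same_class (gP Q) (1 * gP P)" by (rule same_trans)
  then show "Q \<in> cls P" unfolding cls_def using E_closed[OF hE P] h by simp
next
  fix Q assume "Q \<in> cls P"
  then have Q: "Q \<in> carrier E" "same_class (gP Q) (gP P)" by (auto simp: cls_def)
  obtain R where R: "R \<in> carrier E" "Q = R \<otimes>\<^bsub>E\<^esub> P" "same_class (gP Q) (gP R * gP P)"
    using split_off[OF Q(1) P] by metis
  have "same_class (gP R * gP P) (1 * gP P)" using same_trans[OF same_sym[OF R(3)] Q(2)] by simp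
  then have "same_class (gP R) 1" using same_cancel gP_N gP_nz[OF P] by blast
  then have "R \<in> H" using phi_iff_same[OF R(1)] by simp
  then show "Q \<in> H #>\<^bsub>E\<^esub> P" using R(2) by (auto simp: r_coset_def)
qed

lemma cls_self: "P \<in> carrier E \<Longrightarrow> P \<in> cls P" by (simp add: cls_def same_refl)

lemma cls_eq_iff:
  assumes "P \<in> carrier E" "Q \<in> carrier E"
  shows "cls P = cls Q \<longleftrightarrow> same_class (gP P) (gP Q)"
proof
  assume "cls P = cls Q" then show "same_class (gP P) (gP Q)" using cls_self[OF assms(1)] by (auto simp: cls_def)
next
  assume s: "same_class (gP P) (gP Q)"
  have "same_class x (gP P) \<longleftrightarrow> same_class x (gP Q)" for x
    using same_trans[OF _ s] same_trans[OF _ same_sym[OF s]] by blast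
  then show "cls P = cls Q" unfolding cls_def by simp
qed

lemma cls_Inf: "cls Inf = H"
  unfolding cls_def using phi_iff_same H_carrier by auto

abbreviation "G \<equiv> E Mod H"

lemma G_carrier: "carrier G = cls ` carrier E"
  unfolding carrier_FactGroup using rcos_eq by auto

text \<open>Cosets are multiplied elementwise, so a point \<open>X\<close> in the fibre of the sum
  has to be decomposed: it is \<open>R\<close> plus \<open>Q\<close>, and cancelling the value at
  \<open>Q\<close> puts \<open>R\<close> into the fibre of \<open>P\<close>.\<close>

lemma cls_mult:
  assumes P: "P \<in> carrier E" and Q: "Q \<in> carrier E"
  shows "cls P \<otimes>\<^bsub>G\<^esub> cls Q = cls (P \<otimes>\<^bsub>E\<^esub> Q)"
proof (intro equalityI subsetI)
  fix X assume "X \<in> cls P \<otimes>\<^bsub>G\<^esub> cls Q"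
  then obtain p q where pq: "p \<in> cls P" "q \<in> cls Q" "X = p \<otimes>\<^bsub>E\<^esub> q" by (auto simp: set_mult_def)
  then have pE: "p \<in> carrier E" "q \<in> carrier E" by (auto simp: cls_def)
  have "same_class (gP X) (gP p * gP q)" using gP_hom[OF pE] pq by simp
  moreover have "same_class (gP p * gP q) (gP P * gP Q)" using pq by (intro same_mult) (auto simp: cls_def)
  moreover have "same_class (gP P * gP Q) (gP (P \<otimes>\<^bsub>E\<^esub> Q))" by (rule same_sym[OF gP_hom[OF P Q]])
  ultimately have "same_class (gP X) (gP (P \<otimes>\<^bsub>E\<^esub> Q))" by (rule same_trans[OF same_trans])
  then show "X \<in> cls (P \<otimes>\<^bsub>E\<^esub> Q)" unfolding cls_def using E_closed[OF pE] pq(3) by simp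
next
  fix X assume "X \<in> cls (P \<otimes>\<^bsub>E\<^esub> Q)"
  then have X: "X \<in> carrier E" "same_class (gP X) (gP (P \<otimes>\<^bsub>E\<^esub> Q))" by (auto simp: cls_def)
  obtain R where R: "R \<in> carrier E" "X = R \<otimes>\<^bsub>E\<^esub> Q" "same_class (gP X) (gP R * gP Q)"
    using split_off[OF X(1) Q] by metis
  have "same_class (gP R * gP Q) (gP P * gP Q)"
    using same_trans[OF same_sym[OF R(3)] same_trans[OF X(2) gP_hom[OF P Q]]] .
  then have "same_class (gP R) (gP P)" using same_cancel gP_N gP_nz[OF Q] by blast
  then have "R \<in> cls P" using R(1) by (simp add: cls_def)
  then show "X \<in> cls P \<otimes>\<^bsub>G\<^esub> cls Q" using R(2) cls_self[OF Q] by (auto simp: set_mult_def)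
qed

lemma G_one: "\<one>\<^bsub>G\<^esub> = cls Inf" by (simp add: cls_Inf)

text \<open>Associativity comes from the multiplication of Kummer values, because these determine
  the cosets.\<close>

lemma group_G: "group G"
proof (rule groupI)
  show "\<one>\<^bsub>G\<^esub> \<in> carrier G" unfolding G_carrier G_one using E_Inf(1) by blast
next
  fix x y assume "x \<in> carrier G" "y \<in> carrier G"
  then obtain P Q where "P \<in> carrier E" "Q \<in> carrier E" "x = cls P" "y = cls Q" unfolding G_carrier by blast
  then show "x \<otimes>\<^bsub>G\<^esub> y \<in> carrier G" unfolding G_carrier by (simp only: cls_mult) (blast intro: E_closed)
next
  fix x y w assume "x \<in> carrier G" "y \<in> carrier G" "w \<in> carrier G"
  then obtain P Q R where PQR: "P \<in> carrier E" "Q \<in> carrier E" "R \<in> carrier E" "x = cls P" "y = cls Q" "w = cls R"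
    unfolding G_carrier by blast
  have "same_class (gP ((P \<otimes>\<^bsub>E\<^esub> Q) \<otimes>\<^bsub>E\<^esub> R)) (gP P * gP Q * gP R)"
    by (rule same_trans[OF gP_hom[OF E_closed[OF PQR(1,2)] PQR(3)] same_mult[OF gP_hom[OF PQR(1,2)] same_refl]])
  moreover have "same_class (gP (P \<otimes>\<^bsub>E\<^esub> (Q \<otimes>\<^bsub>E\<^esub> R))) (gP P * (gP Q * gP R))"
    by (rule same_trans[OF gP_hom[OF PQR(1) E_closed[OF PQR(2,3)]] same_mult[OF same_refl gP_hom[OF PQR(2,3)]]])
  ultimately have "same_class (gP ((P \<otimes>\<^bsub>E\<^esub> Q) \<otimes>\<^bsub>E\<^esub> R)) (gP (P \<otimes>\<^bsub>E\<^esub> (Q \<otimes>\<^bsub>E\<^esub> R)))"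
    unfolding mult.assoc by (rule same_trans[OF _ same_sym])
  then show "x \<otimes>\<^bsub>G\<^esub> y \<otimes>\<^bsub>G\<^esub> w = x \<otimes>\<^bsub>G\<^esub> (y \<otimes>\<^bsub>G\<^esub> w)"
    using PQR cls_eq_iff[OF E_closed[OF E_closed[OF PQR(1,2)] PQR(3)] E_closed[OF PQR(1) E_closed[OF PQR(2,3)]]]
    by (simp only: cls_mult E_closed)
next
  fix x assume "x \<in> carrier G"
  then obtain P where P: "P \<in> carrier E" "x = cls P" unfolding G_carrier by blast
  show "\<one>\<^bsub>G\<^esub> \<otimes>\<^bsub>G\<^esub> x = x"
    unfolding G_one P(2) using cls_mult[OF E_Inf(1) P(1)] by (simp only: E_Inf)
  have "cls (negP P) \<otimes>\<^bsub>G\<^esub> cls P = cls (negP P \<otimes>\<^bsub>E\<^esub> P)" by (rule cls_mult[OF carrier_neg[OF P(1)] P(1)])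
  also have "\<dots> = cls Inf"
  proof -
    have "same_class (gP (negP P \<otimes>\<^bsub>E\<^esub> P)) (gP (negP P) * gP P)" by (rule gP_hom[OF carrier_neg[OF P(1)] P(1)])
    moreover have "same_class (gP (negP P) * gP P) 1" using gP_neg_same[OF P(1)] by (simp add: mult.commute)
    ultimately have "same_class (gP (negP P \<otimes>\<^bsub>E\<^esub> P)) 1" by (rule same_trans)
    then show ?thesis using cls_eq_iff[OF E_closed[OF carrier_neg[OF P(1)] P(1)] E_Inf(1)] by simp
  qed
  finally show "\<exists>y\<in>carrier G. y \<otimes>\<^bsub>G\<^esub> x = \<one>\<^bsub>G\<^esub>"
    unfolding G_carrier G_one P(2) using carrier_neg[OF P(1)] by blast
qed

lemma cls_pow:
  assumes P: "P \<in> carrier E"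
  shows "\<exists>R\<in>carrier E. cls P [^]\<^bsub>G\<^esub> (n::nat) = cls R \<and> same_class (gP R) (gP P ^ n)"
proof (induction n)
  case 0
  show ?case using E_Inf(1) by (intro bexI[of _ Inf]) (simp_all add: cls_Inf same_refl)
next
  case (Suc n)
  then obtain R where R: "R \<in> carrier E" "cls P [^]\<^bsub>G\<^esub> n = cls R" "same_class (gP R) (gP P ^ n)" by blast
  have "cls P [^]\<^bsub>G\<^esub> Suc n = cls (R \<otimes>\<^bsub>E\<^esub> P)" using cls_mult[OF R(1) P] R(2) by simp
  moreover have "same_class (gP (R \<otimes>\<^bsub>E\<^esub> P)) (gP P ^ n * gP P)"
    by (rule same_trans[OF gP_hom[OF R(1) P] same_mult[OF R(3) same_refl]])
  ultimately show ?case using E_closed[OF R(1) P] by (intro bexI[of _ "R \<otimes>\<^bsub>E\<^esub> P"]) (simp_all add: mult.commute)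
qed

lemma cls_pow_eq_iff:
  assumes P: "P \<in> carrier E" and Q: "Q \<in> carrier E"
  shows "cls Q = cls P [^]\<^bsub>G\<^esub> (n::nat) \<longleftrightarrow> same_class (gP Q) (gP P ^ n)"
proof -
  obtain R where R: "R \<in> carrier E" "cls P [^]\<^bsub>G\<^esub> n = cls R" "same_class (gP R) (gP P ^ n)"
    using cls_pow[OF P] by blast
  show ?thesis unfolding R(2) cls_eq_iff[OF Q R(1)]
    using same_trans[OF _ R(3)] same_trans[OF _ same_sym[OF R(3)]] by blast
qed

lemma cls_in_G: "P \<in> carrier E \<Longrightarrow> cls P \<in> carrier G" unfolding G_carrier by blast

lemma cls_eq_H_iff: "P \<in> carrier E \<Longrightarrow> cls P = H \<longleftrightarrow> P \<in> H"
  using cls_eq_iff[OF _ E_Inf(1)] phi_iff_same by (simp add: cls_Inf)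

lemma cls_pow5:
  assumes P: "P \<in> carrier E"
  shows "cls P [^]\<^bsub>G\<^esub> (5::nat) = \<one>\<^bsub>G\<^esub>"
  unfolding G_one using cls_pow_eq_iff[OF P E_Inf(1), of 5] same_sym[OF same_fifth[OF gP_N gP_nz[OF P]]] by simp

definition cyc :: "rat ecpt \<Rightarrow> rat ecpt set set" where
  "cyc P = range (\<lambda>n::nat. cls P [^]\<^bsub>G\<^esub> n)"

text \<open>Every class has exponent 5, so inverses are fourth powers and five exponents suffice.
  Two equal powers among them would give an exponent strictly between 0 and 5 with trivial class,
  and by \<open>same_pow_one\<close> P would lie in \<open>H\<close>.\<close>

lemma cyc_subgroup_card:
  assumes P: "P \<in> carrier E" "P \<notin> H"
  shows "subgroup (cyc P) G" "card (cyc P) = 5" "finite (cyc P)"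
proof -
  interpret G: group G by (rule group_G)
  let ?X = "cls P"
  have X: "?X \<in> carrier G" by (rule cls_in_G[OF P(1)])
  have p5: "?X [^]\<^bsub>G\<^esub> (5 * m) = \<one>\<^bsub>G\<^esub>" for m :: nat
    using G.nat_pow_pow[OF X, of 5 m] cls_pow5[OF P(1)] by (simp add: G.nat_pow_one del: one_FactGroup)
  show "subgroup (cyc P) G"
  proof (rule G.subgroupI)
    show "cyc P \<subseteq> carrier G" unfolding cyc_def using X by auto
    show "cyc P \<noteq> {}" by (simp add: cyc_def)
  next
    fix x assume "x \<in> cyc P"
    then obtain n :: nat where n: "x = ?X [^]\<^bsub>G\<^esub> n" by (auto simp: cyc_def)
    have "?X [^]\<^bsub>G\<^esub> (4 * n) \<otimes>\<^bsub>G\<^esub> ?X [^]\<^bsub>G\<^esub> n = ?X [^]\<^bsub>G\<^esub> (5 * n)"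
      using G.nat_pow_mult[OF X, of "4 * n" n] by simp
    then have "inv\<^bsub>G\<^esub> x = ?X [^]\<^bsub>G\<^esub> (4 * n)" unfolding n p5 using X by (intro G.inv_equality) auto
    then show "inv\<^bsub>G\<^esub> x \<in> cyc P" by (auto simp: cyc_def)
  next
    fix x y assume "x \<in> cyc P" "y \<in> cyc P"
    then obtain n m :: nat where nm: "x = ?X [^]\<^bsub>G\<^esub> n" "y = ?X [^]\<^bsub>G\<^esub> m" by (auto simp: cyc_def)
    have "x \<otimes>\<^bsub>G\<^esub> y = ?X [^]\<^bsub>G\<^esub> (n + m)" unfolding nm by (rule G.nat_pow_mult[OF X])
    then show "x \<otimes>\<^bsub>G\<^esub> y \<in> cyc P" by (auto simp: cyc_def)
  qed
  have im: "cyc P = (\<lambda>n. ?X [^]\<^bsub>G\<^esub> n) ` {..<5::nat}"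
  proof -
    have "?X [^]\<^bsub>G\<^esub> n \<in> (\<lambda>n. ?X [^]\<^bsub>G\<^esub> n) ` {..<5::nat}" for n :: nat
    proof (rule image_eqI[of _ _ "n mod 5"])
      have "?X [^]\<^bsub>G\<^esub> (5 * (n div 5) + n mod 5) = ?X [^]\<^bsub>G\<^esub> (n mod 5)"
        using G.nat_pow_mult[OF X, of "5 * (n div 5)" "n mod 5", symmetric] p5[of "n div 5"] X
        by (simp del: one_FactGroup mult_FactGroup)
      then show "?X [^]\<^bsub>G\<^esub> n = ?X [^]\<^bsub>G\<^esub> (n mod 5)" by simp
    qed simp
    then show ?thesis unfolding cyc_def by blast
  qed
  then show "finite (cyc P)" by simp
  have "inj_on (\<lambda>n. ?X [^]\<^bsub>G\<^esub> n) {..<5::nat}"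
  proof (rule linorder_inj_onI')
    fix i j :: nat assume ij: "i \<in> {..<5}" "j \<in> {..<5}" "i < j"
    show "?X [^]\<^bsub>G\<^esub> i \<noteq> ?X [^]\<^bsub>G\<^esub> j"
    proof
      assume e: "?X [^]\<^bsub>G\<^esub> i = ?X [^]\<^bsub>G\<^esub> j"
      have "?X [^]\<^bsub>G\<^esub> (5 - j) \<otimes>\<^bsub>G\<^esub> ?X [^]\<^bsub>G\<^esub> i = ?X [^]\<^bsub>G\<^esub> (5 - j) \<otimes>\<^bsub>G\<^esub> ?X [^]\<^bsub>G\<^esub> j" using e by simp
      then have "?X [^]\<^bsub>G\<^esub> (5 - j + i) = ?X [^]\<^bsub>G\<^esub> (5 - j + j)"
        by (simp only: G.nat_pow_mult[OF X])
      then have "cls Inf = ?X [^]\<^bsub>G\<^esub> (5 - j + i)" using ij cls_pow5[OF P(1)] by (simp add: G_one del: one_FactGroup)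
      then have "same_class (gP Inf) (gP P ^ (5 - j + i))" using cls_pow_eq_iff[OF P(1) E_Inf(1)] by blast
      then have "same_class (gP P ^ (5 - j + i)) 1" using same_sym by simp
      then have "same_class (gP P) 1" using ij by (intro same_pow_one[OF gP_N gP_nz[OF P(1)], of "5 - j + i"]) auto
      then show False using phi_iff_same P by simp
    qed
  qed
  then show "card (cyc P) = 5" unfolding im by (simp add: card_image)
qed

text \<open>The coset of P belongs to \<open>S\<close>, and its five distinct powers exhaust
  \<open>S\<close> by counting.\<close>

lemma subgroup5_cyc:
  assumes S: "subgroup S G" "card S = 5" and P: "P \<in> \<Union>S - H"
  shows "P \<in> carrier E" "P \<notin> H" "S = cyc P"
proof -
  interpret G: group G by (rule group_G)
  obtain X where X: "X \<in> S" "P \<in> X" using P by blast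
  have "X \<in> carrier G" using S(1) X(1) subgroup.subset by blast
  then obtain R where R: "R \<in> carrier E" "X = cls R" unfolding G_carrier by blast
  show PE: "P \<in> carrier E" using X(2) R by (simp add: cls_def)
  show PH: "P \<notin> H" using P by blast
  have "cls P = X" using X(2) R cls_eq_iff[OF PE R(1)] by (simp add: cls_def)
  then have PS: "cls P \<in> S" using X by simp
  have "cls P [^]\<^bsub>G\<^esub> n \<in> S" for n :: nat
    using PS S(1) by (induction n) (auto simp del: one_FactGroup mult_FactGroup intro: subgroup.one_closed subgroup.m_closed)
  then have "cyc P \<subseteq> S" by (auto simp: cyc_def)
  moreover have "finite S" using S(2) card.infinite by fastforce
  ultimately show "S = cyc P" using cyc_subgroup_card(2)[OF PE PH] S(2) by (metis card_subset_eq)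
qed

lemma Spl_cong_cyc:
  assumes P: "P \<in> carrier E" "P \<notin> H" and Q: "Q \<in> carrier E" "Q \<notin> H" and c: "cls Q \<in> cyc P"
  shows "Spl (BruP a b Q) \<subseteq> Spl (BruP a b P)"
proof -
  obtain n :: nat where "cls Q = cls P [^]\<^bsub>G\<^esub> n" using c by (auto simp: cyc_def)
  then show ?thesis using cls_pow_eq_iff[OF P(1) Q(1)] Spl_subset[OF P Q] by blast
qed

lemma cls_mem_cyc:
  assumes "P \<in> carrier E"
  shows "cls P \<in> cyc P"
proof -
  have "cls P = cls P [^]\<^bsub>G\<^esub> (1::nat)" using cls_pow_eq_iff[OF assms assms, of 1] same_refl by (simp only: power_one_right)
  then show ?thesis unfolding cyc_def by blast
qed

lemma subgroup5_Spl:
  assumes S: "subgroup S G" "card S = 5" and P: "P \<in> \<Union>S - H" and Q: "Q \<in> \<Union>S - H"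
  shows "Spl (BruP a b P) = Spl (BruP a b Q)"
proof -
  note p = subgroup5_cyc[OF S P] and q = subgroup5_cyc[OF S Q]
  have "cls P \<in> cyc Q" "cls Q \<in> cyc P" using cls_mem_cyc[OF p(1)] cls_mem_cyc[OF q(1)] p(3) q(3) by simp_all
  then show ?thesis using Spl_cong_cyc[OF p(1,2) q(1,2)] Spl_cong_cyc[OF q(1,2) p(1,2)] by (rule_tac equalityI)
qed

lemma subgroup5_nonempty:
  assumes S: "subgroup S G" "card S = 5"
  shows "\<exists>P. P \<in> \<Union>S - H"
proof -
  have "S \<noteq> {H}" using S(2) by auto
  moreover have "S \<noteq> {}" using S(2) by auto
  ultimately obtain X where X: "X \<in> S" "X \<noteq> H" by blast
  have "X \<in> carrier G" using S(1) X(1) subgroup.subset by blast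
  then obtain R where R: "R \<in> carrier E" "X = cls R" unfolding G_carrier by blast
  then have "R \<notin> H" using X cls_eq_H_iff by blast
  then show ?thesis using X R cls_self by blast
qed

lemma Spl_eq_imp_cyc:
  assumes P: "P \<in> carrier E" "P \<notin> H" and Q: "Q \<in> carrier E" "Q \<notin> H"
    and eq: "Spl (BruP a b Q) = Spl (BruP a b P)"
  shows "cls Q \<in> cyc P"
proof -
  obtain i where i: "same_class (gP P ^ i * gP Q) 1" using Spl_eq_imp_same[OF P Q eq] by blast
  \<comment> \<open>The exponent \<open>4 * i\<close> cancels \<open>i\<close> up to the fifth power
    \<open>(gP P ^ i)^5\<close>.\<close>
  have "same_class (gP P ^ (4 * i) * (gP P ^ i * gP Q)) (gP P ^ (4 * i) * 1)" by (rule same_mult[OF same_refl i])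
  moreover have "gP P ^ (4 * i) * (gP P ^ i * gP Q) = (gP P ^ i) ^ 5 * gP Q"
  proof -
    have "4 * i + i = i * 5" by simp
    then show ?thesis by (metis mult.assoc power_add power_mult)
  qed
  moreover have "same_class ((gP P ^ i) ^ 5 * gP Q) (1 * gP Q)"
    using gP_nz[OF P(1)] by (intro same_mult[OF same_fifth same_refl] sf_power[OF sf_N] gP_N) simp
  ultimately have "same_class (gP Q) (gP P ^ (4 * i))" using same_trans[OF same_sym] by (metis mult_1 mult_1_right)
  then have "cls Q = cls P [^]\<^bsub>G\<^esub> (4 * i)" using cls_pow_eq_iff[OF P(1) Q(1)] by blast
  then show ?thesis by (auto simp: cyc_def)
qed

text \<open>Injectivity holds because equal splitting fields put one chosen point into the subgroup
  generated by the other. For surjectivity, P lies in a coset of \<open>cyc P\<close>, and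
  \<open>subgroup5_Spl\<close> compares P with the point chosen by \<open>SOME\<close>.\<close>

lemma bij_subgroups_Spl:
  "bij_betw (\<lambda>S. Spl (BruP a b (SOME P. P \<in> \<Union>S - H)))
     {S. subgroup S G \<and> card S = 5} {Spl (BruP a b P) | P. P \<in> carrier E - H}"
proof -
  define pt where "pt = (\<lambda>S. SOME P. P \<in> \<Union>S - H)"
  have pt: "pt S \<in> \<Union>S - H" if "subgroup S G" "card S = 5" for S
    unfolding pt_def using subgroup5_nonempty[OF that] by (rule someI_ex)
  have "bij_betw (\<lambda>S. Spl (BruP a b (pt S))) {S. subgroup S G \<and> card S = 5} {Spl (BruP a b P) | P. P \<in> carrier E - H}"
    unfolding bij_betw_def
  proof (intro conjI)
    show "inj_on (\<lambda>S. Spl (BruP a b (pt S))) {S. subgroup S G \<and> card S = 5}"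
    proof (rule inj_onI, elim CollectE conjE)
      fix S T assume S: "subgroup S G" "card S = 5" and T: "subgroup T G" "card T = 5"
        and eq: "Spl (BruP a b (pt S)) = Spl (BruP a b (pt T))"
      note s = subgroup5_cyc[OF S pt[OF S]] and t = subgroup5_cyc[OF T pt[OF T]]
      have "cls (pt T) \<in> S" using Spl_eq_imp_cyc[OF s(1,2) t(1,2) eq[symmetric]] s(3) by simp
      then have "pt T \<in> \<Union>S - H" using cls_self[OF t(1)] t(2) by blast
      from subgroup5_cyc(3)[OF S this] t(3) show "S = T" by simp
    qed
    show "(\<lambda>S. Spl (BruP a b (pt S))) ` {S. subgroup S G \<and> card S = 5} = {Spl (BruP a b P) | P. P \<in> carrier E - H}"
    proof (intro equalityI subsetI)
      fix K assume "K \<in> (\<lambda>S. Spl (BruP a b (pt S))) ` {S. subgroup S G \<and> card S = 5}"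
      then obtain S where S: "subgroup S G" "card S = 5" "K = Spl (BruP a b (pt S))" by blast
      have "pt S \<in> carrier E - H" using subgroup5_cyc(1,2)[OF S(1,2) pt[OF S(1,2)]] by blast
      then show "K \<in> {Spl (BruP a b P) | P. P \<in> carrier E - H}" using S(3) by blast
    next
      fix K assume "K \<in> {Spl (BruP a b P) | P. P \<in> carrier E - H}"
      then obtain P where P: "P \<in> carrier E" "P \<notin> H" "K = Spl (BruP a b P)" by blast
      note S = cyc_subgroup_card(1,2)[OF P(1,2)]
      have "P \<in> \<Union>(cyc P) - H" using cls_mem_cyc[OF P(1)] cls_self[OF P(1)] P(2) by blast
      from subgroup5_Spl[OF S this pt[OF S]] have "K = Spl (BruP a b (pt (cyc P)))" using P(3) by simp
      then show "K \<in> (\<lambda>S. Spl (BruP a b (pt S))) ` {S. subgroup S G \<and> card S = 5}" using S by blast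
    qed
  qed
  then show ?thesis unfolding pt_def .
qed

lemma finite_G:
  assumes W: "finite W" "\<And>P. P \<in> carrier E \<Longrightarrow> \<exists>w\<in>W. same_class (gP P) w"
  shows "finite (carrier G)"
proof -
  have "carrier G \<subseteq> (\<lambda>w. {Q \<in> carrier E. same_class (gP Q) w}) ` W"
  proof
    fix X assume "X \<in> carrier G"
    then obtain P where P: "P \<in> carrier E" "X = cls P" unfolding G_carrier by blast
    obtain w where w: "w \<in> W" "same_class (gP P) w" using W(2)[OF P(1)] by blast
    have "same_class x (gP P) \<longleftrightarrow> same_class x w" for x
      using same_trans[OF _ w(2)] same_trans[OF _ same_sym[OF w(2)]] by blast
    then have "X = {Q \<in> carrier E. same_class (gP Q) w}" unfolding P(2) cls_def by simp
    then show "X \<in> (\<lambda>w. {Q \<in> carrier E. same_class (gP Q) w}) ` W" using w(1) by blast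
  qed
  then show ?thesis using W(1) finite_surj by blast
qed

end

theorem mainTheorem1:
  fixes a b :: rat
  assumes "a \<noteq> 0" and "dd a b \<noteq> 0"
    and "nonsingular (EA2 a b) (EA4 a b) (EA6 a b)"
    and "nonsingular (SA2 a b) (SA4 a b) (SA6 a b)"
  shows "(\<forall>P \<in> carrier (Eab a b). P \<noteq> Inf \<longrightarrow>
            (\<not> irreducible (BruP a b P) \<longleftrightarrow> P \<in> phi_img a b))
       \<and> finite (carrier (Eab a b Mod phi_img a b))
       \<and> (\<forall>S. subgroup S (Eab a b Mod phi_img a b) \<and> card S = 5 \<longrightarrow>
            (\<forall>P \<in> \<Union>S - phi_img a b. \<forall>Q \<in> \<Union>S - phi_img a b.
               Spl (BruP a b P) = Spl (BruP a b Q)))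
       \<and> bij_betw (\<lambda>S. Spl (BruP a b (SOME P. P \<in> \<Union>S - phi_img a b)))
            {S. subgroup S (Eab a b Mod phi_img a b) \<and> card S = 5}
            {Spl (BruP a b P) | P. P \<in> carrier (Eab a b) - phi_img a b}"
proof -
  define \<zeta> where "\<zeta> = cis (2 * pi / 5)"
  have "\<zeta>^5 = 1" by (simp add: \<zeta>_def DeMoivre)
  moreover have "\<zeta>^5 - 1 = (\<zeta> - 1) * (1 + \<zeta> + \<zeta>^2 + \<zeta>^3 + \<zeta>^4)" by algebra
  moreover have "\<zeta> \<noteq> 1"
  proof
    assume "\<zeta> = 1"
    then have "Im \<zeta> = 0" by simp
    then have "sin (2 * pi / 5) = 0" by (simp add: \<zeta>_def)
    moreover have "sin (2 * pi / 5) > 0" by (rule sin_gt_zero) (auto simp: field_simps)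
    ultimately show False by simp
  qed
  ultimately have z: "1 + \<zeta> + \<zeta>^2 + \<zeta>^3 + \<zeta>^4 = 0" by simp
  interpret brumer_ns a b \<zeta> "csqrt (of_rat (dd a b))"
    using assms z by unfold_locales simp_all
  obtain W where W: "finite W" "\<forall>P\<in>carrier E. \<exists>w\<in>W. same_class (gP P) w" using finite_classes by blast
  show ?thesis
    using reducible_iff_phi finite_G[OF W(1)] W(2) subgroup5_Spl bij_subgroups_Spl by blast
qed

end
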